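(* Let $\mathfrak{g}=\mathfrak{n}^-\oplus\mathfrak{h}\oplus\mathfrak{n}^+$ be the insertion-elimination Lie algebra over $\mathbb{C}$. Then every Verma module for $\mathfrak{g}$ admits the same central character: for all $\mu_1,\mu_2\in\mathfrak{h}^*$, the central characters $\chi_{\mu_1}$ and $\chi_{\mu_2}$ of the Verma modules $M(\mu_1)$ and $M(\mu_2)$ are equal.
   Context: A rooted tree is a finite nonempty connected undirected graph without cycles, with a distinguished vertex called the root; $\mathbb{T}$ denotes the set of all rooted trees, up to isomorphism. For $t\in\mathbb{T}$, $V(t)$ and $E(t)$ are the sets of vertices and edges and $|t|=|V(t)|$. For $s,t\in\mathbb{T}$ and $v\in V(s)$, $s\cup_v t$ is the rooted tree obtained by joining the root of $t$ to the vertex $v$ of $s$ by a new edge (its root is the root of $s$). For $e\in E(t)$, removing $e$ splits $t$ into two rooted trees: $R_e(t)$, the part containing the root of $t$, and $P_e(t)$, the other part, rooted at its endpoint of $e$. Put $\alpha(t_1,t_2,t_3)=|\{e\in E(t_2): R_e(t_2)=t_3,\ P_e(t_2)=t_1\}|$ and $\beta(t_1,t_2,t_3)=|\{v\in V(t_3): t_1=t_3\cup_v t_2\}|$ (equalities of trees are up to isomorphism). The insertion-elimination Lie algebra $\mathfrak{g}$ is the complex Lie algebra with basis $\{d\}\cup\{D_t^+,D_t^-: t\in\mathbb{T}\}$ and brackets, for $s,t\in\mathbb{T}$: $[D_s^+,D_t^+]=\sum_{r\in\mathbb{T}}(\beta(r,s,t)-\beta(r,t,s))D_r^+$; $[D_s^-,D_t^-]=\sum_{r\in\mathbb{T}}(\alpha(t,r,s)-\alpha(s,r,t))D_r^-$;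 $[D_s^-,D_t^+]=\sum_{r\in\mathbb{T}}\alpha(s,t,r)D_r^+ +\sum_{r\in\mathbb{T}}\beta(s,t,r)D_r^-$ for $s\neq t$; $[D_t^-,D_t^+]=d$; $[d,D_t^-]=-|t|D_t^-$; $[d,D_t^+]=|t|D_t^+$. Let $\mathfrak{n}^{\pm}$ be the span of the $D_t^{\pm}$ ($t\in\mathbb{T}$) and $\mathfrak{h}=\mathbb{C}d$. For $\mu\in\mathfrak{h}^*$ the (highest weight) Verma module is $M(\mu)=U(\mathfrak{g})\otimes_{U(\mathfrak{h}\oplus\mathfrak{n}^+)}\mathbb{C}_\mu$, where $\mathbb{C}_\mu$ is the one-dimensional $\mathfrak{h}\oplus\mathfrak{n}^+$-module with $(h+n)\cdot 1=\mu(h)$ for $h\in\mathfrak{h}$, $n\in\mathfrak{n}^+$. Let $Z(\mathfrak{g})$ be the center of $U(\mathfrak{g})$. A $\mathfrak{g}$-module $V$ admits a central character $\chi:Z(\mathfrak{g})\to\mathbb{C}$ if $zv=\chi(z)v$ for all $z\in Z(\mathfrak{g})$, $v\in V$. It is standard that $M(\mu)$ admits a central character, denoted $\chi_\mu$. *)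

theory Defs
  imports Complex_Main "HOL-Library.Poly_Mapping" "HOL-Library.Groups_Big_Fun"
    "HOL-Library.FuncSet"
begin

section \<open>Rooted trees\<close>

record 'v rgraph =
  verts :: "'v set"
  edges :: "'v set set"
  root :: 'v

definition adj :: "'v set set \<Rightarrow> ('v \<times> 'v) set" where
  "adj E = {(u, v). {u, v} \<in> E}"

definition graph_cycle :: "'v set set \<Rightarrow> 'v list \<Rightarrow> bool" where
  "graph_cycle E c \<longleftrightarrow> length c \<ge> 3 \<and> distinct c \<and>
     (\<forall>i. Suc i < length c \<longrightarrow> {c ! i, c ! Suc i} \<in> E) \<and> {last c, hd c} \<in> E"

definition rooted_tree :: "'v rgraph \<Rightarrow> bool" where
  "rooted_tree G \<longleftrightarrow>
     finite (verts G) \<and> root G \<in> verts G \<and>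
     (\<forall>e\<in>edges G. e \<subseteq> verts G \<and> card e = 2) \<and>
     (\<forall>u\<in>verts G. \<forall>v\<in>verts G. (u, v) \<in> (adj (edges G))\<^sup>*) \<and>
     (\<nexists>c. graph_cycle (edges G) c)"

definition rtree_iso :: "'v rgraph \<Rightarrow> 'w rgraph \<Rightarrow> bool" (infix "\<cong>\<^sub>r" 50) where
  "G \<cong>\<^sub>r H \<longleftrightarrow> (\<exists>f. bij_betw f (verts G) (verts H) \<and>
     (\<lambda>e. f ` e) ` edges G = edges H \<and> f (root G) = root H)"

lemma rtree_iso_refl: "G \<cong>\<^sub>r G"
  unfolding rtree_iso_def by (rule exI[of _ id]) auto

lemma rtree_iso_trans:
  assumes "G \<cong>\<^sub>r H" "H \<cong>\<^sub>r K"
  shows "G \<cong>\<^sub>r K"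
proof -
  obtain f where f: "bij_betw f (verts G) (verts H)"
    "(\<lambda>e. f ` e) ` edges G = edges H" "f (root G) = root H"
    using assms(1) unfolding rtree_iso_def by blast
  obtain g where g: "bij_betw g (verts H) (verts K)"
    "(\<lambda>e. g ` e) ` edges H = edges K" "g (root H) = root K"
    using assms(2) unfolding rtree_iso_def by blast
  have "(\<lambda>e. (g \<circ> f) ` e) ` edges G = edges K"
    unfolding g(2)[symmetric] f(2)[symmetric] by (simp add: image_image image_comp)
  then show ?thesis
    unfolding rtree_iso_def using bij_betw_trans[OF f(1) g(1)] f(3) g(3)
    by (intro exI[of _ "g \<circ> f"]) simp
qed

lemma rtree_iso_sym:
  assumes "rooted_tree G" "G \<cong>\<^sub>r H"
  shows "H \<cong>\<^sub>r G"
proof -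
  obtain f where f: "bij_betw f (verts G) (verts H)"
    "(\<lambda>e. f ` e) ` edges G = edges H" "f (root G) = root H"
    using assms(2) unfolding rtree_iso_def by blast
  let ?g = "inv_into (verts G) f"
  have inv: "?g (f x) = x" if "x \<in> verts G" for x
    using f(1) that by (simp add: bij_betw_inv_into_left)
  have "?g ` (f ` e) = e" if "e \<in> edges G" for e
  proof -
    have "e \<subseteq> verts G" using assms(1) that unfolding rooted_tree_def by blast
    then show ?thesis using inv by (force simp: image_image)
  qed
  then have "(\<lambda>e. ?g ` e) ` edges H = edges G"
    unfolding f(2)[symmetric] by (simp add: image_image)
  moreover have "?g (root H) = root G"
    using f(3) inv assms(1) unfolding rooted_tree_def by metis
  ultimately show ?thesis
    unfolding rtree_iso_def using bij_betw_inv_into[OF f(1)] by blast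
qed

text \<open>A finite rooted tree is isomorphic to one whose vertices are natural numbers, so
  isomorphism classes of the latter are all isomorphism classes.\<close>

quotient_type rtree = "nat rgraph" /
  partial: "\<lambda>G H. rooted_tree G \<and> rooted_tree H \<and> G \<cong>\<^sub>r H"
proof (rule part_equivpI)
  let ?G = "\<lparr>verts = {0}, edges = {}, root = 0\<rparr> :: nat rgraph"
  have "\<not> graph_cycle {} c" for c :: "nat list"
    unfolding graph_cycle_def by auto
  then have "rooted_tree ?G"
    unfolding rooted_tree_def by simp
  then show "\<exists>G :: nat rgraph. rooted_tree G \<and> rooted_tree G \<and> G \<cong>\<^sub>r G"
    using rtree_iso_refl by blast
  show "symp (\<lambda>G H :: nat rgraph. rooted_tree G \<and> rooted_tree H \<and> G \<cong>\<^sub>r H)"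
    by (auto intro!: sympI rtree_iso_sym)
  show "transp (\<lambda>G H :: nat rgraph. rooted_tree G \<and> rooted_tree H \<and> G \<cong>\<^sub>r H)"
    by (auto intro!: transpI intro: rtree_iso_trans)
qed

definition tree_size :: "rtree \<Rightarrow> nat" where
  "tree_size t = card (verts (rep_rtree t))"

text \<open>\<open>s \<union>\<^sub>v t\<close>, formed on the disjoint union of the vertex sets.\<close>

definition graft :: "'v rgraph \<Rightarrow> 'v \<Rightarrow> 'w rgraph \<Rightarrow> ('v + 'w) rgraph" where
  "graft s v t = \<lparr>
     verts = verts s <+> verts t,
     edges = (\<lambda>e. Inl ` e) ` edges s \<union> (\<lambda>e. Inr ` e) ` edges t \<union> {{Inl v, Inr (root t)}},
     root = Inl (root s)\<rparr>"

definition cut_root :: "'v set \<Rightarrow> 'v rgraph \<Rightarrow> 'v rgraph" where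
  "cut_root e t =
     (let W = {v \<in> verts t. (root t, v) \<in> (adj (edges t - {e}))\<^sup>*}
      in \<lparr>verts = W, edges = {e' \<in> edges t - {e}. e' \<subseteq> W}, root = root t\<rparr>)"

definition cut_branch :: "'v set \<Rightarrow> 'v rgraph \<Rightarrow> 'v rgraph" where
  "cut_branch e t =
     (let W = verts t - verts (cut_root e t)
      in \<lparr>verts = W, edges = {e' \<in> edges t - {e}. e' \<subseteq> W}, root = (THE v. v \<in> e \<and> v \<in> W)\<rparr>)"

text \<open>Both counts are independent of the chosen representatives.\<close>

definition alpha :: "rtree \<Rightarrow> rtree \<Rightarrow> rtree \<Rightarrow> nat" where
  "alpha t1 t2 t3 = card {e \<in> edges (rep_rtree t2).
     cut_root e (rep_rtree t2) \<cong>\<^sub>r rep_rtree t3 \<and> cut_branch e (rep_rtree t2) \<cong>\<^sub>r rep_rtree t1}"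

definition beta :: "rtree \<Rightarrow> rtree \<Rightarrow> rtree \<Rightarrow> nat" where
  "beta t1 t2 t3 = card {v \<in> verts (rep_rtree t3).
     rep_rtree t1 \<cong>\<^sub>r graft (rep_rtree t3) v (rep_rtree t2)}"


section \<open>Complex vector spaces and algebras\<close>

class complex_vector_space = ab_group_add +
  fixes scaleC :: "complex \<Rightarrow> 'a \<Rightarrow> 'a" (infixr "*\<^sub>C" 75)
  assumes scaleC_add_right: "a *\<^sub>C (x + y) = a *\<^sub>C x + a *\<^sub>C y"
    and scaleC_add_left: "(a + b) *\<^sub>C x = a *\<^sub>C x + b *\<^sub>C x"
    and scaleC_scaleC: "a *\<^sub>C b *\<^sub>C x = (a * b) *\<^sub>C x"
    and scaleC_one: "1 *\<^sub>C x = x"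

global_interpretation complex_vector:
  vector_space "scaleC :: complex \<Rightarrow> 'a \<Rightarrow> 'a::complex_vector_space"
  by unfold_locales (simp_all add: scaleC_add_right scaleC_add_left scaleC_scaleC scaleC_one)

class complex_algebra_1 = complex_vector_space + ring_1 +
  assumes scaleC_mult_left: "(a *\<^sub>C x) * y = a *\<^sub>C (x * y)"
    and scaleC_mult_right: "x * (a *\<^sub>C y) = a *\<^sub>C (x * y)"

instantiation complex :: complex_algebra_1
begin
definition scaleC_complex :: "complex \<Rightarrow> complex \<Rightarrow> complex" where
  "scaleC_complex a x = a * x"
instance
  by standard (simp_all add: scaleC_complex_def algebra_simps)
end


section \<open>Universal enveloping algebras\<close>

text \<open>The presentation of \<open>U(\<gg>)\<close> only involves the vector space structure and the bracket
  operation, so the class does not record antisymmetry and the Jacobi identity.\<close>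

class lie_bracket = complex_vector_space +
  fixes lie_bracket :: "'a \<Rightarrow> 'a \<Rightarrow> 'a" ("[_, _]\<^sub>L")

datatype 'a free_monoid = Word (letters: "'a list")

instantiation free_monoid :: (type) monoid_add
begin
definition zero_free_monoid :: "'a free_monoid" where
  "0 = Word []"
definition plus_free_monoid :: "'a free_monoid \<Rightarrow> 'a free_monoid \<Rightarrow> 'a free_monoid" where
  "v + w = Word (letters v @ letters w)"
instance
  by standard (simp_all add: zero_free_monoid_def plus_free_monoid_def)
end

text \<open>The free associative algebra on the set \<open>'a\<close>; its product is the convolution product of
  finitely supported functions on words.\<close>

type_synonym 'a free_algebra = "'a free_monoid \<Rightarrow>\<^sub>0 complex"

definition letter :: "'a \<Rightarrow> 'a free_algebra" where
  "letter x = Poly_Mapping.single (Word [x]) 1"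

definition scalar :: "complex \<Rightarrow> 'a free_algebra" where
  "scalar a = Poly_Mapping.single 0 a"

text \<open>Modulo the first two families of relations, the free algebra on the set \<open>\<gg>\<close> is the tensor
  algebra of the vector space \<open>\<gg>\<close>.\<close>

inductive_set uea_ideal :: "('a::lie_bracket) free_algebra set" where
  add_rel: "letter (x + y) - (letter x + letter y) \<in> uea_ideal"
| scale_rel: "letter (a *\<^sub>C x) - scalar a * letter x \<in> uea_ideal"
| bracket_rel: "letter [x, y]\<^sub>L - (letter x * letter y - letter y * letter x) \<in> uea_ideal"
| zero: "0 \<in> uea_ideal"
| add: "p \<in> uea_ideal \<Longrightarrow> q \<in> uea_ideal \<Longrightarrow> p + q \<in> uea_ideal"
| mult: "p \<in> uea_ideal \<Longrightarrow> a * p * b \<in> uea_ideal"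

lemma uea_ideal_mult_left: "p \<in> uea_ideal \<Longrightarrow> a * p \<in> uea_ideal"
  using uea_ideal.mult[of p a 1] by simp

lemma uea_ideal_mult_right: "p \<in> uea_ideal \<Longrightarrow> p * a \<in> uea_ideal"
  using uea_ideal.mult[of p 1 a] by simp

lemma uea_ideal_uminus: "p \<in> uea_ideal \<Longrightarrow> - p \<in> uea_ideal"
  using uea_ideal_mult_left[of p "- 1"] by simp

quotient_type (overloaded) 'a uea = "('a::lie_bracket) free_algebra" /
  "\<lambda>p q. p - q \<in> uea_ideal"
proof (rule equivpI)
  show "reflp (\<lambda>p q :: 'a free_algebra. p - q \<in> uea_ideal)"
    by (simp add: reflp_def uea_ideal.zero)
  show "symp (\<lambda>p q :: 'a free_algebra. p - q \<in> uea_ideal)"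
    using uea_ideal_uminus by (fastforce intro!: sympI)
  show "transp (\<lambda>p q :: 'a free_algebra. p - q \<in> uea_ideal)"
  proof (rule transpI)
    fix p q r :: "'a free_algebra"
    assume "p - q \<in> uea_ideal" "q - r \<in> uea_ideal"
    then have "(p - q) + (q - r) \<in> uea_ideal" by (rule uea_ideal.add)
    then show "p - r \<in> uea_ideal" by simp
  qed
qed

lemma free_algebra_induct [case_names zero single add]:
  fixes p :: "'a free_algebra"
  assumes "P 0" "\<And>k b. P (Poly_Mapping.single k b)" "\<And>f g. P f \<Longrightarrow> P g \<Longrightarrow> P (f + g)"
  shows "P p"
proof (induction p rule: update_induct)
  case const
  show ?case by (rule assms(1))
next
  case (update f k b)
  have "Poly_Mapping.update k b f = f + Poly_Mapping.single k b"
    using update(1)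
    by (intro poly_mapping_eqI)
      (auto simp: lookup_update lookup_add lookup_single in_keys_iff when_def)
  then show ?case using assms update(3) by simp
qed

lemma scalar_commute: "scalar a * p = p * scalar a"
  by (induction p rule: free_algebra_induct)
    (simp_all add: scalar_def mult_single mult.commute distrib_left distrib_right)

lemma scalar_simps:
  "scalar (a + b) = scalar a + scalar b" "scalar a * scalar b = scalar (a * b)" "scalar 1 = 1"
  by (simp_all add: scalar_def single_add mult_single)

lemma scalar_assoc: "p * (scalar a * q) = scalar a * (p * q)"
  by (metis mult.assoc scalar_commute)

lemma lookup_mult_empty_word:
  fixes p q :: "'a free_algebra"
  shows "Poly_Mapping.lookup (p * q) 0 = Poly_Mapping.lookup p 0 * Poly_Mapping.lookup q 0"
proof (induction p rule: free_algebra_induct)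
  case (single k b)
  show ?case
  proof (induction q rule: free_algebra_induct)
    case (single l c)
    show ?case
      by (cases k; cases l) (auto simp: mult_single lookup_single zero_free_monoid_def
          plus_free_monoid_def when_def)
  qed (simp_all add: distrib_left lookup_add)
qed (simp_all add: distrib_right lookup_add)

lemma one_notin_uea_ideal: "1 \<notin> (uea_ideal :: ('a::lie_bracket) free_algebra set)"
proof
  have letter: "Poly_Mapping.lookup (letter x) 0 = 0" for x :: 'a
    by (simp add: letter_def lookup_single zero_free_monoid_def)
  have "Poly_Mapping.lookup p 0 = 0" if "p \<in> uea_ideal" for p :: "'a free_algebra"
    using that
    by induction (simp_all add: letter lookup_mult_empty_word lookup_add lookup_minus)
  moreover assume "1 \<in> (uea_ideal :: 'a free_algebra set)"
  ultimately show False by fastforce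
qed

instantiation uea :: (lie_bracket) complex_algebra_1
begin

lift_definition zero_uea :: "'a uea" is 0 .

lift_definition one_uea :: "'a uea" is 1 .

lift_definition plus_uea :: "'a uea \<Rightarrow> 'a uea \<Rightarrow> 'a uea" is "(+)"
proof -
  fix p p' q q' :: "'a free_algebra"
  assume "p - p' \<in> uea_ideal" "q - q' \<in> uea_ideal"
  then have "(p - p') + (q - q') \<in> uea_ideal" by (rule uea_ideal.add)
  then show "p + q - (p' + q') \<in> uea_ideal" by (simp add: algebra_simps)
qed

lift_definition uminus_uea :: "'a uea \<Rightarrow> 'a uea" is uminus
proof -
  fix p p' :: "'a free_algebra"
  assume "p - p' \<in> uea_ideal"
  then show "- p - - p' \<in> uea_ideal" using uea_ideal_uminus by fastforce
qed

lift_definition minus_uea :: "'a uea \<Rightarrow> 'a uea \<Rightarrow> 'a uea" is "(-)"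
proof -
  fix p p' q q' :: "'a free_algebra"
  assume "p - p' \<in> uea_ideal" "q - q' \<in> uea_ideal"
  then have "(p - p') + - (q - q') \<in> uea_ideal" by (intro uea_ideal.add uea_ideal_uminus)
  then show "p - q - (p' - q') \<in> uea_ideal" by (simp add: algebra_simps)
qed

lift_definition times_uea :: "'a uea \<Rightarrow> 'a uea \<Rightarrow> 'a uea" is "(*)"
proof -
  fix p p' q q' :: "'a free_algebra"
  assume "p - p' \<in> uea_ideal" "q - q' \<in> uea_ideal"
  then have "(p - p') * q + p' * (q - q') \<in> uea_ideal"
    by (intro uea_ideal.add uea_ideal_mult_left uea_ideal_mult_right)
  then show "p * q - p' * q' \<in> uea_ideal" by (simp add: algebra_simps)
qed

lift_definition scaleC_uea :: "complex \<Rightarrow> 'a uea \<Rightarrow> 'a uea" is "\<lambda>a p. scalar a * p"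
proof -
  fix a :: complex and p p' :: "'a free_algebra"
  assume "p - p' \<in> uea_ideal"
  then have "scalar a * (p - p') \<in> uea_ideal" by (rule uea_ideal_mult_left)
  then show "scalar a * p - scalar a * p' \<in> uea_ideal" by (simp add: algebra_simps)
qed

instance
proof
  fix u v w :: "'a uea" and a b :: complex
  show "u + v + w = u + (v + w)" "u * v * w = u * (v * w)" "u * (v + w) = u * v + u * w"
    by (transfer; simp add: algebra_simps uea_ideal.zero)+
  show "u + v = v + u" "0 + u = u" "- u + u = 0" "u - v = u + - v"
    "(u + v) * w = u * w + v * w" "1 * u = u" "u * 1 = u"
    by (transfer; simp add: algebra_simps uea_ideal.zero)+
  show "(a + b) *\<^sub>C u = a *\<^sub>C u + b *\<^sub>C u" "a *\<^sub>C (u + v) = a *\<^sub>C u + a *\<^sub>C v"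
    by (transfer; simp add: scalar_simps algebra_simps uea_ideal.zero)+
  show "a *\<^sub>C b *\<^sub>C u = (a * b) *\<^sub>C u" "1 *\<^sub>C u = u"
    by (transfer; simp add: scalar_simps uea_ideal.zero flip: mult.assoc)+
  show "(a *\<^sub>C u) * v = a *\<^sub>C (u * v)" "u * (a *\<^sub>C v) = a *\<^sub>C (u * v)"
    by (transfer; simp add: mult.assoc scalar_assoc uea_ideal.zero)+
  show "(0::'a uea) \<noteq> 1"
    by transfer (metis diff_0 minus_minus one_notin_uea_ideal uea_ideal_uminus)
qed

end

definition uea_of :: "'a::lie_bracket \<Rightarrow> 'a uea" where
  "uea_of x = abs_uea (letter x)"

text \<open>For a linear map \<open>f\<close> from \<open>\<gg>\<close> into an associative algebra with
  \<open>f [x, y] = f x * f y - f y * f x\<close>, this is the unique extension of \<open>f\<close> to a homomorphism of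
  unital algebras on \<open>U(\<gg>)\<close>; it is only used for such \<open>f\<close>.\<close>

definition uea_extend :: "('a::lie_bracket \<Rightarrow> 'b::complex_algebra_1) \<Rightarrow> 'a uea \<Rightarrow> 'b" where
  "uea_extend f u = (\<Sum>w\<in>Poly_Mapping.keys (rep_uea u).
     Poly_Mapping.lookup (rep_uea u) w *\<^sub>C prod_list (map f (letters w)))"

definition uea_center :: "('a::lie_bracket) uea set" where
  "uea_center = {z. \<forall>u. z * u = u * z}"

text \<open>A \<open>\<gg>\<close>-module is a \<open>U(\<gg>)\<close>-module, with carrier \<open>V\<close> and action \<open>act\<close>; the scalar \<open>c\<close> acts
  on it as the element \<open>c *\<^sub>C 1\<close> of \<open>U(\<gg>)\<close>.\<close>

definition admits_central_character ::
    "'v set \<Rightarrow> (('a::lie_bracket) uea \<Rightarrow> 'v \<Rightarrow> 'v) \<Rightarrow> ('a uea \<Rightarrow> complex) \<Rightarrow> bool" where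
  "admits_central_character V act \<chi> \<longleftrightarrow>
     (\<forall>z\<in>uea_center. \<forall>v\<in>V. act z v = act (\<chi> z *\<^sub>C 1) v)"


section \<open>Tensor products over a noncommutative ring\<close>

text \<open>\<open>A \<otimes>\<^bsub>S\<^esub> B\<close> for a right \<open>S\<close>-module \<open>A\<close> and a left \<open>S\<close>-module \<open>B\<close>, as the quotient of the free
  abelian group on \<open>A \<times> B\<close>.\<close>

inductive_set tensor_null ::
    "('a::ab_group_add \<Rightarrow> 's \<Rightarrow> 'a) \<Rightarrow> ('s \<Rightarrow> 'b::ab_group_add \<Rightarrow> 'b) \<Rightarrow> ('a \<times> 'b \<Rightarrow>\<^sub>0 int) set"
  for ract :: "'a \<Rightarrow> 's \<Rightarrow> 'a" and lact :: "'s \<Rightarrow> 'b \<Rightarrow> 'b" where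
  add_left: "frag_of (a + a', b) - (frag_of (a, b) + frag_of (a', b)) \<in> tensor_null ract lact"
| add_right: "frag_of (a, b + b') - (frag_of (a, b) + frag_of (a, b')) \<in> tensor_null ract lact"
| balanced: "frag_of (ract a s, b) - frag_of (a, lact s b) \<in> tensor_null ract lact"
| zero: "0 \<in> tensor_null ract lact"
| diff: "p \<in> tensor_null ract lact \<Longrightarrow> q \<in> tensor_null ract lact \<Longrightarrow> p - q \<in> tensor_null ract lact"

definition tensor_rel ::
    "('a::ab_group_add \<Rightarrow> 's \<Rightarrow> 'a) \<Rightarrow> ('s \<Rightarrow> 'b::ab_group_add \<Rightarrow> 'b) \<Rightarrow> ('a \<times> 'b \<Rightarrow>\<^sub>0 int) rel" where
  "tensor_rel ract lact = {(p, q). p - q \<in> tensor_null ract lact}"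

definition tensor_carrier ::
    "('a::ab_group_add \<Rightarrow> 's \<Rightarrow> 'a) \<Rightarrow> ('s \<Rightarrow> 'b::ab_group_add \<Rightarrow> 'b) \<Rightarrow> ('a \<times> 'b \<Rightarrow>\<^sub>0 int) set set" where
  "tensor_carrier ract lact = UNIV // tensor_rel ract lact"

text \<open>The left action \<open>u (a \<otimes> b) = (u a) \<otimes> b\<close> when \<open>A\<close> is a ring.\<close>

definition tensor_act ::
    "('a::ring_1 \<Rightarrow> 's \<Rightarrow> 'a) \<Rightarrow> ('s \<Rightarrow> 'b::ab_group_add \<Rightarrow> 'b) \<Rightarrow> 'a \<Rightarrow>
     ('a \<times> 'b \<Rightarrow>\<^sub>0 int) set \<Rightarrow> ('a \<times> 'b \<Rightarrow>\<^sub>0 int) set" where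
  "tensor_act ract lact u X =
     tensor_rel ract lact `` (frag_extend (\<lambda>(a, b). frag_of (u * a, b)) ` X)"


section \<open>The insertion-elimination Lie algebra\<close>

datatype ie_basis = D | Dplus rtree | Dminus rtree

typedef ie_alg = "UNIV :: (ie_basis \<Rightarrow>\<^sub>0 complex) set"
  morphisms coords of_coords ..

setup_lifting type_definition_ie_alg

lemma lookup_map_times:
  "Poly_Mapping.lookup (Poly_Mapping.map ((*) a) p) k = a * Poly_Mapping.lookup p k"
  for a :: complex
  by (simp add: map.rep_eq when_def)

instantiation ie_alg :: complex_vector_space
begin

lift_definition zero_ie_alg :: ie_alg is 0 .
lift_definition plus_ie_alg :: "ie_alg \<Rightarrow> ie_alg \<Rightarrow> ie_alg" is "(+)" .
lift_definition uminus_ie_alg :: "ie_alg \<Rightarrow> ie_alg" is uminus .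
lift_definition minus_ie_alg :: "ie_alg \<Rightarrow> ie_alg \<Rightarrow> ie_alg" is "(-)" .
lift_definition scaleC_ie_alg :: "complex \<Rightarrow> ie_alg \<Rightarrow> ie_alg"
  is "\<lambda>a. Poly_Mapping.map ((*) a)" .

instance
proof
  fix x y z :: ie_alg and a b :: complex
  show "x + y + z = x + (y + z)" "x + y = y + x" "0 + x = x" "- x + x = 0" "x - y = x + - y"
    by (transfer, simp add: add.assoc, transfer, rule add.commute, (transfer, simp)+)
  show "a *\<^sub>C (x + y) = a *\<^sub>C x + a *\<^sub>C y" "(a + b) *\<^sub>C x = a *\<^sub>C x + b *\<^sub>C x"
    by (transfer; rule poly_mapping_eqI; simp add: lookup_add lookup_map_times algebra_simps)+
  show "a *\<^sub>C b *\<^sub>C x = (a * b) *\<^sub>C x" "1 *\<^sub>C x = x"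
    by (transfer; rule poly_mapping_eqI; simp add: lookup_map_times)+
qed

end

definition ie_gen :: "ie_basis \<Rightarrow> ie_alg" where
  "ie_gen b = of_coords (Poly_Mapping.single b 1)"

text \<open>Each sum over \<open>rtree\<close> has only finitely many nonzero terms.\<close>

fun ie_basis_bracket :: "ie_basis \<Rightarrow> ie_basis \<Rightarrow> ie_alg" where
  "ie_basis_bracket (Dplus s) (Dplus t) =
     Sum_any (\<lambda>r. (of_nat (beta r s t) - of_nat (beta r t s)) *\<^sub>C ie_gen (Dplus r))"
| "ie_basis_bracket (Dminus s) (Dminus t) =
     Sum_any (\<lambda>r. (of_nat (alpha t r s) - of_nat (alpha s r t)) *\<^sub>C ie_gen (Dminus r))"
| "ie_basis_bracket (Dminus s) (Dplus t) =
     (if s = t then ie_gen D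
      else Sum_any (\<lambda>r. of_nat (alpha s t r) *\<^sub>C ie_gen (Dplus r))
         + Sum_any (\<lambda>r. of_nat (beta s t r) *\<^sub>C ie_gen (Dminus r)))"
| "ie_basis_bracket (Dplus t) (Dminus s) =
     - (if s = t then ie_gen D
        else Sum_any (\<lambda>r. of_nat (alpha s t r) *\<^sub>C ie_gen (Dplus r))
           + Sum_any (\<lambda>r. of_nat (beta s t r) *\<^sub>C ie_gen (Dminus r)))"
| "ie_basis_bracket D (Dminus t) = - of_nat (tree_size t) *\<^sub>C ie_gen (Dminus t)"
| "ie_basis_bracket (Dminus t) D = of_nat (tree_size t) *\<^sub>C ie_gen (Dminus t)"
| "ie_basis_bracket D (Dplus t) = of_nat (tree_size t) *\<^sub>C ie_gen (Dplus t)"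
| "ie_basis_bracket (Dplus t) D = - of_nat (tree_size t) *\<^sub>C ie_gen (Dplus t)"
| "ie_basis_bracket D D = 0"

instantiation ie_alg :: lie_bracket
begin

definition lie_bracket_ie_alg :: "ie_alg \<Rightarrow> ie_alg \<Rightarrow> ie_alg" where
  "[x, y]\<^sub>L = (\<Sum>a\<in>Poly_Mapping.keys (coords x). \<Sum>b\<in>Poly_Mapping.keys (coords y).
     (Poly_Mapping.lookup (coords x) a * Poly_Mapping.lookup (coords y) b)
       *\<^sub>C ie_basis_bracket a b)"

instance ..

end

definition cartan :: "ie_alg set" where
  "cartan = complex_vector.span {ie_gen D}"

definition nplus :: "ie_alg set" where
  "nplus = complex_vector.span (range (\<lambda>t. ie_gen (Dplus t)))"

definition borel :: "ie_alg set" where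
  "borel = {h + n | h n. h \<in> cartan \<and> n \<in> nplus}"

lemma subspace_borel: "complex_vector.subspace borel"
  unfolding borel_def cartan_def nplus_def
  by (intro complex_vector.subspace_sums complex_vector.subspace_span)

lemma borelI: "h \<in> cartan \<Longrightarrow> n \<in> nplus \<Longrightarrow> h + n \<in> borel"
  unfolding borel_def by blast

lemma ie_gen_in_borel: "ie_gen D \<in> borel" "ie_gen (Dplus t) \<in> borel"
proof -
  have "ie_gen D \<in> cartan" "0 \<in> cartan" "ie_gen (Dplus t) \<in> nplus" "0 \<in> nplus"
    unfolding cartan_def nplus_def
    by (auto intro: complex_vector.span_base complex_vector.span_zero)
  from borelI[OF this(1,4)] borelI[OF this(2,3)]
  show "ie_gen D \<in> borel" "ie_gen (Dplus t) \<in> borel" by simp_all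
qed

lemma subspace_coord_zero:
  "complex_vector.subspace {x. Poly_Mapping.lookup (coords x) b = 0}"
  by (auto intro!: complex_vector.subspaceI simp: zero_ie_alg.rep_eq plus_ie_alg.rep_eq
      scaleC_ie_alg.rep_eq lookup_add lookup_map_times)

lemma borel_no_Dminus:
  assumes "x \<in> borel"
  shows "Poly_Mapping.lookup (coords x) (Dminus t) = 0"
proof -
  let ?S = "{x. Poly_Mapping.lookup (coords x) (Dminus t) = 0}"
  have gen: "Poly_Mapping.lookup (coords (ie_gen b)) b' = (1 when b = b')" for b b'
    by (simp add: ie_gen_def of_coords_inverse lookup_single)
  have "cartan \<subseteq> ?S" "nplus \<subseteq> ?S"
    unfolding cartan_def nplus_def
    by (rule complex_vector.span_minimal[OF _ subspace_coord_zero]; auto simp: gen)+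
  moreover obtain h n where "x = h + n" "h \<in> cartan" "n \<in> nplus"
    using assms unfolding borel_def by blast
  ultimately have "x \<in> ?S"
    using complex_vector.subspace_add[OF subspace_coord_zero, of h "Dminus t" n] by blast
  then show ?thesis by simp
qed

lemma bracket_in_borel:
  assumes "x \<in> borel" "y \<in> borel"
  shows "[x, y]\<^sub>L \<in> borel"
proof -
  note B = subspace_borel ie_gen_in_borel
  have key: "b = D \<or> (\<exists>t. b = Dplus t)" if "z \<in> borel" "b \<in> Poly_Mapping.keys (coords z)" for z b
    using borel_no_Dminus[OF that(1)] that(2) by (cases b) (auto simp: in_keys_iff)
  have Dplus: "Sum_any (\<lambda>r. f r *\<^sub>C ie_gen (Dplus r)) \<in> borel" for f :: "rtree \<Rightarrow> complex"
    unfolding Sum_any.expand_set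
    by (rule complex_vector.subspace_sum[OF B(1)], rule complex_vector.subspace_scale[OF B(1)],
        rule B(3))
  have scale: "c *\<^sub>C ie_gen (Dplus t) \<in> borel" for c t
    by (rule complex_vector.subspace_scale[OF B(1) B(3)])
  have basis: "ie_basis_bracket a b \<in> borel"
    if a: "a = D \<or> (\<exists>t. a = Dplus t)" and b: "b = D \<or> (\<exists>t. b = Dplus t)" for a b
    using a
  proof (elim disjE exE)
    assume "a = D"
    with b show ?thesis
      by (elim disjE exE)
        (simp_all only: ie_basis_bracket.simps scale complex_vector.subspace_0[OF B(1)])
  next
    fix s assume "a = Dplus s"
    with b show ?thesis
      by (elim disjE exE) (simp_all only: ie_basis_bracket.simps scale Dplus)
  qed
  show ?thesis
    unfolding lie_bracket_ie_alg_def
    by (intro complex_vector.subspace_sum[OF B(1)] complex_vector.subspace_scale[OF B(1)]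
        basis key[OF assms(1)] key[OF assms(2)])
qed

text \<open>The subalgebra \<open>\<hh> \<oplus> \<nn>\<^sup>+\<close>, as a type in order to form its enveloping algebra.\<close>

typedef borel_alg = borel
  morphisms of_borel to_borel
  using complex_vector.subspace_0[OF subspace_borel] by blast

setup_lifting type_definition_borel_alg

instantiation borel_alg :: lie_bracket
begin

lift_definition zero_borel_alg :: borel_alg is 0
  using complex_vector.subspace_0[OF subspace_borel] .
lift_definition plus_borel_alg :: "borel_alg \<Rightarrow> borel_alg \<Rightarrow> borel_alg" is "(+)"
  using complex_vector.subspace_add[OF subspace_borel] .
lift_definition uminus_borel_alg :: "borel_alg \<Rightarrow> borel_alg" is uminus
  using complex_vector.subspace_neg[OF subspace_borel] .
lift_definition minus_borel_alg :: "borel_alg \<Rightarrow> borel_alg \<Rightarrow> borel_alg" is "(-)"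
  using complex_vector.subspace_diff[OF subspace_borel] .
lift_definition scaleC_borel_alg :: "complex \<Rightarrow> borel_alg \<Rightarrow> borel_alg" is scaleC
  using complex_vector.subspace_scale[OF subspace_borel] .
lift_definition lie_bracket_borel_alg :: "borel_alg \<Rightarrow> borel_alg \<Rightarrow> borel_alg" is lie_bracket
  by (rule bracket_in_borel)

instance
  by standard
    (transfer; simp add: scaleC_add_right scaleC_add_left scaleC_scaleC scaleC_one)+

end


section \<open>Verma modules and their central characters\<close>

text \<open>The dual space \<open>\<hh>\<^sup>*\<close>; the values of its elements outside \<open>\<hh>\<close> are irrelevant.\<close>

definition cartan_dual :: "(ie_alg \<Rightarrow> complex) set" where
  "cartan_dual = {\<mu>. (\<forall>x\<in>cartan. \<forall>y\<in>cartan. \<mu> (x + y) = \<mu> x + \<mu> y) \<and>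
     (\<forall>c. \<forall>x\<in>cartan. \<mu> (c *\<^sub>C x) = c * \<mu> x)}"

text \<open>The scalar \<open>\<mu> h\<close> by which \<open>h + n\<close> acts on \<open>\<complex>\<^bsub>\<mu>\<^esub>\<close>.\<close>

definition borel_char :: "(ie_alg \<Rightarrow> complex) \<Rightarrow> borel_alg \<Rightarrow> complex" where
  "borel_char \<mu> x = \<mu> (THE h. h \<in> cartan \<and> (\<exists>n\<in>nplus. of_borel x = h + n))"

text \<open>\<open>U(\<gg>)\<close> as a right and \<open>\<complex>\<^bsub>\<mu>\<^esub>\<close> as a left module over \<open>U(\<hh> \<oplus> \<nn>\<^sup>+)\<close>.\<close>

definition borel_ract :: "ie_alg uea \<Rightarrow> borel_alg uea \<Rightarrow> ie_alg uea" where
  "borel_ract u w = u * uea_extend (\<lambda>x. uea_of (of_borel x)) w"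

definition borel_lact :: "(ie_alg \<Rightarrow> complex) \<Rightarrow> borel_alg uea \<Rightarrow> complex \<Rightarrow> complex" where
  "borel_lact \<mu> w c = uea_extend (borel_char \<mu>) w * c"

definition verma :: "(ie_alg \<Rightarrow> complex) \<Rightarrow> (ie_alg uea \<times> complex \<Rightarrow>\<^sub>0 int) set set" where
  "verma \<mu> = tensor_carrier borel_ract (borel_lact \<mu>)"

definition verma_act :: "(ie_alg \<Rightarrow> complex) \<Rightarrow> ie_alg uea \<Rightarrow>
    (ie_alg uea \<times> complex \<Rightarrow>\<^sub>0 int) set \<Rightarrow> (ie_alg uea \<times> complex \<Rightarrow>\<^sub>0 int) set" where
  "verma_act \<mu> = tensor_act borel_ract (borel_lact \<mu>)"

text \<open>Functions on \<open>Z(\<gg>)\<close> are represented by functions on \<open>U(\<gg>)\<close> that are \<open>undefined\<close> outside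
  \<open>Z(\<gg>)\<close>.\<close>

definition is_verma_character :: "(ie_alg \<Rightarrow> complex) \<Rightarrow> (ie_alg uea \<Rightarrow> complex) \<Rightarrow> bool" where
  "is_verma_character \<mu> \<chi> \<longleftrightarrow> \<chi> \<in> uea_center \<rightarrow>\<^sub>E UNIV \<and>
     admits_central_character (verma \<mu>) (verma_act \<mu>) \<chi>"

definition verma_character :: "(ie_alg \<Rightarrow> complex) \<Rightarrow> ie_alg uea \<Rightarrow> complex" where
  "verma_character \<mu> = (THE \<chi>. is_verma_character \<mu> \<chi>)"

end

theory Submission
  imports Defs "HOL-Library.Multiset" "HOL-Computational_Algebra.Polynomial"
begin

text \<open>
  A central element can be written as \<open>z = q(d) + n\<close> with \<open>n \<in> U(\<gg>) \<nn>\<^sup>+\<close>, because its component of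
  weight \<open>0\<close> under \<open>ad d\<close> is all of it. As \<open>\<nn>\<^sup>+\<close> kills the highest weight vector, \<open>z\<close> acts on
  \<open>M(\<mu>)\<close> as \<open>q(\<mu>(d))\<close>. It remains to see that \<open>M(\<mu>)\<close> is not zero and that \<open>q\<close> is constant.

  The algebra \<open>\<gg>\<close> acts on the span of all trees by inserting and eliminating branches. Adding a
  root identifies forests with trees, so this is an action on the polynomial ring in the variables
  \<open>x\<^sub>t\<close>, where \<open>D\<^sub>s\<^sup>+\<close>, \<open>D\<^sub>s\<^sup>-\<close> and \<open>d\<close> become \<open>x\<^sub>s + \<partial>\<^sub>s\<^sup>+\<close>, \<open>\<partial>/\<partial>x\<^sub>s + \<partial>\<^sub>s\<^sup>-\<close> and \<open>1 + deg\<close>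
  for derivations \<open>\<partial>\<^sub>s\<^sup>\<plusminus>\<close>. Replacing \<open>x\<^sub>s\<close> by \<open>\<lambda> x\<^sub>s\<close> and \<open>1\<close> by \<open>\<lambda>\<close> preserves all relations. In the dual of this
  module, the constant coefficient is a highest weight vector \<open>e\<close> of weight \<open>-\<lambda>\<close>, hence
  \<open>M(-\<lambda>) \<noteq> 0\<close>. For \<open>\<lambda> \<noteq> 0\<close> and \<open>n > 0\<close> there is also a functional \<open>f\<close> of weight \<open>-\<lambda> - n\<close>, supported
  on products of ladders, which all \<open>D\<^sub>s\<^sup>+\<close> kill except that for the ladder \<open>s\<close> with \<open>n\<close> vertices,
  and this one maps \<open>f\<close> to \<open>e\<close>. If \<open>n\<close> exceeds the size of all trees occurring in \<open>z\<close>, then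
  \<open>z f = q(-\<lambda> - n) f\<close>; applying \<open>D\<^sub>s\<^sup>+\<close> gives \<open>q(-\<lambda>) = q(-\<lambda> - n)\<close>, so \<open>q\<close> is constant.
\<close>

section \<open>Trees with labelled vertices\<close>

text \<open>The counts \<alpha> and \<beta> refer to vertices and edges of chosen graphs, while the
  action is a recursion over the children of a root. Labelled ordered trees mediate: they name the
  vertices of a graph, allow recursion, and give the isomorphism class once labels and order are
  forgotten. The relations hold because all operators except multiplications are derivations, so
  that commutators are determined by their values on trees. A tree is a forest with a root added,
  and adding the root turns each operator into the same operator on the forest plus one term for the
  new root; this yields an induction. As multiplications commute, both sides of each relation have
  degree at most one in \<lambda>. The constant terms agree by the relations between the
  derivations, so validity for \<lambda> = 1 extends to all \<lambda>. One \<lambda> compares q at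
  two points only. But n depends on z alone, so varying \<lambda> gives q the period n away from 0;
  \<lambda> = 0 drops out as the coefficients of f involve 1/\<lambda>. Ladders serve because
  inserting a ladder into a ladder produces exactly one ladder, which makes the insertions
  countable.\<close>

datatype 'v ltree = LNode (ltree_root: 'v) (ltree_children: "'v ltree list")

text \<open>Children form a multiset, so that equality of these trees is isomorphism of rooted
  trees.\<close>

datatype tree = Node "tree multiset"

primrec ltree_verts :: "'v ltree \<Rightarrow> 'v list" where
  "ltree_verts (LNode v ts) = v # concat (map ltree_verts ts)"

text \<open>The pairs keep the recursive call inside \<open>map\<close>, as recursion through a list
  demands; \<open>ltree_edges_LNode\<close> is the intended equation. The later recursions with
  \<open>fst\<close> and \<open>snd\<close> have this form for the same reason.\<close>

primrec ltree_edges :: "'v ltree \<Rightarrow> 'v set set" where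
  "ltree_edges (LNode v ts) =
     (\<Union>p\<in>set (map (\<lambda>c. (ltree_root c, ltree_edges c)) ts). insert {v, fst p} (snd p))"

primrec shape :: "'v ltree \<Rightarrow> tree" where
  "shape (LNode v ts) = Node (mset (map shape ts))"

text \<open>Grafts at every vertex labelled \<open>v\<close>, without entering \<open>s\<close>;
  distinct labels make this a single vertex.\<close>

primrec ltree_graft :: "'v \<Rightarrow> 'v ltree \<Rightarrow> 'v ltree \<Rightarrow> 'v ltree" where
  "ltree_graft v s (LNode u ts) =
     LNode u ((if u = v then [s] else []) @ map (ltree_graft v s) ts)"

text \<open>Each edge is listed by its upper endpoint and the subtree below it.\<close>

primrec ltree_subtrees :: "'v ltree \<Rightarrow> ('v \<times> 'v ltree) list" where
  "ltree_subtrees (LNode v ts) =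
     concat (map (\<lambda>p. (v, fst p) # snd p) (map (\<lambda>c. (c, ltree_subtrees c)) ts))"

primrec ltree_prune :: "'v \<Rightarrow> 'v ltree \<Rightarrow> 'v ltree" where
  "ltree_prune w (LNode u ts) =
     LNode u (map snd (filter (\<lambda>p. ltree_root (fst p) \<noteq> w) (map (\<lambda>c. (c, ltree_prune w c)) ts)))"

lemma ltree_edges_LNode [simp]:
  "ltree_edges (LNode v ts) = (\<Union>c\<in>set ts. insert {v, ltree_root c} (ltree_edges c))"
  by simp

lemma ltree_subtrees_LNode [simp]:
  "ltree_subtrees (LNode v ts) = concat (map (\<lambda>c. (v, c) # ltree_subtrees c) ts)"
  by (simp add: comp_def)

lemma ltree_prune_LNode [simp]:
  "ltree_prune w (LNode u ts) =
     LNode u (map (ltree_prune w) (filter (\<lambda>c. ltree_root c \<noteq> w) ts))"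
  by (simp add: filter_map comp_def)

declare ltree_edges.simps [simp del] ltree_subtrees.simps [simp del] ltree_prune.simps [simp del]

definition ltree_graph :: "'v ltree \<Rightarrow> 'v rgraph" where
  "ltree_graph t = \<lparr>verts = set (ltree_verts t), edges = ltree_edges t, root = ltree_root t\<rparr>"

lemma ltree_graph_simps [simp]:
  "verts (ltree_graph t) = set (ltree_verts t)" "edges (ltree_graph t) = ltree_edges t"
  "root (ltree_graph t) = ltree_root t"
  by (simp_all add: ltree_graph_def)

lemma ltree_root_in_verts [simp]: "ltree_root t \<in> set (ltree_verts t)"
  by (cases t) simp

lemma ltree_verts_map: "ltree_verts (map_ltree f t) = map f (ltree_verts t)"
  by (induction t) (simp add: map_concat comp_def cong: map_cong)

lemma ltree_root_map: "ltree_root (map_ltree f t) = f (ltree_root t)"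
  by (cases t) simp

lemma ltree_edges_map: "ltree_edges (map_ltree f t) = (\<lambda>e. f ` e) ` ltree_edges t"
  by (induction t) (simp add: image_UN ltree_root_map)

lemma shape_map [simp]: "shape (map_ltree f t) = shape t"
  by (induction t) (simp add: comp_def cong: map_cong)

lemma ltree_edges_subset: "e \<in> ltree_edges t \<Longrightarrow> e \<subseteq> set (ltree_verts t)"
  by (induction t) fastforce

lemma ltree_edges_nonempty: "e \<in> ltree_edges t \<Longrightarrow> e \<noteq> {}"
  by (induction t) auto

lemma ltree_edges_card:
  "distinct (ltree_verts t) \<Longrightarrow> e \<in> ltree_edges t \<Longrightarrow> card e = 2"
proof (induction t)
  case (LNode v ts)
  then obtain c where c: "c \<in> set ts" "e = {v, ltree_root c} \<or> e \<in> ltree_edges c" by auto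
  have "v \<noteq> ltree_root c" using LNode.prems(1) c(1) ltree_root_in_verts[of c] by auto
  moreover have "distinct (ltree_verts c)"
    using LNode.prems(1) c(1) by (auto dest!: split_list)
  ultimately show ?case using c LNode.IH by auto
qed

section \<open>Graphs of labelled trees are rooted trees\<close>

lemma sym_adj: "(u, v) \<in> adj E \<longleftrightarrow> (v, u) \<in> adj E"
  by (simp add: adj_def insert_commute)

lemma adj_rtrancl_sym: "(u, v) \<in> (adj E)\<^sup>* \<Longrightarrow> (v, u) \<in> (adj E)\<^sup>*"
  using sym_rtrancl[of "adj E"] unfolding sym_def using sym_adj by (metis)

lemma adj_mono: "E \<subseteq> F \<Longrightarrow> adj E \<subseteq> adj F"
  by (auto simp: adj_def)

lemma ltree_connected:
  "x \<in> set (ltree_verts t) \<Longrightarrow> (ltree_root t, x) \<in> (adj (ltree_edges t))\<^sup>*"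
proof (induction t)
  case (LNode v ts)
  show ?case
  proof (cases "x = v")
    case False
    then obtain c where c: "c \<in> set ts" "x \<in> set (ltree_verts c)" using LNode.prems by auto
    have "adj (ltree_edges c) \<subseteq> adj (ltree_edges (LNode v ts))"
      using c by (intro adj_mono) auto
    then have "(ltree_root c, x) \<in> (adj (ltree_edges (LNode v ts)))\<^sup>*"
      using LNode.IH[OF c] rtrancl_mono by blast
    moreover have "(v, ltree_root c) \<in> adj (ltree_edges (LNode v ts))"
      using c(1) by (auto simp: adj_def)
    ultimately show ?thesis by (auto intro: converse_rtrancl_into_rtrancl)
  qed auto
qed

text \<open>A deepest vertex of a cycle would have two different parents.\<close>

lemma no_cycle_if_parents:
  assumes par: "\<And>e. e \<in> E \<Longrightarrow> \<exists>w. e = {w, par w} \<and> (depth (par w) :: nat) < depth w"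
  shows "\<not> graph_cycle E c"
proof
  assume "graph_cycle E c"
  then have c: "length c \<ge> 3" "distinct c" "{last c, hd c} \<in> E"
    "\<And>i. Suc i < length c \<Longrightarrow> {c ! i, c ! Suc i} \<in> E"
    unfolding graph_cycle_def by auto
  let ?n = "length c"
  have ne: "c \<noteq> []" using c(1) by auto
  have step: "{c ! i, c ! (Suc i mod ?n)} \<in> E" if "i < ?n" for i
  proof (cases "Suc i < ?n")
    case False
    then have "Suc i = ?n" using that by simp
    then show ?thesis using c(3) ne by (simp add: last_conv_nth hd_conv_nth flip: \<open>Suc i = ?n\<close>)
  qed (use c(4) in auto)
  have "\<exists>i<?n. \<forall>j<?n. depth (c ! j) \<le> depth (c ! i)"
  proof -
    have "Max ((\<lambda>i. depth (c ! i)) ` {..<?n}) \<in> (\<lambda>i. depth (c ! i)) ` {..<?n}"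
      using ne by (intro Max_in) auto
    then obtain i where "i < ?n" "depth (c ! i) = Max ((\<lambda>i. depth (c ! i)) ` {..<?n})" by auto
    then show ?thesis by (intro exI[of _ i]) auto
  qed
  then obtain i where i: "i < ?n" "\<And>j. j < ?n \<Longrightarrow> depth (c ! j) \<le> depth (c ! i)" by blast
  have nb: "c ! j = par (c ! i)" if "j < ?n" "{c ! i, c ! j} \<in> E" for j
    using par[OF that(2)] i(2)[OF that(1)] by (metis doubleton_eq_iff leD)
  \<comment> \<open>Successor and predecessor of position \<open>i\<close> around the cycle; they
    differ because the length is at least 3.\<close>
  let ?j = "Suc i mod ?n" and ?k = "if i = 0 then ?n - 1 else i - 1"
  have jk: "?j < ?n" "?k < ?n" "?j \<noteq> ?k" "Suc ?k mod ?n = i"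
    using i(1) c(1) by (auto simp: mod_Suc)
  have "{c ! i, c ! ?k} \<in> E" using step[OF jk(2)] unfolding jk(4) by (simp add: insert_commute)
  then have "c ! ?j = c ! ?k" using nb[OF jk(1) step[OF i(1)]] nb[OF jk(2)] by simp
  then show False using c(2) jk by (simp add: nth_eq_iff_index_eq)
qed

text \<open>Supplies the hypothesis of \<open>no_cycle_if_parents\<close>. The clause
  \<open>w \<noteq> ltree_root t\<close> carries the induction: the root of a child has no parent
  inside the child, so it is free to receive the new root as its parent.\<close>

lemma ltree_parents:
  "distinct (ltree_verts t) \<Longrightarrow> \<exists>par depth. \<forall>e\<in>ltree_edges t. \<exists>w\<in>set (ltree_verts t).
     w \<noteq> ltree_root t \<and> e = {w, par w} \<and> (depth (par w) :: nat) < depth w"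
proof (induction t)
  case (LNode v ts)
  have d: "distinct (ltree_verts c)" if "c \<in> set ts" for c
    using LNode.prems that by (auto dest!: split_list)
  have "\<forall>c. \<exists>par depth. c \<in> set ts \<longrightarrow> (\<forall>e\<in>ltree_edges c. \<exists>w\<in>set (ltree_verts c).
     w \<noteq> ltree_root c \<and> e = {w, par w} \<and> (depth (par w) :: nat) < depth w)"
    using LNode.IH d by blast
  then obtain par depth where pd: "\<And>c e. c \<in> set ts \<Longrightarrow> e \<in> ltree_edges c \<Longrightarrow>
     \<exists>w\<in>set (ltree_verts c). w \<noteq> ltree_root c \<and> e = {w, par c w} \<and> (depth c (par c w) :: nat) <
       depth c w"
    by metis
  define C where "C x = (THE c. c \<in> set ts \<and> x \<in> set (ltree_verts c))" for x
  have uniq: "c = c'" if cc: "c \<in> set ts" "c' \<in> set ts" "x \<in> set (ltree_verts c)"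
    "x \<in> set (ltree_verts c')" for c c' x
  proof (rule ccontr)
    assume "c \<noteq> c'"
    obtain xs ys where ts: "ts = xs @ c # ys" using split_list[OF cc(1)] by blast
    then have "c' \<in> set xs \<or> c' \<in> set ys" using \<open>c \<noteq> c'\<close> cc(2) by auto
    then show False using LNode.prems cc(3,4) unfolding ts by auto
  qed
  have C: "C x = c" if "c \<in> set ts" "x \<in> set (ltree_verts c)" for c x
    unfolding C_def using that uniq by blast
  \<comment> \<open>The parent and depth functions of the children are glued; depths grow by one,
    which leaves 0 for the new root.\<close>
  define par' where "par' x = (if x = ltree_root (C x) then v else par (C x) x)" for x
  define depth' where "depth' x = (if x = v then 0 else Suc (depth (C x) x))" for x
  have nv: "x \<noteq> v" if "c \<in> set ts" "x \<in> set (ltree_verts c)" for c x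
    using LNode.prems that by auto
  show ?case
  proof (intro exI ballI)
    fix e assume "e \<in> ltree_edges (LNode v ts)"
    then obtain c where c: "c \<in> set ts" "e = {v, ltree_root c} \<or> e \<in> ltree_edges c" by auto
    show "\<exists>w\<in>set (ltree_verts (LNode v ts)). w \<noteq> ltree_root (LNode v ts) \<and> e = {w, par' w} \<and>
        depth' (par' w) < depth' w"
    proof (cases "e \<in> ltree_edges c")
      case True
      obtain w where w: "w\<in>set (ltree_verts c)" "w \<noteq> ltree_root c" "e = {w, par c w}"
          "depth c (par c w) < depth c w" using pd[OF c(1) True] by blast
      have "par c w \<in> set (ltree_verts c)" using ltree_edges_subset[OF True] w by blast
      then show ?thesis using w c(1) C[OF c(1)] nv[OF c(1)]
        by (intro bexI[of _ w]) (auto simp: par'_def depth'_def)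
    next
      case False
      then have "e = {ltree_root c, v}" using c(2) by auto
      moreover have "ltree_root c \<in> set (ltree_verts c)" by simp
      ultimately show ?thesis using c(1) C[OF c(1)] nv[OF c(1)]
        by (intro bexI[of _ "ltree_root c"]) (auto simp: par'_def depth'_def simp del:
          ltree_root_in_verts)
    qed
  qed
qed

lemma rooted_tree_ltree_graph:
  assumes "distinct (ltree_verts t)"
  shows "rooted_tree (ltree_graph t)"
proof -
  obtain par and depth :: "'a \<Rightarrow> nat" where pd: "\<forall>e\<in>ltree_edges t. \<exists>w\<in>set (ltree_verts t).
     w \<noteq> ltree_root t \<and> e = {w, par w} \<and> depth (par w) < depth w"
    using ltree_parents[OF assms] by blast
  have "\<not> graph_cycle (ltree_edges t) c" for c
    using no_cycle_if_parents[of "ltree_edges t" par depth c] pd by blast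
  moreover have "(u, v) \<in> (adj (ltree_edges t))\<^sup>*"
    if "u \<in> set (ltree_verts t)" "v \<in> set (ltree_verts t)" for u v
    using adj_rtrancl_sym[OF ltree_connected[OF that(1)]] ltree_connected[OF that(2)] by auto
  ultimately show ?thesis
    unfolding rooted_tree_def using ltree_edges_subset[of _ t] ltree_edges_card[OF assms] by auto
qed

text \<open>Induction along the path from the root to \<open>v\<close>. The list of children is
  split at the child that contains \<open>v\<close>; by distinctness the other children do not
  contain it.\<close>

lemma ltree_vertex_induct [consumes 2, case_names root child]:
  assumes "distinct (ltree_verts t)" "v \<in> set (ltree_verts t)"
    and root: "\<And>v ts. distinct (ltree_verts (LNode v ts)) \<Longrightarrow> P v (LNode v ts)"
    and child: "\<And>u xs c ys v. distinct (ltree_verts (LNode u (xs @ c # ys))) \<Longrightarrow>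
      v \<in> set (ltree_verts c) \<Longrightarrow> P v c \<Longrightarrow> P v (LNode u (xs @ c # ys))"
  shows "P v t"
  using assms(1,2)
proof (induction t)
  case (LNode u ts)
  show ?case
  proof (cases "u = v")
    case False
    then obtain c where c: "c \<in> set ts" "v \<in> set (ltree_verts c)" using LNode.prems by auto
    obtain xs ys where ts: "ts = xs @ c # ys" using split_list[OF c(1)] by blast
    show ?thesis
      using child[of u xs c ys v] LNode.IH[OF c(1)] c(2) LNode.prems(1) unfolding ts by simp
  qed (use root LNode.prems in simp)
qed

lemma ltree_subtree_induct [consumes 2, case_names root child]:
  assumes "distinct (ltree_verts t)" "(p, b) \<in> set (ltree_subtrees t)"
    and root: "\<And>v xs b ys. distinct (ltree_verts (LNode v (xs @ b # ys))) \<Longrightarrow>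
      P v b (LNode v (xs @ b # ys))"
    and child: "\<And>u xs c ys p b. distinct (ltree_verts (LNode u (xs @ c # ys))) \<Longrightarrow>
      (p, b) \<in> set (ltree_subtrees c) \<Longrightarrow> P p b c \<Longrightarrow> P p b (LNode u (xs @ c # ys))"
  shows "P p b t"
  using assms(1,2)
proof (induction t)
  case (LNode u ts)
  then obtain c where c: "c \<in> set ts" "(p, b) = (u, c) \<or> (p, b) \<in> set (ltree_subtrees c)"
    by auto
  obtain xs ys where ts: "ts = xs @ c # ys" using split_list[OF c(1)] by blast
  show ?case
    using c(2)
  proof
    assume "(p, b) = (u, c)"
    then show ?thesis using root[of u xs c ys] LNode.prems(1) ts by simp
  next
    assume "(p, b) \<in> set (ltree_subtrees c)"
    then show ?thesis using child[of u xs c ys p b] LNode.IH[OF c(1)] LNode.prems(1) ts by simp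
  qed
qed

section \<open>Grafting and pruning labelled trees\<close>

lemma ltree_graft_notin:
  "v \<notin> set (ltree_verts t) \<Longrightarrow> ltree_graft v s t = t"
proof (induction t)
  case (LNode u ts)
  then have "map (ltree_graft v s) ts = ts" by (intro map_idI) auto
  then show ?case using LNode.prems by auto
qed

lemma ltree_graft_at_root:
  "distinct (ltree_verts (LNode v ts)) \<Longrightarrow> ltree_graft v s (LNode v ts) = LNode v (s # ts)"
proof -
  assume d: "distinct (ltree_verts (LNode v ts))"
  have "map (ltree_graft v s) ts = ts" using d by (intro map_idI ltree_graft_notin) auto
  then show ?thesis by simp
qed

lemma ltree_graft_in_child:
  "distinct (ltree_verts (LNode u (xs @ c # ys))) \<Longrightarrow> v \<in> set (ltree_verts c) \<Longrightarrow>
    ltree_graft v s (LNode u (xs @ c # ys)) = LNode u (xs @ ltree_graft v s c # ys)"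
proof -
  assume d: "distinct (ltree_verts (LNode u (xs @ c # ys)))" and v: "v \<in> set (ltree_verts c)"
  have "map (ltree_graft v s) xs = xs" "map (ltree_graft v s) ys = ys" "u \<noteq> v"
    using d v by (auto intro!: map_idI ltree_graft_notin)
  then show ?thesis by simp
qed

lemma ltree_root_graft [simp]: "ltree_root (ltree_graft v s t) = ltree_root t"
  by (cases t) simp

lemma ltree_verts_graft:
  assumes "distinct (ltree_verts t)" "v \<in> set (ltree_verts t)"
  shows "mset (ltree_verts (ltree_graft v s t)) = mset (ltree_verts t) + mset (ltree_verts s)"
  using assms
  by (induction rule: ltree_vertex_induct)
    (simp_all add: ltree_graft_at_root ltree_graft_in_child del: ltree_graft.simps)

lemma ltree_edges_graft:
  assumes "distinct (ltree_verts t)" "v \<in> set (ltree_verts t)"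
  shows "ltree_edges (ltree_graft v s t) = ltree_edges t \<union> ltree_edges s \<union> {{v, ltree_root s}}"
  using assms
  by (induction rule: ltree_vertex_induct)
    (auto simp: ltree_graft_at_root ltree_graft_in_child simp del: ltree_graft.simps)

lemma graft_ltree_graph:
  assumes "distinct (ltree_verts t)" "v \<in> set (ltree_verts t)"
  shows "graft (ltree_graph t) v (ltree_graph s) =
    ltree_graph (ltree_graft (Inl v) (map_ltree Inr s) (map_ltree Inl t))"
proof -
  have d: "distinct (ltree_verts (map_ltree Inl t))" "Inl v \<in> set (ltree_verts (map_ltree Inl t))"
    using assms by (auto simp: ltree_verts_map distinct_map)
  have "set (ltree_verts (ltree_graft (Inl v) (map_ltree Inr s) (map_ltree Inl t))) =
    set (ltree_verts t) <+> set (ltree_verts s)"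
    using arg_cong[OF ltree_verts_graft[OF d, of "map_ltree Inr s"], of set_mset]
    by (simp add: ltree_verts_map Plus_def)
  then show ?thesis
    unfolding graft_def ltree_graph_def
    by (simp add: ltree_edges_graft[OF d] ltree_edges_map ltree_root_map)
qed

lemma distinct_ltree_graft:
  assumes "distinct (ltree_verts t)" "v \<in> set (ltree_verts t)" "distinct (ltree_verts s)"
    "set (ltree_verts t) \<inter> set (ltree_verts s) = {}"
  shows "distinct (ltree_verts (ltree_graft v s t))"
proof -
  have "mset (ltree_verts (ltree_graft v s t)) = mset (ltree_verts t @ ltree_verts s)"
    using ltree_verts_graft[OF assms(1,2)] by simp
  moreover have "distinct (ltree_verts t @ ltree_verts s)" using assms by simp
  ultimately show ?thesis using mset_eq_imp_distinct_iff by blast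
qed

lemma ltree_prune_notin:
  "w \<notin> set (ltree_verts t) \<Longrightarrow> ltree_prune w t = t"
proof (induction t)
  case (LNode u ts)
  have "ltree_root c \<noteq> w" "ltree_prune w c = c" if "c \<in> set ts" for c
    using LNode that ltree_root_in_verts[of c] by auto
  then have "filter (\<lambda>c. ltree_root c \<noteq> w) ts = ts" "map (ltree_prune w) ts = ts"
    by (auto simp: filter_id_conv intro!: map_idI)
  then show ?case by simp
qed

lemma ltree_prune_others:
  assumes "\<And>c. c \<in> set xs \<Longrightarrow> w \<notin> set (ltree_verts c)"
  shows "map (ltree_prune w) (filter (\<lambda>c. ltree_root c \<noteq> w) xs) = xs"
proof -
  have "ltree_root c \<noteq> w" "ltree_prune w c = c" if "c \<in> set xs" for c
    using assms[OF that] ltree_root_in_verts[of c] ltree_prune_notin[of w c] by auto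
  then have "filter (\<lambda>c. ltree_root c \<noteq> w) xs = xs" "map (ltree_prune w) xs = xs"
    by (auto simp: filter_id_conv intro!: map_idI)
  then show ?thesis by simp
qed

lemma ltree_prune_at_root:
  assumes "distinct (ltree_verts (LNode v (xs @ b # ys)))"
  shows "ltree_prune (ltree_root b) (LNode v (xs @ b # ys)) = LNode v (xs @ ys)"
proof -
  have "ltree_root b \<notin> set (ltree_verts c)" if "c \<in> set xs \<or> c \<in> set ys" for c
    using assms that ltree_root_in_verts[of b] by (auto simp del: ltree_root_in_verts)
  then show ?thesis using ltree_prune_others[of xs] ltree_prune_others[of ys] by simp
qed

text \<open>A listed subtree lies strictly below the root, so pruning it inside a child never
  removes that child itself.\<close>

lemma ltree_subtree_root:
  "(p, b) \<in> set (ltree_subtrees t) \<Longrightarrow>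
    set (ltree_verts b) \<subseteq> set (concat (map ltree_verts (ltree_children t)))"
proof (induction t)
  case (LNode v ts)
  then obtain c where c: "c \<in> set ts" "(p, b) = (v, c) \<or> (p, b) \<in> set (ltree_subtrees c)" by auto
  have "set (concat (map ltree_verts (ltree_children c))) \<subseteq> set (ltree_verts c)" by (cases c) auto
  then show ?case using c LNode.IH[OF c(1)] by fastforce
qed

lemma ltree_prune_in_child:
  assumes "distinct (ltree_verts (LNode u (xs @ c # ys)))" "(p, b) \<in> set (ltree_subtrees c)"
  shows "ltree_prune (ltree_root b) (LNode u (xs @ c # ys)) =
    LNode u (xs @ ltree_prune (ltree_root b) c # ys)"
proof -
  have b: "ltree_root b \<in> set (concat (map ltree_verts (ltree_children c)))"
    using ltree_subtree_root[OF assms(2)] ltree_root_in_verts by blast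
  then have "ltree_root c \<noteq> ltree_root b" "ltree_root b \<in> set (ltree_verts c)"
    using assms(1) by (cases c; auto)+
  moreover have "ltree_root b \<notin> set (ltree_verts c')" if "c' \<in> set xs \<or> c' \<in> set ys" for c'
    using assms that \<open>ltree_root b \<in> set (ltree_verts c)\<close> by (auto simp del: ltree_root_in_verts)
  ultimately show ?thesis using ltree_prune_others[of xs] ltree_prune_others[of ys] by simp
qed

lemma ltree_prune_split:
  assumes "distinct (ltree_verts t)" "(p, b) \<in> set (ltree_subtrees t)"
  shows "mset (ltree_verts t) = mset (ltree_verts (ltree_prune (ltree_root b) t)) +
    mset (ltree_verts b)
    \<and> ltree_edges t = ltree_edges (ltree_prune (ltree_root b) t) \<union> ltree_edges b \<union>
      {{p, ltree_root b}}
    \<and> p \<in> set (ltree_verts (ltree_prune (ltree_root b) t))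
    \<and> ltree_root (ltree_prune (ltree_root b) t) = ltree_root t"
  using assms
proof (induction rule: ltree_subtree_induct)
  case (root v xs b ys)
  show ?case unfolding ltree_prune_at_root[OF root] by auto
next
  case (child u xs c ys p b)
  then show ?case unfolding ltree_prune_in_child[OF child(1,2)] by auto
qed

lemma adj_reach_within:
  assumes "(x, y) \<in> (adj E)\<^sup>*" "x \<in> V" "\<And>e. e \<in> E \<Longrightarrow> e \<inter> V \<noteq> {} \<Longrightarrow> e \<subseteq> V"
  shows "y \<in> V"
  using assms(1,2)
proof (induction rule: rtrancl_induct)
  case (step y z)
  then show ?case using assms(3)[of "{y, z}"] by (auto simp: adj_def)
qed

section \<open>Rooted trees up to isomorphism\<close>

lemma adj_simple_path:
  assumes "(a, b) \<in> (adj E)\<^sup>*"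
  shows "\<exists>p. p \<noteq> [] \<and> hd p = a \<and> last p = b \<and> distinct p \<and> successively (\<lambda>x y. {x, y} \<in> E) p"
  using assms
proof (induction rule: rtrancl_induct)
  case base
  show ?case by (intro exI[of _ "[a]"]) simp
next
  case (step y z)
  then obtain p where p: "p \<noteq> []" "hd p = a" "last p = y" "distinct p"
    "successively (\<lambda>x y. {x, y} \<in> E) p" by blast
  show ?case
  proof (cases "z \<in> set p")
    case True
    \<comment> \<open>The walk returns to \<open>z\<close>; cutting the path off at this vertex
      keeps it simple.\<close>
    then obtain xs ys where "p = (xs @ [z]) @ ys" using split_list[OF True] by auto
    then have "distinct (xs @ [z])" "successively (\<lambda>x y. {x, y} \<in> E) (xs @ [z])" "hd (xs @ [z]) = a"
      using p by (auto simp: successively_append_iff[of _ "xs @ [z]" ys] hd_append simp del: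
        append_assoc)
    then show ?thesis by (intro exI[of _ "xs @ [z]"]) simp
  next
    case False
    then show ?thesis using p step(2)
      by (intro exI[of _ "p @ [z]"]) (auto simp: successively_append_iff adj_def)
  qed
qed

text \<open>Take a largest labelled tree inside \<open>G\<close> with the same root. It reaches all
  vertices because \<open>G\<close> is connected, and it contains all edges because \<open>G\<close>
  has no cycle.\<close>

lemma rooted_tree_eq_ltree_graph:
  assumes "rooted_tree G"
  obtains t where "distinct (ltree_verts t)" "ltree_graph t = G"
proof -
  note G = assms[unfolded rooted_tree_def]
  let ?P = "\<lambda>t. distinct (ltree_verts t) \<and> set (ltree_verts t) \<subseteq> verts G \<and>
    ltree_edges t \<subseteq> edges G \<and> ltree_root t = root G"
  have "length (ltree_verts t) \<le> card (verts G)" if "?P t" for t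
    using that G by (metis card_mono distinct_card)
  moreover have "?P (LNode (root G) [])" using G by simp
  ultimately have "\<exists>t. ?P t \<and> (\<forall>t'. ?P t' \<longrightarrow> length (ltree_verts t') \<le> length (ltree_verts t))"
    by (intro ex_has_greatest_nat[of ?P "LNode (root G) []" _ "Suc (card (verts G))"])
      (auto simp: less_Suc_eq_le)
  then obtain t where t: "?P t" "\<And>t'. ?P t' \<Longrightarrow> length (ltree_verts t') \<le> length (ltree_verts t)"
    by blast
  have V: "verts G \<subseteq> set (ltree_verts t)"
  proof (rule ccontr)
    assume "\<not> verts G \<subseteq> set (ltree_verts t)"
    then obtain x where x: "x \<in> verts G" "x \<notin> set (ltree_verts t)" by blast
    have "(ltree_root t, x) \<in> (adj (edges G))\<^sup>*" using G t(1) x by auto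
    then obtain e where e: "e \<in> edges G" "e \<inter> set (ltree_verts t) \<noteq> {}" "\<not> e \<subseteq> set (ltree_verts t)"
      using adj_reach_within[of "ltree_root t" x "edges G" "set (ltree_verts t)"] x by auto
    then obtain p w where pw: "p \<in> e" "p \<in> set (ltree_verts t)" "w \<in> e" "w \<notin> set (ltree_verts t)"
      by blast
    moreover have "card e = 2" using G e by blast
    ultimately have "e = {p, w}" by (auto simp: card_2_iff)
    \<comment> \<open>The edge \<open>e\<close> leaves the vertex set of \<open>t\<close>; hanging
      its outer endpoint \<open>w\<close> on \<open>t\<close> contradicts maximality.\<close>
    define t' where "t' = ltree_graft p (LNode w []) t"
    have "mset (ltree_verts t') = mset (w # ltree_verts t)"
      unfolding t'_def using ltree_verts_graft[of t p "LNode w []"] t(1) pw by simp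
    then have "set (ltree_verts t') = insert w (set (ltree_verts t))"
      "length (ltree_verts t') = Suc (length (ltree_verts t))"
      "distinct (ltree_verts t')"
      using t(1) pw mset_eq_setD[of _ "w # ltree_verts t"] mset_eq_length[of _ "w # ltree_verts t"]
        mset_eq_imp_distinct_iff[of _ "w # ltree_verts t"] by auto
    moreover have "ltree_edges t' = ltree_edges t \<union> {{p, w}}" "ltree_root t' = ltree_root t"
      unfolding t'_def using ltree_edges_graft[of t p "LNode w []"] t(1) pw by auto
    moreover have "w \<in> verts G" using G e pw by blast
    ultimately show False using t(2)[of t'] t(1) e \<open>e = {p, w}\<close> by auto
  qed
  have E: "edges G \<subseteq> ltree_edges t"
  proof
    fix e assume e: "e \<in> edges G"
    show "e \<in> ltree_edges t"
    proof (rule ccontr)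
      assume n: "e \<notin> ltree_edges t"
      have "card e = 2" "e \<subseteq> verts G" using G e by auto
      then obtain a b where ab: "e = {a, b}" "a \<noteq> b" "a \<in> verts G" "b \<in> verts G"
        by (auto simp: card_2_iff)
      have "rooted_tree (ltree_graph t)" using rooted_tree_ltree_graph t(1) by blast
      then have "(a, b) \<in> (adj (ltree_edges t))\<^sup>*"
        using subsetD[OF V ab(3)] subsetD[OF V ab(4)]
        by (simp only: rooted_tree_def ltree_graph_simps)
      from adj_simple_path[OF this] obtain p where p: "p \<noteq> []" "hd p = a" "last p = b" "distinct p"
        "successively (\<lambda>x y. {x, y} \<in> ltree_edges t) p" by (elim exE conjE)
      obtain x q where q: "p = a # x # q" using p ab(2)
        by (cases p; cases "tl p") auto
      \<comment> \<open>The path in \<open>t\<close> is not the single edge \<open>e\<close>, as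
        \<open>e\<close> is missing from \<open>t\<close>; so it has at least three vertices and
        \<open>e\<close> closes it to a cycle.\<close>
      then have "q \<noteq> []" using p n ab by auto
      then have "length p \<ge> 3" using q by (cases q) auto
      moreover have "{last p, hd p} \<in> edges G" using p e ab by (simp add: insert_commute)
      ultimately have "graph_cycle (edges G) p"
        unfolding graph_cycle_def using p(4,5) t(1) by (auto simp: successively_conv_nth)
      then show False using G by blast
    qed
  qed
  have "ltree_graph t = G" using t(1) V E by (intro rgraph.equality) auto
  then show ?thesis using that t(1) by blast
qed

text \<open>Without the cut edge, no edge joins the pruned tree to the branch, so the vertices
  reachable from the root are exactly those of the pruned tree.\<close>

lemma ltree_cut:
  assumes "distinct (ltree_verts t)" "(p, b) \<in> set (ltree_subtrees t)"
  shows "cut_root {p, ltree_root b} (ltree_graph t) = ltree_graph (ltree_prune (ltree_root b) t)"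
    and "cut_branch {p, ltree_root b} (ltree_graph t) = ltree_graph b"
proof -
  define r where "r = ltree_prune (ltree_root b) t"
  let ?e = "{p, ltree_root b}"
  have r: "mset (ltree_verts t) = mset (ltree_verts r @ ltree_verts b)"
    "ltree_edges t = ltree_edges r \<union> ltree_edges b \<union> {?e}"
    "p \<in> set (ltree_verts r)" "ltree_root r = ltree_root t"
    using ltree_prune_split[OF assms] unfolding r_def by auto
  have disj: "set (ltree_verts r) \<inter> set (ltree_verts b) = {}"
    using mset_eq_imp_distinct_iff[OF r(1)] assms(1) by simp
  have V: "set (ltree_verts t) = set (ltree_verts r) \<union> set (ltree_verts b)"
    using mset_eq_setD[OF r(1)] by simp
  have "ltree_root b \<notin> set (ltree_verts r)" "p \<notin> set (ltree_verts b)"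
    using disj r(3) ltree_root_in_verts[of b] by blast+
  then have "?e \<notin> ltree_edges r \<union> ltree_edges b"
    using ltree_edges_subset[of ?e r] ltree_edges_subset[of ?e b] by auto
  then have E: "ltree_edges t - {?e} = ltree_edges r \<union> ltree_edges b" using r(2) by blast
  have cl: "e \<subseteq> set (ltree_verts r)"
    if "e \<in> ltree_edges r \<union> ltree_edges b" "e \<inter> set (ltree_verts r) \<noteq> {}" for e
    using that disj ltree_edges_subset[of e r] ltree_edges_subset[of e b] by blast
  have in_only: "\<not> e \<subseteq> set (ltree_verts b)" if "e \<in> ltree_edges r" for e
    using that disj ltree_edges_subset[OF that] ltree_edges_nonempty[OF that] by blast
  have in_only': "\<not> e \<subseteq> set (ltree_verts r)" if "e \<in> ltree_edges b" for e
    using that disj ltree_edges_subset[OF that] ltree_edges_nonempty[OF that] by blast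
  have sub: "{e \<in> ltree_edges r \<union> ltree_edges b. e \<subseteq> set (ltree_verts r)} = ltree_edges r"
    "{e \<in> ltree_edges r \<union> ltree_edges b. e \<subseteq> set (ltree_verts b)} = ltree_edges b"
    using in_only in_only' by (auto dest: ltree_edges_subset)
  have W: "{v \<in> set (ltree_verts t). (ltree_root t, v) \<in> (adj (ltree_edges t - {?e}))\<^sup>*} =
    set (ltree_verts r)"
  proof (intro equalityI subsetI)
    fix v assume "v \<in> {v \<in> set (ltree_verts t). (ltree_root t, v) \<in> (adj (ltree_edges t - {?e}))\<^sup>*}"
    then show "v \<in> set (ltree_verts r)"
      using adj_reach_within[of "ltree_root t" v _ "set (ltree_verts r)"] cl
        ltree_root_in_verts[of r] unfolding E r(4) by blast
  next
    fix v assume v: "v \<in> set (ltree_verts r)"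
    have "(ltree_root t, v) \<in> (adj (ltree_edges r \<union> ltree_edges b))\<^sup>*"
      using ltree_connected[OF v] rtrancl_mono[OF adj_mono[of "ltree_edges r"]] r(4) by auto
    then show "v \<in> {v \<in> set (ltree_verts t). (ltree_root t, v) \<in> (adj (ltree_edges t - {?e}))\<^sup>*}"
      using v V E by auto
  qed
  show root: "cut_root ?e (ltree_graph t) = ltree_graph (ltree_prune (ltree_root b) t)"
    unfolding cut_root_def r_def[symmetric] Let_def
    by (simp add: W[unfolded E] E sub[unfolded Un_iff] ltree_graph_def r(4))
  have "(THE v. v \<in> ?e \<and> v \<in> set (ltree_verts b)) = ltree_root b"
    using \<open>p \<notin> set (ltree_verts b)\<close> by (intro the_equality) auto
  moreover have "set (ltree_verts t) - set (ltree_verts r) = set (ltree_verts b)"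
    using V disj by blast
  ultimately show "cut_branch ?e (ltree_graph t) = ltree_graph b"
    unfolding cut_branch_def root r_def[symmetric] Let_def
    by (simp add: E sub[unfolded Un_iff] ltree_graph_def)
qed

section \<open>The shape is a complete isomorphism invariant\<close>

lemma distinct_ltree_roots:
  "distinct (concat (map ltree_verts ts)) \<Longrightarrow> distinct (map ltree_root ts)"
proof (induction ts)
  case (Cons c ts)
  have "ltree_root c \<notin> ltree_root ` set ts"
  proof
    assume "ltree_root c \<in> ltree_root ` set ts"
    then obtain c' where "c' \<in> set ts" "ltree_root c = ltree_root c'" by blast
    then have "ltree_root c \<in> set (ltree_verts c')" by simp
    then show False using Cons.prems \<open>c' \<in> set ts\<close> ltree_root_in_verts[of c]
      by (auto simp del: ltree_root_in_verts)
  qed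
  then show ?case using Cons by auto
qed simp

text \<open>Recovers a child from the graph and the root of the child alone: it is the component of
  that root once the edges at \<open>v\<close> are removed. The next lemma can therefore pass from
  equal graphs to equal graphs of children.\<close>

lemma ltree_child_graph:
  assumes "distinct (ltree_verts (LNode v ts))" "c \<in> set ts"
  defines "E \<equiv> ltree_edges (LNode v ts)"
  shows "set (ltree_verts c) = {x. (ltree_root c, x) \<in> (adj {e \<in> E. v \<notin> e})\<^sup>*}"
    and "ltree_edges c = {e \<in> E. e \<subseteq> set (ltree_verts c)}"
proof -
  obtain xs ys where ts: "ts = xs @ c # ys" using split_list[OF assms(2)] by blast
  have v: "v \<notin> set (ltree_verts c')" if "c' \<in> set ts" for c' using assms(1) that by auto
  have disj: "set (ltree_verts c) \<inter> set (ltree_verts c') = {}"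
    if "c' \<in> set xs \<or> c' \<in> set ys" for c'
    using assms(1) that unfolding ts by auto
  have other: "e \<inter> set (ltree_verts c) = {}" if e: "e \<in> E" "v \<notin> e" "e \<notin> ltree_edges c" for e
  proof -
    obtain c' where "c' \<in> set xs \<or> c' \<in> set ys" "e \<in> ltree_edges c'"
    proof -
      obtain c' where "c' \<in> set ts" "e = {v, ltree_root c'} \<or> e \<in> ltree_edges c'"
        using e(1) unfolding E_def by auto
      then have "c' \<in> set xs \<or> c' \<in> set ys" "e \<in> ltree_edges c'"
        using e(2,3) unfolding ts by auto
      then show thesis using that by blast
    qed
    then show ?thesis using disj[of c'] ltree_edges_subset[of e c'] by blast
  qed
  have sub: "ltree_edges c \<subseteq> {e \<in> E. v \<notin> e}"
    using assms(2) v[OF assms(2)] ltree_edges_subset[of _ c] unfolding E_def by auto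
  show "ltree_edges c = {e \<in> E. e \<subseteq> set (ltree_verts c)}"
  proof (intro equalityI subsetI)
    fix e assume e: "e \<in> {e \<in> E. e \<subseteq> set (ltree_verts c)}"
    then have "v \<notin> e" "e \<noteq> {}" using v[OF assms(2)] ltree_edges_nonempty[of e "LNode v ts"]
      unfolding E_def by blast+
    then show "e \<in> ltree_edges c" using other[of e] e by blast
  qed (use sub ltree_edges_subset[of _ c] in auto)
  show "set (ltree_verts c) = {x. (ltree_root c, x) \<in> (adj {e \<in> E. v \<notin> e})\<^sup>*}"
  proof (intro equalityI subsetI CollectI)
    fix x assume "x \<in> set (ltree_verts c)"
    then show "(ltree_root c, x) \<in> (adj {e \<in> E. v \<notin> e})\<^sup>*"
      using subsetD[OF rtrancl_mono[OF adj_mono[OF sub]] ltree_connected] by simp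
  next
    fix x assume "x \<in> {x. (ltree_root c, x) \<in> (adj {e \<in> E. v \<notin> e})\<^sup>*}"
    then show "x \<in> set (ltree_verts c)"
      using adj_reach_within[of "ltree_root c" x "{e \<in> E. v \<notin> e}" "set (ltree_verts c)"]
        other ltree_edges_subset[of _ c] by auto
  qed
qed

text \<open>The order of the children is invisible in the graph. They are matched through their
  roots, which are the neighbours of \<open>v\<close>.\<close>

lemma shape_eq_if_graph_eq:
  assumes "distinct (ltree_verts t)" "distinct (ltree_verts t')" "ltree_graph t = ltree_graph t'"
  shows "shape t = shape t'"
  using assms
proof (induction t arbitrary: t')
  case (LNode v ts)
  obtain ts' where t': "t' = LNode v ts'"
    using LNode.prems(3) by (cases t') (auto simp: ltree_graph_def)
  define E where "E = ltree_edges (LNode v ts)"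
  have E': "E = ltree_edges (LNode v ts')"
    using LNode.prems(3) unfolding E_def t' ltree_graph_def by simp
  have root_c: "ltree_root ` set us = {x. {v, x} \<in> ltree_edges (LNode v us) \<and> x \<noteq> v}"
    if d: "distinct (ltree_verts (LNode v us))" for us
  proof (intro equalityI subsetI)
    fix x assume "x \<in> ltree_root ` set us"
    then obtain c where "c \<in> set us" "x = ltree_root c" by blast
    then show "x \<in> {x. {v, x} \<in> ltree_edges (LNode v us) \<and> x \<noteq> v}"
      using d ltree_root_in_verts[of c] by (auto simp del: ltree_root_in_verts)
  next
    fix x assume x: "x \<in> {x. {v, x} \<in> ltree_edges (LNode v us) \<and> x \<noteq> v}"
    then obtain c where c: "c \<in> set us" "{v, x} = {v, ltree_root c} \<or> {v, x} \<in> ltree_edges c"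
      by auto
    moreover have "{v, x} \<notin> ltree_edges c" using ltree_edges_subset[of "{v,x}" c] d c(1) by auto
    ultimately show "x \<in> ltree_root ` set us" using x by (auto simp: doubleton_eq_iff)
  qed
  have roots: "ltree_root ` set ts = ltree_root ` set ts'"
    unfolding root_c[OF LNode.prems(1)] root_c[OF LNode.prems(2)[unfolded t']]
      E_def[symmetric] E'[symmetric] ..
  have d: "distinct (map ltree_root ts)" "distinct (map ltree_root ts')"
    using LNode.prems(1,2) unfolding t' by (auto intro!: distinct_ltree_roots)
  have sh: "shape c = shape c'"
    if "c \<in> set ts" "c' \<in> set ts'" "ltree_root c = ltree_root c'" for c c'
  proof -
    note g = ltree_child_graph[OF LNode.prems(1) that(1)]
    note g' = ltree_child_graph[OF LNode.prems(2)[unfolded t'] that(2)]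
    have "set (ltree_verts c) = set (ltree_verts c')"
      unfolding g(1) g'(1) that(3) E_def[symmetric] E'[symmetric] ..
    moreover from this have "ltree_edges c = ltree_edges c'"
      unfolding g(2) g'(2) E_def[symmetric] E'[symmetric] by simp
    ultimately have "ltree_graph c = ltree_graph c'" using that(3) by (simp add: ltree_graph_def)
    moreover have "distinct (ltree_verts c)" "distinct (ltree_verts c')"
      using LNode.prems(1,2) that(1,2) unfolding t' by (auto dest!: split_list)
    ultimately show ?thesis using LNode.IH[OF that(1)] by blast
  qed
  \<comment> \<open>The shape of a child as a function of its root, so that both multisets of shapes
    are images of the same set of roots.\<close>
  define h where "h x = shape (SOME c. c \<in> set ts' \<and> ltree_root c = x)" for x
  have h: "shape c = h (ltree_root c)" if "c \<in> set ts" for c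
  proof -
    have "\<exists>c'. c' \<in> set ts' \<and> ltree_root c' = ltree_root c" using roots that by (metis image_iff)
    from someI_ex[OF this] show ?thesis unfolding h_def using sh[OF that] by simp
  qed
  have h': "shape c = h (ltree_root c)" if c: "c \<in> set ts'" for c
  proof -
    obtain c0 where c0: "c0 \<in> set ts" "ltree_root c0 = ltree_root c" using roots c
      by (metis image_iff)
    then show ?thesis using h[OF c0(1)] sh[OF c0(1) c] by simp
  qed
  have "map shape ts = map h (map ltree_root ts)" using h by simp
  then have "mset (map shape ts) = image_mset h (mset (map ltree_root ts))" by (metis mset_map)
  also have "mset (map ltree_root ts) = mset (map ltree_root ts')"
    using d roots by (simp add: set_eq_iff_mset_eq_distinct[symmetric] del: mset_map)
  also have "map h (map ltree_root ts') = map shape ts'" using h' by simp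
  then have "image_mset h (mset (map ltree_root ts')) = mset (map shape ts')" by (metis mset_map)
  finally show ?case unfolding t' by simp
qed

primrec tree_verts :: "tree \<Rightarrow> nat" where
  "tree_verts (Node M) = Suc (\<Sum>k\<in>#image_mset tree_verts M. k)"

lemma length_ltree_verts: "length (ltree_verts t) = tree_verts (shape t)"
proof (induction t)
  case (LNode v ts)
  then have "(\<Sum>c\<leftarrow>ts. length (ltree_verts c)) = (\<Sum>c\<leftarrow>ts. tree_verts (shape c))"
    by (intro arg_cong[of _ _ sum_list]) simp
  moreover have "(\<Sum>k\<in>#mset (map (\<lambda>c. tree_verts (shape c)) ts). k) =
    sum_list (map (\<lambda>c. tree_verts (shape c)) ts)"
    by (metis image_mset.identity id_apply sum_mset_sum_list)
  ultimately show ?case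
    by (simp add: length_concat multiset.map_comp comp_def)
qed

lemma ex_map_eq_mset:
  "image_mset f M = mset ys \<Longrightarrow> \<exists>zs. mset zs = M \<and> map f zs = ys"
proof (induction ys arbitrary: M)
  case (Cons y ys)
  then obtain N a where "M = add_mset a N" "f a = y" "image_mset f N = mset ys"
    using msed_map_invR[of f M y "mset ys"] by auto
  then show ?case using Cons.IH[of N] by (metis list.simps(9) mset.simps(2))
qed simp

lemma ltree_edges_LNode_split:
  "ltree_edges (LNode v ts) = (\<lambda>x. {v, x}) ` ltree_root ` set ts \<union> \<Union>(ltree_edges ` set ts)"
  by auto

text \<open>Only a surjective map is constructed; trees of equal shape have equally many vertices,
  so \<open>ltree_graph_iso_iff\<close> obtains injectivity by counting.\<close>

lemma ltree_graph_map_if_shape_eq: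
  assumes "distinct (ltree_verts t)" "shape t = shape t'"
  shows "\<exists>f. f ` set (ltree_verts t) = set (ltree_verts t') \<and>
    (\<lambda>e. f ` e) ` ltree_edges t = ltree_edges t' \<and> f (ltree_root t) = ltree_root t'"
  using assms
proof (induction t arbitrary: t')
  case (LNode v ts)
  obtain v' ts' where t': "t' = LNode v' ts'" by (cases t')
  have "image_mset shape (mset ts') = mset (map shape ts)" using LNode.prems(2) t' by simp
  \<comment> \<open>Reorders the children of \<open>t'\<close> so that shapes agree position by
    position.\<close>
  then obtain us where us: "mset us = mset ts'" "map shape us = map shape ts"
    using ex_map_eq_mset by blast
  let ?V = "\<lambda>ts. set (concat (map ltree_verts ts))" and ?E = "\<lambda>ts. \<Union>(ltree_edges ` set ts)"
  have "\<exists>f. f ` ?V ts = ?V us \<and> (\<lambda>e. f ` e) ` ?E ts = ?E us \<and>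
    f ` ltree_root ` set ts = ltree_root ` set us"
    using us(2)[symmetric] LNode.IH LNode.prems(1) unfolding ltree_verts.simps distinct.simps
  proof (induction ts arbitrary: us)
    case (Cons c ts)
    then obtain d us' where us': "us = d # us'" "shape c = shape d" "map shape ts = map shape us'"
      by (cases us) auto
    obtain f where f: "f ` ?V ts = ?V us'" "(\<lambda>e. f ` e) ` ?E ts = ?E us'"
      "f ` ltree_root ` set ts = ltree_root ` set us'"
      using Cons.IH[OF us'(3)] Cons.prems(2,3) by auto
    obtain g where g: "g ` set (ltree_verts c) = set (ltree_verts d)"
      "(\<lambda>e. g ` e) ` ltree_edges c = ltree_edges d" "g (ltree_root c) = ltree_root d"
      using Cons.prems(2)[of c d] Cons.prems(3) us'(2) by auto
    \<comment> \<open>The maps for the first child and for the rest glue because the vertex sets are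
      disjoint.\<close>
    define h where "h x = (if x \<in> set (ltree_verts c) then g x else f x)" for x
    have hf: "h x = f x" if "x \<in> ?V ts" for x using that Cons.prems(3) unfolding h_def by auto
    have hg: "h x = g x" if "x \<in> set (ltree_verts c)" for x using that unfolding h_def by simp
    have "h ` ?V ts = f ` ?V ts" using hf by (rule image_cong[OF refl])
    moreover have "h ` set (ltree_verts c) = g ` set (ltree_verts c)" using hg
      by (rule image_cong[OF refl])
    moreover have "(\<lambda>e. h ` e) ` ?E ts = (\<lambda>e. f ` e) ` ?E ts"
    proof (rule image_cong[OF refl])
      fix e assume "e \<in> ?E ts"
      then have "e \<subseteq> ?V ts" using ltree_edges_subset by fastforce
      then show "h ` e = f ` e" using hf by (intro image_cong[OF refl]) blast
    qed
    moreover have "(\<lambda>e. h ` e) ` ltree_edges c = (\<lambda>e. g ` e) ` ltree_edges c"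
    proof (rule image_cong[OF refl])
      fix e assume "e \<in> ltree_edges c"
      then have "e \<subseteq> set (ltree_verts c)" by (rule ltree_edges_subset)
      then show "h ` e = g ` e" using hg by (intro image_cong[OF refl]) blast
    qed
    moreover have "h ` ltree_root ` set ts = f ` ltree_root ` set ts"
    proof (rule image_cong[OF refl])
      fix x assume "x \<in> ltree_root ` set ts"
      then obtain c' where "c' \<in> set ts" "x = ltree_root c'" by blast
      then have "x \<in> ?V ts" by (auto intro!: bexI[of _ c'])
      then show "h x = f x" by (rule hf)
    qed
    moreover have "h (ltree_root c) = ltree_root d" using hg g(3) by simp
    ultimately show ?case unfolding us' using f g
      by (intro exI[of _ h]) (simp add: image_Un)
  qed simp
  then obtain f where f: "f ` ?V ts = ?V us" "(\<lambda>e. f ` e) ` ?E ts = ?E us"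
    "f ` ltree_root ` set ts = ltree_root ` set us" by (elim exE conjE)
  define h where "h = f(v := v')"
  have v: "v \<notin> ?V ts" using LNode.prems(1) by simp
  have hV: "h x = f x" if "x \<in> ?V ts" for x using v that unfolding h_def by auto
  have Vus: "?V us = ?V ts'" "set us = set ts'"
    using mset_eq_setD[OF us(1)] by auto
  have "h v = v'" by (simp add: h_def)
  have "h ` ?V ts = ?V us" using hV f(1) by auto
  then have 1: "h ` set (ltree_verts (LNode v ts)) = set (ltree_verts t')"
    unfolding t' ltree_verts.simps list.set(2) image_insert \<open>h v = v'\<close> Vus by simp
  have "(\<lambda>e. h ` e) ` ?E ts = (\<lambda>e. f ` e) ` ?E ts"
  proof (rule image_cong[OF refl])
    fix e assume "e \<in> ?E ts"
    then have "e \<subseteq> ?V ts" using ltree_edges_subset by fastforce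
    then show "h ` e = f ` e" using hV by (intro image_cong[OF refl]) blast
  qed
  moreover have "h ` ltree_root ` set ts = f ` ltree_root ` set ts"
  proof (rule image_cong[OF refl])
    fix x assume "x \<in> ltree_root ` set ts"
    then obtain c' where "c' \<in> set ts" "x = ltree_root c'" by blast
    then have "x \<in> ?V ts" by (auto intro!: bexI[of _ c'])
    then show "h x = f x" by (rule hV)
  qed
  moreover have "(\<lambda>e. h ` e) ` (\<lambda>x. {v, x}) ` A = (\<lambda>x. {v', x}) ` h ` A" for A
    by (simp add: image_image \<open>h v = v'\<close>)
  ultimately have "(\<lambda>e. h ` e) ` ltree_edges (LNode v ts) = ltree_edges t'"
    unfolding t' ltree_edges_LNode_split image_Un by (simp only: f(2,3) Vus)
  then show ?case using 1 \<open>h v = v'\<close> t' by (intro exI[of _ h]) simp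
qed

lemma ltree_graph_iso_iff:
  assumes "distinct (ltree_verts t)" "distinct (ltree_verts t')"
  shows "ltree_graph t \<cong>\<^sub>r ltree_graph t' \<longleftrightarrow> shape t = shape t'"
proof
  assume "ltree_graph t \<cong>\<^sub>r ltree_graph t'"
  then obtain f where f: "bij_betw f (set (ltree_verts t)) (set (ltree_verts t'))"
    "(\<lambda>e. f ` e) ` ltree_edges t = ltree_edges t'" "f (ltree_root t) = ltree_root t'"
    unfolding rtree_iso_def by auto
  have "ltree_graph (map_ltree f t) = ltree_graph t'"
    using f by (auto simp: ltree_graph_def ltree_verts_map ltree_edges_map ltree_root_map
      bij_betw_def)
  moreover have "distinct (ltree_verts (map_ltree f t))"
    using assms f(1) by (simp add: ltree_verts_map distinct_map bij_betw_def)
  ultimately show "shape t = shape t'"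
    using shape_eq_if_graph_eq[OF _ assms(2)] by fastforce
next
  assume sh: "shape t = shape t'"
  obtain f where f: "f ` set (ltree_verts t) = set (ltree_verts t')"
    "(\<lambda>e. f ` e) ` ltree_edges t = ltree_edges t'" "f (ltree_root t) = ltree_root t'"
    using ltree_graph_map_if_shape_eq[OF assms(1) sh] by blast
  have "card (set (ltree_verts t)) = card (set (ltree_verts t'))"
    using assms sh by (simp add: distinct_card length_ltree_verts)
  then have "inj_on f (set (ltree_verts t))" using f(1) by (intro eq_card_imp_inj_on) auto
  then show "ltree_graph t \<cong>\<^sub>r ltree_graph t'"
    unfolding rtree_iso_def using f by (intro exI[of _ f]) (simp add: bij_betw_def)
qed

section \<open>Isomorphism classes as multiset trees\<close>

definition tree_of :: "rtree \<Rightarrow> tree" where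
  "tree_of t = shape (SOME l. distinct (ltree_verts l) \<and> ltree_graph l = rep_rtree t)"

lemma rooted_tree_rep_rtree: "rooted_tree (rep_rtree t)"
  using Quotient3_rep_reflp[OF Quotient3_rtree] by blast

lemma tree_of_cases:
  obtains l where "distinct (ltree_verts l)" "rep_rtree t = ltree_graph l" "tree_of t = shape l"
proof -
  obtain l where "distinct (ltree_verts l) \<and> ltree_graph l = rep_rtree t"
    using rooted_tree_eq_ltree_graph[OF rooted_tree_rep_rtree] by metis
  then show ?thesis
    using that[of "SOME l. distinct (ltree_verts l) \<and> ltree_graph l = rep_rtree t"]
      someI[of "\<lambda>l. distinct (ltree_verts l) \<and> ltree_graph l = rep_rtree t" l]
    unfolding tree_of_def by simp
qed

lemma iso_rep_rtree_iff:
  assumes "distinct (ltree_verts l)"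
  shows "ltree_graph l \<cong>\<^sub>r rep_rtree t \<longleftrightarrow> shape l = tree_of t"
proof -
  obtain k where "distinct (ltree_verts k)" "rep_rtree t = ltree_graph k" "tree_of t = shape k"
    using tree_of_cases by blast
  then show ?thesis using ltree_graph_iso_iff[OF assms] by simp
qed

lemma tree_size_eq: "tree_size t = tree_verts (tree_of t)"
proof -
  obtain k where "distinct (ltree_verts k)" "rep_rtree t = ltree_graph k" "tree_of t = shape k"
    using tree_of_cases by blast
  then show ?thesis
    unfolding tree_size_def by (simp add: distinct_card length_ltree_verts)
qed

lemma ex_ltree_shape: "\<exists>l :: nat ltree. distinct (ltree_verts l) \<and> shape l = t"
proof (induction t)
  case (Node M)
  then show ?case
  proof (induction M)
    case empty
    show ?case by (intro exI[of _ "LNode 0 []"]) simp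
  next
    case (add c M)
    have "\<exists>l :: nat ltree. distinct (ltree_verts l) \<and> shape l = Node M"
      by (rule add.IH) (use add.prems in auto)
    then obtain l :: "nat ltree" where l: "distinct (ltree_verts l)" "shape l = Node M" by blast
    obtain k :: "nat ltree" where k: "distinct (ltree_verts k)" "shape k = c"
      using add.prems[of c] by auto
    obtain v ts where vts: "l = LNode v ts" by (cases l)
    \<comment> \<open>Even labels for one tree and odd labels for the other make them
      disjoint.\<close>
    let ?f = "map_ltree (\<lambda>x. 2 * x)" and ?g = "map_ltree (\<lambda>x. 2 * x + 1)"
    obtain us where us: "?f l = LNode (2 * v) us" using vts by simp
    have "distinct (ltree_verts (LNode (2 * v) us))" "shape (LNode (2 * v) us) = Node M"
      unfolding us[symmetric] using l by (auto simp: ltree_verts_map distinct_map intro: inj_onI)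
    moreover have "distinct (ltree_verts (?g k))" "shape (?g k) = c"
      using k by (auto simp: ltree_verts_map distinct_map intro: inj_onI)
    moreover have "set (ltree_verts (LNode (2 * v) us)) \<inter> set (ltree_verts (?g k)) = {}"
      unfolding us[symmetric] by (auto simp: ltree_verts_map) presburger
    ultimately have "distinct (ltree_verts (LNode (2 * v) (?g k # us)))"
      "shape (LNode (2 * v) (?g k # us)) = Node (add_mset c M)" by auto
    then show ?case by blast
  qed
qed

lemma bij_tree_of: "bij tree_of"
proof (rule bijI)
  show "inj tree_of"
  proof (rule injI)
    fix s t assume st: "tree_of s = tree_of t"
    obtain k where k: "distinct (ltree_verts k)" "rep_rtree s = ltree_graph k" "tree_of s = shape k"
      using tree_of_cases by blast
    then have "rep_rtree s \<cong>\<^sub>r rep_rtree t" using iso_rep_rtree_iff[OF k(1), of t] st by simp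
    then show "s = t"
      using Quotient3_rel_rep[OF Quotient3_rtree, of s t] rooted_tree_rep_rtree by simp
  qed
  show "surj tree_of"
  proof (rule surjI)
    fix t
    define l :: "nat ltree" where "l = (SOME l. distinct (ltree_verts l) \<and> shape l = t)"
    have l: "distinct (ltree_verts l)" "shape l = t"
      using someI_ex[OF ex_ltree_shape[of t]] unfolding l_def by auto
    have r: "rooted_tree (ltree_graph l)" using l(1) by (rule rooted_tree_ltree_graph)
    let ?t = "abs_rtree (ltree_graph l)"
    have "rep_rtree ?t \<cong>\<^sub>r ltree_graph l"
      using Quotient3_rep_abs[OF Quotient3_rtree, of "ltree_graph l"] r rtree_iso_refl by blast
    then have "ltree_graph l \<cong>\<^sub>r rep_rtree ?t"
      using rtree_iso_sym rooted_tree_rep_rtree by blast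
    then show "tree_of (abs_rtree (ltree_graph (SOME l. distinct (ltree_verts l) \<and> shape l = t)))
      = t"
      using iso_rep_rtree_iff[OF l(1)] l unfolding l_def by simp
  qed
qed

section \<open>Counting grafts and cuts\<close>

text \<open>The multisets count vertices and edges, so that \<open>\<beta>\<close> and \<open>\<alpha>\<close> are their multiplicities; a cut
  is listed as the pair of the branch and the remaining tree.\<close>

primrec grafts :: "tree \<Rightarrow> tree \<Rightarrow> tree multiset" where
  "grafts s (Node M) = add_mset (Node (add_mset s M))
     (\<Sum>p\<in>#image_mset (\<lambda>c. (c, grafts s c)) M. image_mset (\<lambda>r. Node (add_mset r (M - {#fst p#})))
       (snd p))"

primrec cuts :: "tree \<Rightarrow> (tree \<times> tree) multiset" where
  "cuts (Node M) = (\<Sum>p\<in>#image_mset (\<lambda>c. (c, cuts c)) M.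
     add_mset (fst p, Node (M - {#fst p#}))
       (image_mset (\<lambda>q. (fst q, Node (add_mset (snd q) (M - {#fst p#})))) (snd p)))"

lemma grafts_Node [simp]:
  "grafts s (Node M) = add_mset (Node (add_mset s M))
     (\<Sum>c\<in>#M. image_mset (\<lambda>r. Node (add_mset r (M - {#c#}))) (grafts s c))"
  by (simp add: multiset.map_comp comp_def)

lemma cuts_Node [simp]:
  "cuts (Node M) = (\<Sum>c\<in>#M. add_mset (c, Node (M - {#c#}))
     (image_mset (\<lambda>q. (fst q, Node (add_mset (snd q) (M - {#c#})))) (cuts c)))"
  by (simp add: multiset.map_comp comp_def)

declare grafts.simps [simp del] cuts.simps [simp del]

lemma image_mset_concat:
  "image_mset f (mset (concat xss)) = (\<Sum>xs\<in>#mset xss. image_mset f (mset xs))"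
  by (induction xss) simp_all

text \<open>The root accounts for the first element of \<open>grafts\<close>; grafting at any other
  vertex alters only the child that contains it.\<close>

lemma grafts_shape:
  assumes "distinct (ltree_verts t)"
  shows "image_mset (\<lambda>v. shape (ltree_graft v s t)) (mset (ltree_verts t)) =
    grafts (shape s) (shape t)"
  using assms
proof (induction t)
  case (LNode u ts)
  let ?M = "mset (map shape ts)"
  have "image_mset (\<lambda>v. shape (ltree_graft v s (LNode u ts))) (mset (ltree_verts c)) =
    image_mset (\<lambda>r. Node (add_mset r (?M - {#shape c#}))) (grafts (shape s) (shape c))"
    if c: "c \<in> set ts" for c
  proof -
    obtain xs ys where ts: "ts = xs @ c # ys" using split_list[OF c] by blast
    have "distinct (ltree_verts c)" using LNode.prems unfolding ts by simp
    note IH = LNode.IH[OF c this]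
    have "shape (ltree_graft v s (LNode u ts)) =
        Node (add_mset (shape (ltree_graft v s c)) (?M - {#shape c#}))"
      if "v \<in> set (ltree_verts c)" for v
      using ltree_graft_in_child[OF LNode.prems[unfolded ts] that, of s]
      unfolding ts by (simp del: ltree_graft.simps)
    then have "image_mset (\<lambda>v. shape (ltree_graft v s (LNode u ts))) (mset (ltree_verts c)) =
        image_mset (\<lambda>v. Node (add_mset (shape (ltree_graft v s c)) (?M - {#shape c#})))
          (mset (ltree_verts c))"
      by (intro image_mset_cong) simp
    also have "\<dots> = image_mset (\<lambda>r. Node (add_mset r (?M - {#shape c#})))
      (grafts (shape s) (shape c))"
      unfolding IH[symmetric] by (simp add: multiset.map_comp comp_def)
    finally show ?thesis .
  qed
  then have "(\<Sum>c\<in>#mset ts. image_mset (\<lambda>v. shape (ltree_graft v s (LNode u ts)))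
    (mset (ltree_verts c))) =
      (\<Sum>c\<in>#mset ts. image_mset (\<lambda>r. Node (add_mset r (?M - {#shape c#})))
        (grafts (shape s) (shape c)))"
    by (intro arg_cong[of _ _ sum_mset] image_mset_cong) simp
  moreover have "shape (ltree_graft u s (LNode u ts)) = Node (add_mset (shape s) ?M)"
    using ltree_graft_at_root[OF LNode.prems, of s] by (simp del: ltree_graft.simps)
  ultimately show ?case
    by (simp add: image_mset_concat multiset.map_comp comp_def del: ltree_graft.simps)
qed

lemma cuts_shape:
  assumes "distinct (ltree_verts t)"
  shows "image_mset (\<lambda>q. (shape (snd q), shape (ltree_prune (ltree_root (snd q)) t)))
    (mset (ltree_subtrees t)) = cuts (shape t)"
  using assms
proof (induction t)
  case (LNode u ts)
  let ?M = "mset (map shape ts)" and ?t = "LNode u ts"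
  let ?f = "\<lambda>t q. (shape (snd q), shape (ltree_prune (ltree_root (snd q)) t))"
  have "image_mset (?f ?t) (mset ((u, c) # ltree_subtrees c)) =
    add_mset (shape c, Node (?M - {#shape c#}))
      (image_mset (\<lambda>q. (fst q, Node (add_mset (snd q) (?M - {#shape c#})))) (cuts (shape c)))"
    if c: "c \<in> set ts" for c
  proof -
    obtain xs ys where ts: "ts = xs @ c # ys" using split_list[OF c] by blast
    have "distinct (ltree_verts c)" using LNode.prems unfolding ts by simp
    note IH = LNode.IH[OF c this]
    have "?f ?t q = (\<lambda>q. (fst q, Node (add_mset (snd q) (?M - {#shape c#})))) (?f c q)"
      if "q \<in> set (ltree_subtrees c)" for q
      using ltree_prune_in_child[OF LNode.prems[unfolded ts], of "fst q" "snd q"] that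
      unfolding ts by (simp del: ltree_prune_LNode)
    then have "image_mset (?f ?t) (mset (ltree_subtrees c)) =
      image_mset (\<lambda>q. (\<lambda>q. (fst q, Node (add_mset (snd q) (?M - {#shape c#})))) (?f c q))
        (mset (ltree_subtrees c))"
      by (intro image_mset_cong) simp
    also have "\<dots> = image_mset (\<lambda>q. (fst q, Node (add_mset (snd q) (?M - {#shape c#}))))
      (cuts (shape c))"
      unfolding IH[symmetric] by (simp add: multiset.map_comp comp_def)
    finally show ?thesis
      using ltree_prune_at_root[OF LNode.prems[unfolded ts]] unfolding ts
        by (simp del: ltree_prune_LNode)
  qed
  then have "(\<Sum>c\<in>#mset ts. image_mset (?f ?t) (mset ((u, c) # ltree_subtrees c))) =
      (\<Sum>c\<in>#mset ts. add_mset (shape c, Node (?M - {#shape c#}))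
      (image_mset (\<lambda>q. (fst q, Node (add_mset (snd q) (?M - {#shape c#})))) (cuts (shape c))))"
    by (intro arg_cong[of _ _ sum_mset] image_mset_cong) simp
  then show ?case
    by (simp add: image_mset_concat multiset.map_comp comp_def del: ltree_prune_LNode)
qed

section \<open>The numbers \<alpha> and \<beta> as multiplicities\<close>

lemma ltree_edges_subtrees:
  "ltree_edges t = (\<lambda>q. {fst q, ltree_root (snd q)}) ` set (ltree_subtrees t)"
  by (induction t) (force simp: image_UN)

lemma ltree_subtrees_roots:
  "ltree_verts t = ltree_root t # map (ltree_root \<circ> snd) (ltree_subtrees t)"
proof (induction t)
  case (LNode v ts)
  then have "map ltree_verts ts = map (\<lambda>c. ltree_root c # map (ltree_root \<circ> snd)
    (ltree_subtrees c)) ts"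
    by (intro map_cong refl)
  then show ?case unfolding ltree_verts.simps by (simp only:) (simp add: map_concat comp_def)
qed

text \<open>An edge determines its lower endpoint as the root of the branch cut off by it, and
  distinct labels make this endpoint determine the entry of the list.\<close>

lemma ltree_subtrees_edge_inj:
  assumes "distinct (ltree_verts t)"
  shows "inj_on (\<lambda>q. {fst q, ltree_root (snd q)}) (set (ltree_subtrees t))"
proof (rule inj_onI)
  fix q q' assume q: "q \<in> set (ltree_subtrees t)" "q' \<in> set (ltree_subtrees t)"
    and eq: "{fst q, ltree_root (snd q)} = {fst q', ltree_root (snd q')}"
  have inj: "inj_on (ltree_root \<circ> snd) (set (ltree_subtrees t))"
    using assms unfolding ltree_subtrees_roots[of t] by (simp add: distinct_map)
  have "cut_branch {fst q, ltree_root (snd q)} (ltree_graph t) = ltree_graph (snd q)"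
    "cut_branch {fst q', ltree_root (snd q')} (ltree_graph t) = ltree_graph (snd q')"
    using ltree_cut(2)[OF assms, of "fst q" "snd q"] ltree_cut(2)[OF assms, of "fst q'"
      "snd q'"] q by auto
  then have "ltree_root (snd q) = ltree_root (snd q')"
    using eq by (metis ltree_graph_simps(3))
  then show "q = q'" using inj_onD[OF inj _ q] by simp
qed

lemma count_image_mset_distinct:
  "distinct xs \<Longrightarrow> count (image_mset f (mset xs)) y = card {x \<in> set xs. f x = y}"
proof (induction xs)
  case (Cons a xs)
  have "{x \<in> set (a # xs). f x = y} =
    (if f a = y then insert a {x \<in> set xs. f x = y} else {x \<in> set xs. f x = y})"
    by auto
  then show ?case using Cons by simp
qed simp

text \<open>Compares the graft on a disjoint union, as in \<open>graft\<close>, with the one on the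
  original labels, where the labels of \<open>s\<close> and \<open>t\<close> may overlap.\<close>

lemma shape_graft_map:
  "inj f \<Longrightarrow> shape (ltree_graft (f v) (map_ltree g s) (map_ltree f t)) = shape (ltree_graft v s t)"
proof (induction t)
  case (LNode u ts)
  then have "map (\<lambda>t. shape (ltree_graft (f v) (map_ltree g s) (map_ltree f t))) ts =
    map (\<lambda>t. shape (ltree_graft v s t)) ts" by simp
  then have "mset (map (\<lambda>t. shape (ltree_graft (f v) (map_ltree g s) (map_ltree f t))) ts) =
    mset (map (\<lambda>t. shape (ltree_graft v s t)) ts)" by (rule arg_cong)
  then show ?case using LNode.prems by (simp add: inj_eq multiset.map_comp comp_def)
qed

lemma beta_eq: "beta r s t = count (grafts (tree_of s) (tree_of t)) (tree_of r)"
proof -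
  obtain l where l: "distinct (ltree_verts l)" "rep_rtree t = ltree_graph l" "tree_of t = shape l"
    using tree_of_cases by blast
  obtain k where k: "distinct (ltree_verts k)" "rep_rtree s = ltree_graph k" "tree_of s = shape k"
    using tree_of_cases by blast
  obtain m where m: "distinct (ltree_verts m)" "rep_rtree r = ltree_graph m" "tree_of r = shape m"
    using tree_of_cases by blast
  have "ltree_graph m \<cong>\<^sub>r graft (ltree_graph l) v (ltree_graph k) \<longleftrightarrow> shape (ltree_graft v k l) =
    tree_of r"
    if v: "v \<in> set (ltree_verts l)" for v
  proof -
    let ?l = "map_ltree Inl l :: (nat + nat) ltree" and ?k = "map_ltree Inr k :: (nat + nat) ltree"
    have d: "distinct (ltree_verts (ltree_graft (Inl v) ?k ?l))"
      using l(1) k(1) v by (intro distinct_ltree_graft) (auto simp: ltree_verts_map distinct_map)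
    have "shape (ltree_graft (Inl v) ?k ?l) = shape (ltree_graft v k l)"
      by (intro shape_graft_map) simp
    then show ?thesis
      unfolding graft_ltree_graph[OF l(1) v] ltree_graph_iso_iff[OF m(1) d] m(3) by auto
  qed
  then have "beta r s t = card {v \<in> set (ltree_verts l). shape (ltree_graft v k l) = tree_of r}"
    unfolding beta_def l(2) k(2) m(2) by (intro arg_cong[of _ _ card]) auto
  also have "\<dots> = count (grafts (tree_of s) (tree_of t)) (tree_of r)"
    unfolding l(3) k(3) grafts_shape[OF l(1), symmetric] count_image_mset_distinct[OF l(1)] ..
  finally show ?thesis .
qed

lemma alpha_eq: "alpha s t r = count (cuts (tree_of t)) (tree_of s, tree_of r)"
proof -
  obtain l where l: "distinct (ltree_verts l)" "rep_rtree t = ltree_graph l" "tree_of t = shape l"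
    using tree_of_cases by blast
  let ?e = "\<lambda>q. {fst q, ltree_root (snd q)}"
  have cut: "cut_root (?e q) (ltree_graph l) = ltree_graph (ltree_prune (ltree_root (snd q)) l)"
    "cut_branch (?e q) (ltree_graph l) = ltree_graph (snd q)"
    "distinct (ltree_verts (ltree_prune (ltree_root (snd q)) l))"
    "distinct (ltree_verts (snd q))"
    if "q \<in> set (ltree_subtrees l)" for q
  proof -
    have q: "(fst q, snd q) \<in> set (ltree_subtrees l)" using that by simp
    show "cut_root (?e q) (ltree_graph l) = ltree_graph (ltree_prune (ltree_root (snd q)) l)"
      "cut_branch (?e q) (ltree_graph l) = ltree_graph (snd q)"
      using ltree_cut[OF l(1) q] by auto
    have "distinct (ltree_verts (ltree_prune (ltree_root (snd q)) l) @ ltree_verts (snd q))"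
      using mset_eq_imp_distinct_iff[of "ltree_verts l"
        "ltree_verts (ltree_prune (ltree_root (snd q)) l) @ ltree_verts (snd q)"]
        ltree_prune_split[OF l(1) q] l(1) by simp
    then show "distinct (ltree_verts (ltree_prune (ltree_root (snd q)) l))"
      "distinct (ltree_verts (snd q))" by auto
  qed
  let ?Q = "{q \<in> set (ltree_subtrees l).
    (shape (snd q), shape (ltree_prune (ltree_root (snd q)) l)) = (tree_of s, tree_of r)}"
  have "{e \<in> ltree_edges l. cut_root e (ltree_graph l) \<cong>\<^sub>r rep_rtree r \<and>
      cut_branch e (ltree_graph l) \<cong>\<^sub>r rep_rtree s} = ?e ` ?Q"
  proof -
    have "cut_root (?e q) (ltree_graph l) \<cong>\<^sub>r rep_rtree r \<and> cut_branch (?e q) (ltree_graph l) \<cong>\<^sub>r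
      rep_rtree s
      \<longleftrightarrow> (shape (snd q), shape (ltree_prune (ltree_root (snd q)) l)) = (tree_of s, tree_of r)"
      if q: "q \<in> set (ltree_subtrees l)" for q
      unfolding cut(1,2)[OF q] iso_rep_rtree_iff[OF cut(3)[OF q]]
        iso_rep_rtree_iff[OF cut(4)[OF q]] by auto
    then show ?thesis unfolding ltree_edges_subtrees by blast
  qed
  then have "alpha s t r = card (?e ` ?Q)"
    unfolding alpha_def l(2) by simp
  also have "\<dots> = card ?Q"
    by (intro card_image inj_on_subset[OF ltree_subtrees_edge_inj[OF l(1)]] Collect_restrict)
  also have "\<dots> = count (cuts (tree_of t)) (tree_of s, tree_of r)"
  proof -
    have d: "distinct (ltree_subtrees l)"
      using l(1) unfolding ltree_subtrees_roots[of l] by (simp add: distinct_map)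
    show ?thesis
      unfolding l(3) cuts_shape[OF l(1), symmetric] count_image_mset_distinct[OF d] ..
  qed
  finally show ?thesis .
qed

section \<open>Linear maps and derivations\<close>

instantiation poly_mapping :: (type, complex_vector_space) complex_vector_space
begin

lift_definition scaleC_poly_mapping :: "complex \<Rightarrow> ('a \<Rightarrow>\<^sub>0 'b) \<Rightarrow> 'a \<Rightarrow>\<^sub>0 'b"
  is "\<lambda>a f k. a *\<^sub>C f k"
  by (rule finite_subset[rotated]) auto

instance
  by standard (transfer; simp add: fun_eq_iff scaleC_add_right scaleC_add_left scaleC_scaleC
    scaleC_one)+

end

lemma scaleC_single: "a *\<^sub>C Poly_Mapping.single k b = Poly_Mapping.single k (a *\<^sub>C b)"
  by (rule poly_mapping_eqI) (simp add: scaleC_poly_mapping.rep_eq lookup_single when_def)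

lemma poly_mapping_single_induct [case_names zero single add]:
  assumes "P 0" "\<And>k b. P (Poly_Mapping.single k b)" "\<And>f g. P f \<Longrightarrow> P g \<Longrightarrow> P (f + g)"
  shows "P (p :: 'a \<Rightarrow>\<^sub>0 'b::monoid_add)"
proof (induction p rule: update_induct)
  case const
  show ?case by (rule assms(1))
next
  case (update f k b)
  have "Poly_Mapping.update k b f = f + Poly_Mapping.single k b"
    using update(1)
    by (intro poly_mapping_eqI)
      (auto simp: lookup_update lookup_add lookup_single in_keys_iff when_def)
  then show ?case using assms update(3) by simp
qed

instance poly_mapping :: (monoid_add, complex_algebra_1) complex_algebra_1
proof
  fix a :: complex and x y :: "'a \<Rightarrow>\<^sub>0 'b"
  have single: "(a *\<^sub>C Poly_Mapping.single k b) * Poly_Mapping.single l c =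
    a *\<^sub>C (Poly_Mapping.single k b * Poly_Mapping.single l c)"
    "Poly_Mapping.single k b * (a *\<^sub>C Poly_Mapping.single l c) =
    a *\<^sub>C (Poly_Mapping.single k b * Poly_Mapping.single l c)" for k l :: 'a and b c :: 'b
    by (simp_all add: scaleC_single mult_single scaleC_mult_left scaleC_mult_right)
  have "(a *\<^sub>C Poly_Mapping.single k b) * y = a *\<^sub>C (Poly_Mapping.single k b * y)" for k b
    by (induction y rule: poly_mapping_single_induct) (simp_all add: single distrib_left
      scaleC_add_right)
  then show "(a *\<^sub>C x) * y = a *\<^sub>C (x * y)"
    by (induction x rule: poly_mapping_single_induct) (simp_all add: distrib_right scaleC_add_right)
  have "Poly_Mapping.single k b * (a *\<^sub>C y) = a *\<^sub>C (Poly_Mapping.single k b * y)" for k b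
    by (induction y rule: poly_mapping_single_induct) (simp_all add: single distrib_left
      scaleC_add_right)
  then show "x * (a *\<^sub>C y) = a *\<^sub>C (x * y)"
    by (induction x rule: poly_mapping_single_induct) (simp_all add: distrib_right scaleC_add_right)
qed

section \<open>Linear maps\<close>

definition clinear :: "('a::complex_vector_space \<Rightarrow> 'b::complex_vector_space) \<Rightarrow> bool" where
  "clinear f \<longleftrightarrow> (\<forall>x y. f (x + y) = f x + f y) \<and> (\<forall>a x. f (a *\<^sub>C x) = a *\<^sub>C f x)"

lemma clinearI:
  "(\<And>x y. f (x + y) = f x + f y) \<Longrightarrow> (\<And>a x. f (a *\<^sub>C x) = a *\<^sub>C f x) \<Longrightarrow> clinear f"
  by (simp add: clinear_def)

lemma clinear_add: "clinear f \<Longrightarrow> f (x + y) = f x + f y"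
  and clinear_scale: "clinear f \<Longrightarrow> f (a *\<^sub>C x) = a *\<^sub>C f x"
  by (simp_all add: clinear_def)

lemma clinear_0: "clinear f \<Longrightarrow> f 0 = 0"
  using clinear_scale[of f 0 0] by simp

lemma clinear_neg: "clinear f \<Longrightarrow> f (- x) = - f x"
  using clinear_add[of f x "- x"] clinear_0[of f] by (simp add: eq_neg_iff_add_eq_0 add.commute)

lemma clinear_diff: "clinear f \<Longrightarrow> f (x - y) = f x - f y"
  using clinear_add[of f x "- y"] clinear_neg[of f y] by simp

lemma clinear_sum: "clinear f \<Longrightarrow> f (\<Sum>i\<in>A. g i) = (\<Sum>i\<in>A. f (g i))"
  by (induction A rule: infinite_finite_induct) (simp_all add: clinear_0 clinear_add)

lemma clinear_sum_mset: "clinear f \<Longrightarrow> f (\<Sum>i\<in>#A. g i) = (\<Sum>i\<in>#A. f (g i))"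
  by (induction A) (simp_all add: clinear_0 clinear_add)

lemma clinear_compose_add: "clinear f \<Longrightarrow> clinear g \<Longrightarrow> clinear (\<lambda>x. f x + g x)"
  and clinear_compose_diff: "clinear f \<Longrightarrow> clinear g \<Longrightarrow> clinear (\<lambda>x. f x - g x)"
  and clinear_compose_neg: "clinear f \<Longrightarrow> clinear (\<lambda>x. - f x)"
  and clinear_compose_scale: "clinear f \<Longrightarrow> clinear (\<lambda>x. a *\<^sub>C f x)"
  and clinear_compose: "clinear h \<Longrightarrow> clinear f \<Longrightarrow> clinear (\<lambda>x. h (f x))"
  and clinear_zero: "clinear (\<lambda>x. 0)"
  and clinear_id: "clinear (\<lambda>x. x)"
  by (simp_all add: clinear_def complex_vector.scale_right_diff_distrib scaleC_add_right
      complex_vector.scale_left_commute)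

lemma clinear_compose_sum: "(\<And>i. i \<in> A \<Longrightarrow> clinear (f i)) \<Longrightarrow> clinear (\<lambda>x. \<Sum>i\<in>A. f i x)"
  by (induction A rule: infinite_finite_induct) (simp_all add: clinear_zero clinear_compose_add)

lemma clinear_compose_sum_mset: "(\<And>i. i \<in># A \<Longrightarrow> clinear (f i)) \<Longrightarrow> clinear (\<lambda>x. \<Sum>i\<in>#A. f i x)"
  by (induction A) (simp_all add: clinear_zero clinear_compose_add)

lemma clinear_mult_left: "clinear (\<lambda>x. (p :: 'a::complex_algebra_1) * x)"
  and clinear_mult_right: "clinear (\<lambda>x. x * (p :: 'a::complex_algebra_1))"
  by (simp_all add: clinear_def distrib_left distrib_right scaleC_mult_left scaleC_mult_right)

lemmas clinear_intros = clinear_compose_add clinear_compose_diff clinear_compose_neg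
  clinear_compose_scale
  clinear_zero clinear_id clinear_compose_sum clinear_compose_sum_mset clinear_mult_left
    clinear_mult_right

lemma clinear_eqI:
  fixes f g :: "('a \<Rightarrow>\<^sub>0 complex) \<Rightarrow> 'b::complex_vector_space"
  assumes "clinear f" "clinear g"
    and "\<And>k. f (Poly_Mapping.single k 1) = g (Poly_Mapping.single k 1)"
  shows "f p = g p"
proof (induction p rule: poly_mapping_single_induct)
  case (single k b)
  have "Poly_Mapping.single k b = b *\<^sub>C Poly_Mapping.single k 1"
    by (simp add: scaleC_single scaleC_complex_def)
  then show ?case using assms(3) clinear_scale[OF assms(1)] clinear_scale[OF assms(2)] by metis
qed (simp_all add: assms(1,2)[THEN clinear_add] assms(1,2)[THEN clinear_0])

definition lin_ext :: "('a \<Rightarrow> 'b::complex_vector_space) \<Rightarrow> ('a \<Rightarrow>\<^sub>0 complex) \<Rightarrow> 'b" where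
  "lin_ext g p = (\<Sum>k\<in>Poly_Mapping.keys p. Poly_Mapping.lookup p k *\<^sub>C g k)"

lemma lin_ext_superset:
  "finite A \<Longrightarrow> Poly_Mapping.keys p \<subseteq> A \<Longrightarrow> lin_ext g p = (\<Sum>k\<in>A. Poly_Mapping.lookup p k *\<^sub>C g k)"
  unfolding lin_ext_def by (rule sum.mono_neutral_left) (auto simp: in_keys_iff)

lemma clinear_lin_ext: "clinear (lin_ext g)"
proof (rule clinearI)
  fix p q :: "'a \<Rightarrow>\<^sub>0 complex"
  let ?A = "Poly_Mapping.keys p \<union> Poly_Mapping.keys q"
  have "Poly_Mapping.keys (p + q) \<subseteq> ?A" by (rule Poly_Mapping.keys_add)
  then show "lin_ext g (p + q) = lin_ext g p + lin_ext g q"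
    by (simp add: lin_ext_superset[of ?A] lookup_add scaleC_add_left sum.distrib)
next
  fix a :: complex and p :: "'a \<Rightarrow>\<^sub>0 complex"
  have "Poly_Mapping.keys (a *\<^sub>C p) \<subseteq> Poly_Mapping.keys p"
    by (auto simp: in_keys_iff scaleC_poly_mapping.rep_eq)
  then show "lin_ext g (a *\<^sub>C p) = a *\<^sub>C lin_ext g p"
    by (simp add: lin_ext_superset[of "Poly_Mapping.keys p"] scaleC_poly_mapping.rep_eq
        scaleC_complex_def complex_vector.scale_sum_right scaleC_scaleC)
qed

lemma lin_ext_single [simp]: "lin_ext g (Poly_Mapping.single k b) = b *\<^sub>C g k"
  by (cases "b = 0") (simp_all add: lin_ext_def)

text \<open>Monomials are multisets of variables, so the convolution product is the product of
  polynomials; for variables indexed by trees, a monomial is a forest.\<close>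

type_synonym 'a spoly = "'a multiset \<Rightarrow>\<^sub>0 complex"

abbreviation mon :: "'a multiset \<Rightarrow> 'a spoly" where
  "mon M \<equiv> Poly_Mapping.single M 1"

abbreviation var :: "'a \<Rightarrow> 'a spoly" where
  "var x \<equiv> mon {#x#}"

lemma mon_add: "mon (M + N) = mon M * mon N"
  by (simp add: mult_single)

lemma mon_add_mset: "mon (add_mset x M) = var x * mon M"
  by (simp add: mult_single)

section \<open>Derivations of the polynomial ring\<close>

definition derivation :: "('a spoly \<Rightarrow> 'a spoly) \<Rightarrow> bool" where
  "derivation X \<longleftrightarrow> clinear X \<and> (\<forall>p q. X (p * q) = X p * q + p * X q)"

lemma derivation_clinear: "derivation X \<Longrightarrow> clinear X"
  and derivation_mult: "derivation X \<Longrightarrow> X (p * q) = X p * q + p * X q"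
  by (simp_all add: derivation_def)

lemma derivation_one: "derivation X \<Longrightarrow> X 1 = 0"
  by (drule derivation_mult[of X 1 1]) simp

lemma derivation_eq_mon:
  assumes "derivation X" "derivation Y" "\<And>x. x \<in># M \<Longrightarrow> X (var x) = Y (var x)"
  shows "X (mon M) = Y (mon M)"
  using assms(3)
proof (induction M)
  case empty
  show ?case by (simp add: derivation_one assms(1,2))
next
  case (add x M)
  then show ?case unfolding mon_add_mset[of x M] by (simp add: assms(1,2)[THEN derivation_mult])
qed

lemma derivation_eqI:
  assumes "derivation X" "derivation Y" "\<And>x. X (var x) = Y (var x)"
  shows "X p = Y p"
  by (rule clinear_eqI[OF assms(1,2)[THEN derivation_clinear]]) (rule derivation_eq_mon[OF assms])

lemma derivation_commutator:
  assumes "derivation X" "derivation Y"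
  shows "derivation (\<lambda>p. X (Y p) - Y (X p))"
proof -
  note X = derivation_clinear[OF assms(1)] and Y = derivation_clinear[OF assms(2)]
  have "clinear (\<lambda>p. X (Y p) - Y (X p))"
    by (intro clinear_compose_diff clinear_compose[OF X Y] clinear_compose[OF Y X])
  then show ?thesis
    by (simp add: derivation_def assms[THEN derivation_mult] clinear_add[OF X] clinear_add[OF Y]
      algebra_simps)
qed

lemma derivation_sum:
  assumes "\<And>i. i \<in> A \<Longrightarrow> derivation (X i)"
  shows "derivation (\<lambda>p. \<Sum>i\<in>A. a i *\<^sub>C X i p)"
proof -
  have "clinear (\<lambda>p. \<Sum>i\<in>A. a i *\<^sub>C X i p)"
    using assms by (intro clinear_intros) (simp add: derivation_clinear)
  moreover have "(\<Sum>i\<in>A. a i *\<^sub>C X i (p * q)) = (\<Sum>i\<in>A. a i *\<^sub>C X i p) * q +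
    p * (\<Sum>i\<in>A. a i *\<^sub>C X i q)" for p q
    by (simp add: assms[THEN derivation_mult] scaleC_add_right scaleC_mult_left scaleC_mult_right
        sum.distrib sum_distrib_left sum_distrib_right)
  ultimately show ?thesis by (simp add: derivation_def)
qed

lemma derivation_add: "derivation X \<Longrightarrow> derivation Y \<Longrightarrow> derivation (\<lambda>p. X p + Y p)"
  by (simp add: derivation_def clinear_compose_add algebra_simps)

lemma derivation_scale: "derivation X \<Longrightarrow> derivation (\<lambda>p. a *\<^sub>C X p)"
  by (simp add: derivation_def clinear_compose_scale scaleC_add_right scaleC_mult_left
    scaleC_mult_right)

text \<open>The derivation with value \<open>\<phi> x\<close> at the variable \<open>x\<close>.
  Summing over the multiset accounts for repeated factors, as in the derivative n x^(n-1) of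
  x^n.\<close>

definition Der :: "('a \<Rightarrow> 'a spoly) \<Rightarrow> 'a spoly \<Rightarrow> 'a spoly" where
  "Der \<phi> = lin_ext (\<lambda>M. \<Sum>x\<in>#M. mon (M - {#x#}) * \<phi> x)"

lemma clinear_Der: "clinear (Der \<phi>)"
  unfolding Der_def by (rule clinear_lin_ext)

lemma Der_mon: "Der \<phi> (mon M) = (\<Sum>x\<in>#M. mon (M - {#x#}) * \<phi> x)"
  by (simp add: Der_def scaleC_one)

lemma Der_var [simp]: "Der \<phi> (var x) = \<phi> x"
  by (simp add: Der_mon)

lemma derivation_Der: "derivation (Der \<phi>)"
proof -
  have mon: "Der \<phi> (mon M * mon N) = Der \<phi> (mon M) * mon N + mon M * Der \<phi> (mon N)" for M N
  proof -
    have "(\<Sum>x\<in>#M. mon (M + N - {#x#}) * \<phi> x) = (\<Sum>x\<in>#M. mon (M - {#x#}) * \<phi> x * mon N)"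
    proof (intro arg_cong[of _ _ sum_mset] image_mset_cong)
      fix x assume "x \<in># M"
      then have MN: "M + N - {#x#} = (M - {#x#}) + N"
        using multiset_diff_union_assoc[of "{#x#}" M N] by (simp add: add.commute)
      show "mon (M + N - {#x#}) * \<phi> x = mon (M - {#x#}) * \<phi> x * mon N"
        unfolding MN mon_add by (simp only: ac_simps)
    qed
    moreover have "(\<Sum>x\<in>#N. mon (M + N - {#x#}) * \<phi> x) = (\<Sum>x\<in>#N. mon M * (mon (N - {#x#}) * \<phi> x))"
    proof (intro arg_cong[of _ _ sum_mset] image_mset_cong)
      fix x assume "x \<in># N"
      then have MN: "M + N - {#x#} = M + (N - {#x#})"
        using multiset_diff_union_assoc[of "{#x#}" N M] by simp
      show "mon (M + N - {#x#}) * \<phi> x = mon M * (mon (N - {#x#}) * \<phi> x)"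
        unfolding MN mon_add by (simp only: ac_simps)
    qed
    ultimately show ?thesis
      unfolding mon_add[symmetric] Der_mon
      by (simp add: sum_mset_distrib_left sum_mset_distrib_right)
  qed
  note intros = clinear_compose_add clinear_compose[OF clinear_Der clinear_mult_left]
    clinear_compose[OF clinear_Der clinear_mult_right]
    clinear_compose[OF clinear_mult_left clinear_Der]
      clinear_compose[OF clinear_mult_right clinear_Der]
    clinear_mult_left clinear_mult_right
  have "Der \<phi> (mon M * q) = Der \<phi> (mon M) * q + mon M * Der \<phi> q" for M q
    by (rule clinear_eqI[of "\<lambda>q. Der \<phi> (mon M * q)" "\<lambda>q. Der \<phi> (mon M) * q + mon M * Der \<phi> q"])
      (rule mon intros)+
  note mon_left = this
  have "Der \<phi> (p * q) = Der \<phi> p * q + p * Der \<phi> q" for p q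
    by (rule clinear_eqI[of "\<lambda>p. Der \<phi> (p * q)" "\<lambda>p. Der \<phi> p * q + p * Der \<phi> q"])
      (rule mon_left intros)+
  then show ?thesis unfolding derivation_def using clinear_Der by blast
qed

text \<open>Turns sums over all grafts or cuts into sums weighted by multiplicities, the form in
  which \<alpha> and \<beta> enter the brackets.\<close>

lemma sum_mset_eq_sum_count:
  assumes "finite S" "set_mset A \<subseteq> S"
  shows "(\<Sum>x\<in>#A. f x) = (\<Sum>x\<in>S. of_nat (count A x) *\<^sub>C (f x :: 'b::complex_vector_space))"
  using assms(2)
proof (induction A)
  case (add a A)
  have "(\<Sum>x\<in>S. of_nat (count (add_mset a A) x) *\<^sub>C f x) =
    (\<Sum>x\<in>S. of_nat (count A x) *\<^sub>C f x + (if x = a then f x else 0))"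
    by (intro sum.cong) (auto simp: scaleC_add_left scaleC_one)
  then show ?case using add assms(1) by (simp add: sum.distrib)
qed simp

section \<open>The tree action on polynomials\<close>

definition trees_of_size :: "nat \<Rightarrow> tree set" where
  "trees_of_size n = {t. tree_verts t = n}"

lemma tree_verts_pos: "tree_verts t > 0"
  by (cases t) simp

lemma tree_verts_Node [simp]: "tree_verts (Node M) = Suc (\<Sum>t\<in>#M. tree_verts t)"
  by simp

declare tree_verts.simps [simp del]

lemma size_le_sum_tree_verts: "size M \<le> (\<Sum>t\<in>#M. tree_verts t)"
proof (induction M)
  case (add t M)
  then show ?case using tree_verts_pos[of t] by simp
qed simp

lemma sum_tree_verts_remove:
  "c \<in># M \<Longrightarrow> (\<Sum>t\<in>#M. tree_verts t) = tree_verts c + (\<Sum>t\<in>#M - {#c#}. tree_verts t)"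
  by (auto dest!: multi_member_split)

lemma finite_trees_upto: "finite {t. tree_verts t \<le> n}"
proof (induction n)
  case 0
  have "\<not> tree_verts t \<le> 0" for t using tree_verts_pos[of t] by simp
  then have "{t. tree_verts t \<le> 0} = {}" by blast
  then show ?case by (metis finite.emptyI)
next
  case (Suc n)
  have "{t. tree_verts t \<le> Suc n} \<subseteq>
    (\<lambda>ts. Node (mset ts)) ` {ts. set ts \<subseteq> {t. tree_verts t \<le> n} \<and> length ts \<le> n}"
  proof
    fix t assume "t \<in> {t. tree_verts t \<le> Suc n}"
    then obtain M where t: "t = Node M" "(\<Sum>t\<in>#M. tree_verts t) \<le> n" by (cases t) auto
    obtain ts where ts: "mset ts = M" using ex_mset by blast
    have "tree_verts c \<le> n" if "c \<in># M" for c
      using t(2) sum_tree_verts_remove[OF that] by linarith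
    moreover have "length ts \<le> n" using size_le_sum_tree_verts[of M] t(2) size_mset[of ts]
      unfolding ts by linarith
    ultimately show "t \<in> (\<lambda>ts. Node (mset ts)) ` {ts. set ts \<subseteq> {t. tree_verts t \<le> n} \<and> length ts \<le>
      n}"
      using t(1) set_mset_mset[of ts] unfolding ts by (intro image_eqI[of _ _ ts]) (auto simp: ts)
  qed
  then show ?case using finite_lists_length_le[OF Suc] finite_subset by blast
qed

lemma finite_trees_of_size [simp]: "finite (trees_of_size n)"
  by (rule finite_subset[OF _ finite_trees_upto[of n]]) (auto simp: trees_of_size_def)

lemma tree_verts_grafts: "r \<in># grafts s t \<Longrightarrow> tree_verts r = tree_verts s + tree_verts t"
proof (induction t arbitrary: r)
  case (Node M)
  then consider "r = Node (add_mset s M)" |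
    c r' where "c \<in># M" "r' \<in># grafts s c" "r = Node (add_mset r' (M - {#c#}))"
    by auto
  then show ?case
  proof cases
    case 2
    then show ?thesis using Node.IH[OF 2(1,2)] sum_tree_verts_remove[OF 2(1)] by simp
  qed simp
qed

lemma tree_verts_cuts: "q \<in># cuts t \<Longrightarrow> tree_verts (fst q) + tree_verts (snd q) = tree_verts t"
proof (induction t arbitrary: q)
  case (Node M)
  then consider c where "c \<in># M" "q = (c, Node (M - {#c#}))" |
    c q' where "c \<in># M" "q' \<in># cuts c" "q = (fst q', Node (add_mset (snd q') (M - {#c#})))"
    by auto
  then show ?case
  proof cases
    case 1
    then show ?thesis using sum_tree_verts_remove[OF 1(1)] by simp
  next
    case 2
    then show ?thesis using Node.IH[OF 2(1,2)] sum_tree_verts_remove[OF 2(1)] by simp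
  qed
qed

lemma count_grafts_eq_0: "tree_verts r \<noteq> tree_verts s + tree_verts t \<Longrightarrow> count (grafts s t) r = 0"
  using tree_verts_grafts count_eq_zero_iff by metis

lemma count_cuts_eq_0: "tree_verts s + tree_verts r \<noteq> tree_verts t \<Longrightarrow> count (cuts t) (s, r) = 0"
  using tree_verts_cuts[of "(s, r)" t] count_eq_zero_iff by fastforce

definition graftD :: "tree \<Rightarrow> tree spoly \<Rightarrow> tree spoly" where
  "graftD s = Der (\<lambda>t. \<Sum>r\<in>#grafts s t. var r)"

definition cutD :: "tree \<Rightarrow> tree spoly \<Rightarrow> tree spoly" where
  "cutD s = Der (\<lambda>t. \<Sum>q\<in>#cuts t. if fst q = s then var (snd q) else 0)"

definition pd :: "tree \<Rightarrow> tree spoly \<Rightarrow> tree spoly" where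
  "pd s = Der (\<lambda>t. if t = s then 1 else 0)"

definition degD :: "tree spoly \<Rightarrow> tree spoly" where
  "degD = Der (\<lambda>t. of_nat (tree_verts t) *\<^sub>C var t)"

definition Bplus :: "tree spoly \<Rightarrow> tree spoly" where
  "Bplus = lin_ext (\<lambda>M. var (Node M))"

lemma derivations: "derivation (graftD s)" "derivation (cutD s)" "derivation (pd s)"
  "derivation degD"
  unfolding graftD_def cutD_def pd_def degD_def by (rule derivation_Der)+

lemmas derivations_clinear = derivations[THEN derivation_clinear]

lemma clinear_Bplus: "clinear Bplus"
  unfolding Bplus_def by (rule clinear_lin_ext)

lemma Bplus_mon [simp]: "Bplus (mon M) = var (Node M)"
  by (simp add: Bplus_def scaleC_one)

text \<open>Grafting at the new root adds \<open>s\<close> to the forest, which is multiplication by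
  \<open>var s\<close>; grafting at any other vertex happens inside one tree of the forest.\<close>

lemma graftD_Bplus: "graftD s (Bplus q) = Bplus (var s * q + graftD s q)"
proof (rule clinear_eqI[of "\<lambda>q. graftD s (Bplus q)" "\<lambda>q. Bplus (var s * q + graftD s q)"])
  show "clinear (\<lambda>q. graftD s (Bplus q))" "clinear (\<lambda>q. Bplus (var s * q + graftD s q))"
    by (intro clinear_compose[OF derivations_clinear(1) clinear_Bplus]
        clinear_compose[OF clinear_Bplus clinear_compose_add[OF clinear_mult_left
          derivations_clinear(1)]])+
  fix M
  have "Bplus (graftD s (mon M)) = (\<Sum>c\<in>#M. \<Sum>r\<in>#grafts s c. var (Node (add_mset r (M - {#c#}))))"
    by (simp add: graftD_def Der_mon clinear_sum_mset[OF clinear_Bplus] sum_mset_distrib_left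
        mult_single)
  moreover have "graftD s (var (Node M)) = var (Node (add_mset s M)) +
      (\<Sum>c\<in>#M. \<Sum>r\<in>#grafts s c. var (Node (add_mset r (M - {#c#}))))"
  proof -
    have "(\<Sum>r\<in>#(\<Sum>c\<in>#M. image_mset (\<lambda>r. Node (add_mset r (N - {#c#}))) (grafts s c)). var r) =
      (\<Sum>c\<in>#M. \<Sum>r\<in>#grafts s c. var (Node (add_mset r (N - {#c#}))))" for N
      by (induction M) (simp_all add: multiset.map_comp comp_def)
    then show ?thesis by (simp add: graftD_def)
  qed
  ultimately show "graftD s (Bplus (mon M)) = Bplus (var s * mon M + graftD s (mon M))"
    by (simp add: clinear_add[OF clinear_Bplus] flip: mon_add_mset)
qed

text \<open>Cutting an edge at the new root removes a whole tree of the forest, which is what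
  \<open>pd s\<close> does; any other edge lies inside one tree.\<close>

lemma cutD_Bplus: "cutD s (Bplus q) = Bplus (pd s q + cutD s q)"
proof (rule clinear_eqI[of "\<lambda>q. cutD s (Bplus q)" "\<lambda>q. Bplus (pd s q + cutD s q)"])
  show "clinear (\<lambda>q. cutD s (Bplus q))" "clinear (\<lambda>q. Bplus (pd s q + cutD s q))"
    by (intro clinear_compose[OF derivations_clinear(2) clinear_Bplus]
        clinear_compose[OF clinear_Bplus clinear_compose_add[OF derivations_clinear(3,2)]])+
  fix M
  let ?f = "\<lambda>q. if fst q = s then var (snd q) else 0"
  have B: "Bplus (if b then p else 0) = (if b then Bplus p else 0)"
    "mon N * (if b then p else 0) = (if b then mon N * p else 0)" for b p N
    by (simp_all add: clinear_0[OF clinear_Bplus])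
  have "Bplus (cutD s (mon M)) = (\<Sum>c\<in>#M. \<Sum>q\<in>#cuts c. ?f
    (fst q, Node (add_mset (snd q) (M - {#c#}))))"
    by (simp add: cutD_def Der_mon clinear_sum_mset[OF clinear_Bplus] sum_mset_distrib_left
        mult_single B cong: if_cong)
  moreover have "Bplus (pd s (mon M)) = (\<Sum>c\<in>#M. ?f (c, Node (M - {#c#})))"
    by (simp add: pd_def Der_mon clinear_sum_mset[OF clinear_Bplus] B mult_single cong: if_cong)
  moreover have "cutD s (var (Node M)) = (\<Sum>c\<in>#M. ?f (c, Node (M - {#c#}))) +
      (\<Sum>c\<in>#M. \<Sum>q\<in>#cuts c. ?f (fst q, Node (add_mset (snd q) (M - {#c#}))))"
  proof -
    have "(\<Sum>q\<in>#(\<Sum>c\<in>#M. add_mset (c, Node (N - {#c#}))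
         (image_mset (\<lambda>q. (fst q, Node (add_mset (snd q) (N - {#c#})))) (cuts c))). ?f q) =
      (\<Sum>c\<in>#M. ?f (c, Node (N - {#c#}))) +
      (\<Sum>c\<in>#M. \<Sum>q\<in>#cuts c. ?f (fst q, Node (add_mset (snd q) (N - {#c#}))))" for N
      by (induction M) (simp_all add: multiset.map_comp comp_def add_ac cong: if_cong)
    then show ?thesis by (simp add: cutD_def)
  qed
  ultimately show "cutD s (Bplus (mon M)) = Bplus (pd s (mon M) + cutD s (mon M))"
    by (simp add: clinear_add[OF clinear_Bplus])
qed

lemma degD_mon: "degD (mon M) = of_nat (\<Sum>t\<in>#M. tree_verts t) *\<^sub>C mon M"
proof -
  have "mon (M - {#t#}) * (of_nat (tree_verts t) *\<^sub>C var t) = of_nat (tree_verts t) *\<^sub>C mon M"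
    if "t \<in># M" for t
    using that by (simp add: scaleC_mult_right mult_single)
  then have "degD (mon M) = (\<Sum>t\<in>#M. of_nat (tree_verts t) *\<^sub>C mon M)"
    unfolding degD_def Der_mon by (intro arg_cong[of _ _ sum_mset] image_mset_cong) simp
  also have "\<dots> = of_nat (\<Sum>t\<in>#M. tree_verts t) *\<^sub>C mon M"
  proof -
    have "(\<Sum>t\<in>#N. of_nat (tree_verts t) *\<^sub>C p) = of_nat (\<Sum>t\<in>#N. tree_verts t) *\<^sub>C p" for N
      and p :: "tree spoly"
      by (induction N) (simp_all add: scaleC_add_left)
    then show ?thesis .
  qed
  finally show ?thesis .
qed

lemma degD_Bplus: "degD (Bplus q) = Bplus (q + degD q)"
proof (rule clinear_eqI[of "\<lambda>q. degD (Bplus q)" "\<lambda>q. Bplus (q + degD q)"])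
  show "clinear (\<lambda>q. degD (Bplus q))" "clinear (\<lambda>q. Bplus (q + degD q))"
    by (intro clinear_compose[OF derivations_clinear(4) clinear_Bplus]
        clinear_compose[OF clinear_Bplus clinear_compose_add[OF clinear_id
          derivations_clinear(4)]])+
  fix M
  show "degD (Bplus (mon M)) = Bplus (mon M + degD (mon M))"
    by (simp add: degD_mon clinear_add[OF clinear_Bplus] clinear_scale[OF clinear_Bplus]
        scaleC_add_left scaleC_one)
qed

text \<open>Induction over trees: two derivations that agree on the trees of a forest agree on the
  forest, and the last assumption carries this over to the tree obtained by adding a root.\<close>

lemma tree_derivation_eqI:
  assumes "derivation X" "derivation Y"
    and "\<And>M. X (mon M) = Y (mon M) \<Longrightarrow> X (Bplus (mon M)) = Y (Bplus (mon M))"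
  shows "X p = Y p"
proof -
  have "X (var t) = Y (var t)" for t
  proof (induction t)
    case (Node M)
    then have "X (mon M) = Y (mon M)" using derivation_eq_mon[OF assms(1,2)] by blast
    then show ?case using assms(3)[of M] by simp
  qed
  then show ?thesis by (rule derivation_eqI[OF assms(1,2)])
qed

section \<open>Commutation relations of the derivations\<close>

lemma graftD_var: "graftD s (var t) = (\<Sum>r\<in>trees_of_size (tree_verts s + tree_verts t).
    of_nat (count (grafts s t) r) *\<^sub>C var r)"
  unfolding graftD_def Der_var
  by (intro sum_mset_eq_sum_count finite_trees_of_size) (auto simp: trees_of_size_def
    tree_verts_grafts)

text \<open>The new root contributes multiplications by \<open>var s\<close> and
  \<open>var t\<close>. They commute with each other; their commutators with the derivations
  multiply by the grafts of \<open>s\<close> onto \<open>t\<close> minus those of \<open>t\<close>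
  onto \<open>s\<close>, which gives the coefficients claimed.\<close>

lemma graftD_graftD: "graftD s (graftD t p) - graftD t (graftD s p) =
  (\<Sum>r\<in>trees_of_size (tree_verts s + tree_verts t).
    (of_nat (count (grafts s t) r) - of_nat (count (grafts t s) r)) *\<^sub>C graftD r p)"
    (is "?X p = ?Y p")
proof (rule tree_derivation_eqI[of ?X ?Y])
  let ?S = "trees_of_size (tree_verts s + tree_verts t)"
  let ?c = "\<lambda>r. of_nat (count (grafts s t) r) - of_nat (count (grafts t s) r) :: complex"
  show "derivation ?X" "derivation ?Y"
    by (intro derivation_commutator derivation_sum derivations)+
  fix M :: "tree multiset"
  let ?m = "mon M :: tree spoly"
  assume IH: "?X ?m = ?Y ?m"
  have "?X (Bplus ?m) = Bplus ((graftD s (var t) - graftD t (var s)) * ?m + ?X ?m)"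
    by (simp add: graftD_Bplus derivations(1)[THEN derivation_mult]
      clinear_add[OF derivations_clinear(1)]
        clinear_diff[OF clinear_Bplus, symmetric] algebra_simps del: Bplus_mon)
  also have "graftD s (var t) - graftD t (var s) = (\<Sum>r\<in>?S. ?c r *\<^sub>C var r)"
    by (simp add: graftD_var add.commute[of "tree_verts t"] sum_subtractf
      complex_vector.scale_left_diff_distrib)
  also have "(\<Sum>r\<in>?S. ?c r *\<^sub>C var r) * ?m + ?X ?m = (\<Sum>r\<in>?S. ?c r *\<^sub>C (var r * ?m + graftD r ?m))"
    unfolding IH by (simp add: scaleC_add_right sum.distrib sum_distrib_right scaleC_mult_left)
  also have "Bplus \<dots> = ?Y (Bplus ?m)"
    by (simp add: clinear_sum[OF clinear_Bplus] clinear_scale[OF clinear_Bplus] graftD_Bplus del: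
      Bplus_mon)
  finally show "?X (Bplus ?m) = ?Y (Bplus ?m)" .
qed

lemma pd_var: "pd s (var t) = (if t = s then 1 else 0)"
  by (simp add: pd_def)

lemma derivation_pd_var: "derivation X \<Longrightarrow> X (pd s (var t)) = 0"
  by (simp add: pd_var derivation_one derivation_clinear clinear_0)

lemma pd_pd: "pd s (pd t p) = pd t (pd s p)"
proof -
  have "pd s (pd t p) - pd t (pd s p) = (\<lambda>p. 0) p"
    by (rule derivation_eqI[of "\<lambda>p. pd s (pd t p) - pd t (pd s p)"])
      (simp_all add: derivation_commutator derivations derivation_pd_var, simp add: derivation_def
        clinear_zero)
  then show ?thesis by simp
qed

lemma pd_sum_mset_var: "pd s (\<Sum>r\<in>#A. var r) = of_nat (count A s) *\<^sub>C 1"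
  by (induction A) (auto simp: clinear_0[OF derivations_clinear(3)]
    clinear_add[OF derivations_clinear(3)]
      pd_var scaleC_add_left scaleC_one)

text \<open>Both sides are derivations, so variables suffice. There \<open>cutD t\<close> followed
  by \<open>pd s\<close> counts the edges that split a tree into branch \<open>t\<close> and rest
  \<open>s\<close>, while the opposite order gives 0 as derivations kill constants.\<close>

lemma pd_cutD: "pd s (cutD t p) - cutD t (pd s p) =
  (\<Sum>r\<in>trees_of_size (tree_verts s + tree_verts t). of_nat (count (cuts r) (t, s)) *\<^sub>C pd r p)"
    (is "?X p = ?Y p")
proof (rule derivation_eqI[of ?X ?Y])
  show "derivation ?X" "derivation ?Y"
    by (intro derivation_commutator derivation_sum derivations)+
  fix u
  have count: "pd s (\<Sum>q\<in>#A. if fst q = t then var (snd q) else 0) = of_nat (count A (t, s)) *\<^sub>C 1"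
    for A
    by (induction A) (auto simp: clinear_0[OF derivations_clinear(3)]
      clinear_add[OF derivations_clinear(3)]
      pd_var scaleC_add_left scaleC_one)
  have not_size: "u \<notin> trees_of_size n \<Longrightarrow> n \<noteq> tree_verts u" for n by (simp add: trees_of_size_def)
  have "?X (var u) = of_nat (count (cuts u) (t, s)) *\<^sub>C 1"
    by (simp add: derivation_pd_var derivations) (simp add: cutD_def count)
  also have "\<dots> = ?Y (var u)"
    by (cases "u \<in> trees_of_size (tree_verts s + tree_verts t)")
      (simp_all add: pd_var if_distrib sum.delta' count_cuts_eq_0 not_size add.commute cong:
        if_cong)
  finally show "?X (var u) = ?Y (var u)" .
qed

text \<open>As for \<open>pd_cutD\<close>, both sides are compared on variables. The index set is
  empty unless \<open>s\<close> has more vertices than \<open>t\<close>, since every tree has a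
  vertex.\<close>

lemma pd_graftD: "pd s (graftD t p) - graftD t (pd s p) =
  (\<Sum>r\<in>{r. tree_verts r + tree_verts t = tree_verts s}. of_nat (count (grafts t r) s) *\<^sub>C pd r p)"
    (is "?X p = ?Y p")
proof (rule derivation_eqI[of ?X ?Y])
  show "derivation ?X" "derivation ?Y"
    by (intro derivation_commutator derivation_sum derivations)+
  fix u
  have fin: "finite {r. tree_verts r + tree_verts t = tree_verts s}"
    by (rule finite_subset[OF _ finite_trees_upto[of "tree_verts s"]]) auto
  have "?X (var u) = of_nat (count (grafts t u) s) *\<^sub>C 1"
    by (simp add: derivation_pd_var derivations) (simp add: graftD_def pd_sum_mset_var)
  also have "\<dots> = ?Y (var u)"
    using fin by (cases "tree_verts u + tree_verts t = tree_verts s")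
      (auto simp: pd_var if_distrib sum.delta count_grafts_eq_0 add.commute cong: if_cong)
  finally show "?X (var u) = ?Y (var u)" .
qed

lemma finite_trees_add_eq [simp]:
  "finite {r. tree_verts r + m = n}" "finite {r. m + tree_verts r = n}"
  by (rule finite_subset[OF _ finite_trees_upto[of n]], auto)+

lemma cutD_cutD: "cutD s (cutD t p) - cutD t (cutD s p) =
  (\<Sum>r\<in>trees_of_size (tree_verts s + tree_verts t).
    (of_nat (count (cuts r) (t, s)) - of_nat (count (cuts r) (s, t))) *\<^sub>C cutD r p)"
    (is "?X p = ?Y p")
proof (rule tree_derivation_eqI[of ?X ?Y])
  let ?S = "trees_of_size (tree_verts s + tree_verts t)"
  let ?c = "\<lambda>r. of_nat (count (cuts r) (t, s)) - of_nat (count (cuts r) (s, t)) :: complex"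
  show "derivation ?X" "derivation ?Y"
    by (intro derivation_commutator derivation_sum derivations)+
  fix M :: "tree multiset"
  let ?m = "mon M :: tree spoly"
  assume IH: "?X ?m = ?Y ?m"
  have "?X (Bplus ?m) = Bplus ((pd s (cutD t ?m) - cutD t (pd s ?m)) - (pd t (cutD s ?m) - cutD s
    (pd t ?m)) + ?X ?m)"
    by (simp add: cutD_Bplus clinear_add[OF derivations_clinear(2)]
      clinear_add[OF derivations_clinear(3)]
        clinear_diff[OF clinear_Bplus, symmetric] pd_pd[of s t] algebra_simps del: Bplus_mon)
  also have "(pd s (cutD t ?m) - cutD t (pd s ?m)) - (pd t (cutD s ?m) - cutD s (pd t ?m)) =
      (\<Sum>r\<in>?S. ?c r *\<^sub>C pd r ?m)"
    unfolding pd_cutD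
    by (simp add: add.commute[of "tree_verts t"] sum_subtractf
      complex_vector.scale_left_diff_distrib)
  also have "(\<Sum>r\<in>?S. ?c r *\<^sub>C pd r ?m) + ?X ?m = (\<Sum>r\<in>?S. ?c r *\<^sub>C (pd r ?m + cutD r ?m))"
    unfolding IH by (simp add: scaleC_add_right sum.distrib)
  also have "Bplus \<dots> = ?Y (Bplus ?m)"
    by (simp add: clinear_sum[OF clinear_Bplus] clinear_scale[OF clinear_Bplus] cutD_Bplus del:
      Bplus_mon)
  finally show "?X (Bplus ?m) = ?Y (Bplus ?m)" .
qed

lemma cutD_var: "cutD s (var t) = (\<Sum>r\<in>{r. tree_verts s + tree_verts r = tree_verts t}.
    of_nat (count (cuts t) (s, r)) *\<^sub>C var r)"
proof -
  have "(\<Sum>q\<in>#A. if fst q = s then var (snd q) else 0) =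
      (\<Sum>r\<in>S. of_nat (count A (s, r)) *\<^sub>C var r)"
    if "finite S" "\<And>r. (s, r) \<in># A \<Longrightarrow> r \<in> S" for S and A :: "(tree \<times> tree) multiset"
    using that(2)
  proof (induction A)
    case (add q A)
    have "(\<Sum>r\<in>S. of_nat (count (add_mset q A) (s, r)) *\<^sub>C var r) =
      (\<Sum>r\<in>S. of_nat (count A (s, r)) *\<^sub>C var r +
        (if r = snd q then (if fst q = s then var r else 0) else 0))"
      by (intro sum.cong) (auto simp: scaleC_add_left scaleC_one)
    moreover have "fst q = s \<Longrightarrow> snd q \<in> S" using add.prems[of "snd q"] by auto
    ultimately show ?case using add that(1) by (simp add: sum.distrib add.commute)
  qed simp
  note * = this
  show ?thesis
    unfolding cutD_def Der_var
    by (rule *) (auto dest: tree_verts_cuts)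
qed

text \<open>The new root contributes \<open>pd s\<close> on one side and multiplication by
  \<open>var t\<close> on the other. Their commutator is 1 for \<open>s = t\<close>, the extra term
  of \<open>degD_Bplus\<close>. The commutators of \<open>cutD s\<close> with \<open>var t\<close>
  and of \<open>pd s\<close> with \<open>graftD t\<close> supply the root terms of the two
  sums.\<close>

lemma cutD_graftD: "cutD s (graftD t p) - graftD t (cutD s p) =
  (if s = t then 1 else 0) *\<^sub>C degD p
  + (\<Sum>r\<in>{r. tree_verts s + tree_verts r = tree_verts t}. of_nat (count (cuts t) (s, r)) *\<^sub>C graftD
    r p)
  + (\<Sum>r\<in>{r. tree_verts r + tree_verts t = tree_verts s}. of_nat (count (grafts t r) s) *\<^sub>C cutD r
    p)"
    (is "?X p = ?Y p")
proof (rule tree_derivation_eqI[of ?X ?Y])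
  show "derivation ?X" "derivation ?Y"
    by (intro derivation_commutator derivation_add derivation_scale derivation_sum derivations)+
  fix M :: "tree multiset"
  let ?m = "mon M :: tree spoly"
  assume IH: "?X ?m = ?Y ?m"
  have "?X (Bplus ?m) = Bplus (pd s (var t) * ?m + cutD s (var t) * ?m +
      (pd s (graftD t ?m) - graftD t (pd s ?m)) + ?X ?m)"
    by (simp add: graftD_Bplus cutD_Bplus derivations(1,2,3)[THEN derivation_mult]
        clinear_add[OF derivations_clinear(1)] clinear_add[OF derivations_clinear(2)]
          clinear_add[OF derivations_clinear(3)]
        clinear_diff[OF clinear_Bplus, symmetric] algebra_simps del: Bplus_mon)
  also have "pd s (var t) * ?m = (if s = t then 1 else 0) *\<^sub>C ?m"
    by (simp add: pd_var scaleC_one)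
  also have "(if s = t then 1 else 0) *\<^sub>C ?m + cutD s (var t) * ?m +
      (pd s (graftD t ?m) - graftD t (pd s ?m)) + ?X ?m =
        (if s = t then 1 else 0) *\<^sub>C (?m + degD ?m)
  + (\<Sum>r\<in>{r. tree_verts s + tree_verts r = tree_verts t}.
      of_nat (count (cuts t) (s, r)) *\<^sub>C (var r * ?m + graftD r ?m))
  + (\<Sum>r\<in>{r. tree_verts r + tree_verts t = tree_verts s}.
      of_nat (count (grafts t r) s) *\<^sub>C (pd r ?m + cutD r ?m))"
    unfolding IH pd_graftD cutD_var
    by (simp add: scaleC_add_right sum.distrib sum_distrib_right scaleC_mult_left)
  also have "Bplus \<dots> = ?Y (Bplus ?m)"
    by (simp add: clinear_sum[OF clinear_Bplus] clinear_scale[OF clinear_Bplus]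
      clinear_add[OF clinear_Bplus, of "_ + _"]
        graftD_Bplus cutD_Bplus degD_Bplus clinear_scale[OF clinear_Bplus] del: Bplus_mon)
  finally show "?X (Bplus ?m) = ?Y (Bplus ?m)" .
qed

lemma degD_var: "degD (var t) = of_nat (tree_verts t) *\<^sub>C var t"
  by (simp add: degD_def)

lemma degD_graftD: "degD (graftD s p) - graftD s (degD p) = of_nat (tree_verts s) *\<^sub>C graftD s p"
  (is "?X p = ?Y p")
proof (rule derivation_eqI[of ?X ?Y])
  show "derivation ?X" "derivation ?Y"
    by (intro derivation_commutator derivation_scale derivations)+
  fix u
  let ?S = "trees_of_size (tree_verts s + tree_verts u)"
  have "degD (graftD s (var u)) = (\<Sum>r\<in>?S. of_nat (tree_verts s + tree_verts u) *\<^sub>C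
      of_nat (count (grafts s u) r) *\<^sub>C var r)"
    unfolding graftD_var clinear_sum[OF derivations_clinear(4)]
      clinear_scale[OF derivations_clinear(4)] degD_var
    by (intro sum.cong) (auto simp: trees_of_size_def complex_vector.scale_left_commute)
  also have "\<dots> = of_nat (tree_verts s + tree_verts u) *\<^sub>C graftD s (var u)"
    unfolding graftD_var by (rule complex_vector.scale_sum_right[symmetric])
  finally show "?X (var u) = ?Y (var u)"
    by (simp add: degD_var clinear_scale[OF derivations_clinear(1)] scaleC_add_left)
qed

lemma degD_cutD: "degD (cutD s p) - cutD s (degD p) = - of_nat (tree_verts s) *\<^sub>C cutD s p"
  (is "?X p = ?Y p")
proof (rule derivation_eqI[of ?X ?Y])
  show "derivation ?X" "derivation ?Y"
    by (intro derivation_commutator derivation_scale derivations)+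
  fix u
  let ?S = "{r. tree_verts s + tree_verts r = tree_verts u}"
  have "degD (cutD s (var u)) = (\<Sum>r\<in>?S. (of_nat (tree_verts u) - of_nat (tree_verts s)) *\<^sub>C
      of_nat (count (cuts u) (s, r)) *\<^sub>C var r)"
    unfolding cutD_var clinear_sum[OF derivations_clinear(4)]
      clinear_scale[OF derivations_clinear(4)] degD_var
    by (intro sum.cong) (auto simp: complex_vector.scale_left_commute eq_diff_eq add.commute simp
      flip: of_nat_add)
  also have "\<dots> = (of_nat (tree_verts u) - of_nat (tree_verts s)) *\<^sub>C cutD s (var u)"
    unfolding cutD_var by (rule complex_vector.scale_sum_right[symmetric])
  finally show "?X (var u) = ?Y (var u)"
    by (simp add: degD_var clinear_scale[OF derivations_clinear(2)]
      complex_vector.scale_left_diff_distrib)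
qed

lemma degD_pd: "degD (pd s p) - pd s (degD p) = - of_nat (tree_verts s) *\<^sub>C pd s p"
  (is "?X p = ?Y p")
proof (rule derivation_eqI[of ?X ?Y])
  show "derivation ?X" "derivation ?Y"
    by (intro derivation_commutator derivation_scale derivations)+
  fix u
  show "?X (var u) = ?Y (var u)"
    by (simp add: derivation_pd_var derivations degD_var clinear_scale[OF derivations_clinear(3)])
      (simp add: pd_var)
qed

text \<open>For \<open>l = 1\<close>, these are the operators on trees transported along \<^const>\<open>Bplus\<close>.\<close>

definition hatP :: "complex \<Rightarrow> tree \<Rightarrow> tree spoly \<Rightarrow> tree spoly" where
  "hatP l s p = l *\<^sub>C (var s * p) + graftD s p"

definition hatM :: "tree \<Rightarrow> tree spoly \<Rightarrow> tree spoly" where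
  "hatM s p = pd s p + cutD s p"

definition hatD :: "complex \<Rightarrow> tree spoly \<Rightarrow> tree spoly" where
  "hatD l p = l *\<^sub>C p + degD p"

lemma clinear_hat: "clinear (hatP l s)" "clinear (hatM s)" "clinear (hatD l)"
  unfolding hatP_def[abs_def] hatM_def[abs_def] hatD_def[abs_def]
  by (intro clinear_compose_add clinear_compose_scale clinear_mult_left clinear_id
    derivations_clinear)+

lemmas derivations_simps = derivations[THEN derivation_mult] derivations_clinear[THEN clinear_add]
  derivations_clinear[THEN clinear_scale]

text \<open>Multiplications commute, so no term quadratic in \<open>l\<close> arises. The terms
  linear in \<open>l\<close> come from the grafts on the variables themselves, the others from
  \<open>graftD_graftD\<close>.\<close>

lemma hatP_hatP: "hatP l s (hatP l t p) - hatP l t (hatP l s p) =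
  (\<Sum>r\<in>trees_of_size (tree_verts s + tree_verts t).
    (of_nat (count (grafts s t) r) - of_nat (count (grafts t s) r)) *\<^sub>C hatP l r p)"
proof -
  let ?S = "trees_of_size (tree_verts s + tree_verts t)"
  let ?c = "\<lambda>r. of_nat (count (grafts s t) r) - of_nat (count (grafts t s) r) :: complex"
  have "hatP l s (hatP l t p) - hatP l t (hatP l s p) =
    l *\<^sub>C ((graftD s (var t) - graftD t (var s)) * p) +
      (graftD s (graftD t p) - graftD t (graftD s p))"
    by (simp add: hatP_def derivations_simps scaleC_mult_left scaleC_mult_right scaleC_add_right
        complex_vector.scale_right_diff_distrib algebra_simps)
  also have "graftD s (var t) - graftD t (var s) = (\<Sum>r\<in>?S. ?c r *\<^sub>C var r)"
    by (simp add: graftD_var add.commute[of "tree_verts t"] sum_subtractf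
      complex_vector.scale_left_diff_distrib)
  finally show ?thesis
    unfolding graftD_graftD hatP_def
    by (simp add: sum_distrib_right scaleC_mult_left scaleC_add_right sum.distrib
        complex_vector.scale_sum_right complex_vector.scale_left_commute mult.commute[of l])
qed

lemma hatM_hatM: "hatM s (hatM t p) - hatM t (hatM s p) =
  (\<Sum>r\<in>trees_of_size (tree_verts s + tree_verts t).
    (of_nat (count (cuts r) (t, s)) - of_nat (count (cuts r) (s, t))) *\<^sub>C hatM r p)"
proof -
  have "hatM s (hatM t p) - hatM t (hatM s p) =
    (pd s (cutD t p) - cutD t (pd s p)) - (pd t (cutD s p) - cutD s (pd t p)) +
      (cutD s (cutD t p) - cutD t (cutD s p))"
    by (simp add: hatM_def derivations_simps pd_pd[of s t])
  then show ?thesis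
    unfolding pd_cutD cutD_cutD hatM_def
    by (simp add: add.commute[of "tree_verts t"] sum_subtractf scaleC_add_right sum.distrib
        complex_vector.scale_left_diff_distrib)
qed

text \<open>The parameter enters through \<open>pd s\<close> and \<open>cutD s\<close> applied to
  \<open>l *\<^sub>C var t\<close>: the first yields the summand \<open>l\<close> of
  \<open>hatD l\<close>, the second the multiplications in \<open>hatP l r\<close>. This forces the
  scalar part of \<open>hatD\<close> to be the factor of \<open>var s\<close> in
  \<open>hatP\<close>.\<close>

lemma hatM_hatP: "hatM s (hatP l t p) - hatP l t (hatM s p) =
  (if s = t then 1 else 0) *\<^sub>C hatD l p
  + (\<Sum>r\<in>{r. tree_verts s + tree_verts r = tree_verts t}. of_nat (count (cuts t) (s, r)) *\<^sub>C hatP l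
    r p)
  + (\<Sum>r\<in>{r. tree_verts r + tree_verts t = tree_verts s}. of_nat (count (grafts t r) s) *\<^sub>C hatM r
    p)"
proof -
  have "hatM s (hatP l t p) - hatP l t (hatM s p) =
    l *\<^sub>C (pd s (var t) * p) + l *\<^sub>C (cutD s (var t) * p) +
      (pd s (graftD t p) - graftD t (pd s p)) +
    (cutD s (graftD t p) - graftD t (cutD s p))"
    by (simp add: hatP_def hatM_def derivations_simps scaleC_mult_left scaleC_mult_right
      scaleC_add_right
        complex_vector.scale_right_diff_distrib algebra_simps)
  then show ?thesis
    unfolding pd_graftD cutD_graftD hatM_def hatP_def hatD_def cutD_var
    by (simp add: sum_distrib_right scaleC_mult_left scaleC_add_right sum.distrib pd_var scaleC_one
        complex_vector.scale_sum_right complex_vector.scale_left_commute[of l] mult.commute[of l])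
qed

lemma hatD_hatP: "hatD l (hatP l s p) - hatP l s (hatD l p) = of_nat (tree_verts s) *\<^sub>C hatP l s p"
proof -
  have "hatD l (hatP l s p) - hatP l s (hatD l p) =
    l *\<^sub>C (degD (var s) * p) + (degD (graftD s p) - graftD s (degD p))"
    by (simp add: hatP_def hatD_def derivations_simps scaleC_mult_left scaleC_mult_right
      scaleC_add_right
        complex_vector.scale_right_diff_distrib algebra_simps)
  then show ?thesis
    unfolding degD_graftD hatP_def degD_var
    by (simp add: scaleC_mult_left scaleC_add_right complex_vector.scale_left_commute)
qed

lemma hatD_hatM: "hatD l (hatM s p) - hatM s (hatD l p) = - of_nat (tree_verts s) *\<^sub>C hatM s p"
proof -
  have "hatD l (hatM s p) - hatM s (hatD l p) =
    (degD (pd s p) - pd s (degD p)) + (degD (cutD s p) - cutD s (degD p))"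
    by (simp add: hatM_def hatD_def derivations_simps scaleC_add_right)
  then show ?thesis
    unfolding degD_pd degD_cutD hatM_def by (simp only: scaleC_add_right)
qed

section \<open>Functionals on polynomials\<close>

definition const_coeff :: "'a spoly \<Rightarrow> complex" where
  "const_coeff p = Poly_Mapping.lookup p {#}"

lemma clinear_const_coeff: "clinear const_coeff"
  by (rule clinearI) (simp_all add: const_coeff_def lookup_add scaleC_poly_mapping.rep_eq)

lemma const_coeff_mon: "const_coeff (mon M) = (if M = {#} then 1 else 0)"
  by (simp add: const_coeff_def lookup_single when_def)

lemma const_coeff_1: "const_coeff 1 = 1"
  using const_coeff_mon[of "{#}"] by simp

lemma graftD_mon: "graftD s (mon M) = (\<Sum>c\<in>#M. \<Sum>r\<in>#grafts s c. mon (add_mset r (M - {#c#})))"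
  by (simp add: graftD_def Der_mon sum_mset_distrib_left mult_single)

lemma hatP_mon: "hatP l s (mon M) = l *\<^sub>C mon (add_mset s M) +
    (\<Sum>c\<in>#M. \<Sum>r\<in>#grafts s c. mon (add_mset r (M - {#c#})))"
  by (simp add: hatP_def graftD_mon flip: mon_add_mset)

text \<open>Every monomial produced contains at least one tree: an insertion either adds a tree or
  replaces one. Dually, all D+ kill the constant coefficient.\<close>

lemma const_coeff_hatP: "const_coeff (hatP l s p) = 0"
proof (rule clinear_eqI[of "\<lambda>p. const_coeff (hatP l s p)" "\<lambda>p. 0"])
  show "clinear (\<lambda>p. const_coeff (hatP l s p))" "clinear (\<lambda>p :: tree spoly. 0 :: complex)"
    by (rule clinear_compose[OF clinear_const_coeff clinear_hat(1)] clinear_zero)+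
  fix M :: "tree multiset"
  show "const_coeff (hatP l s (mon M)) = 0"
    by (simp add: hatP_mon clinear_add[OF clinear_const_coeff] clinear_scale[OF clinear_const_coeff]
        clinear_sum_mset[OF clinear_const_coeff] const_coeff_mon)
qed

lemma hatD_mon: "hatD l (mon M) = (l + of_nat (\<Sum>t\<in>#M. tree_verts t)) *\<^sub>C mon M"
  by (simp add: hatD_def degD_mon scaleC_add_left)

lemma const_coeff_hatD: "const_coeff (hatD l p) = l * const_coeff p"
proof (rule clinear_eqI[of "\<lambda>p. const_coeff (hatD l p)" "\<lambda>p. l * const_coeff p"])
  show "clinear (\<lambda>p. const_coeff (hatD l p))" "clinear (\<lambda>p :: tree spoly. l * const_coeff p)"
    by (rule clinear_compose[OF clinear_const_coeff clinear_hat(3)]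
        clinear_compose_scale[OF clinear_const_coeff, unfolded scaleC_complex_def])+
  fix M :: "tree multiset"
  show "const_coeff (hatD l (mon M)) = l * const_coeff (mon M)"
    by (simp add: hatD_mon clinear_scale[OF clinear_const_coeff] const_coeff_mon scaleC_complex_def)
qed

section \<open>A functional supported on products of ladders\<close>

primrec ladder :: "tree \<Rightarrow> bool" where
  "ladder (Node M) \<longleftrightarrow> size M \<le> 1 \<and> (\<forall>b\<in>#image_mset ladder M. b)"

lemma ladder_Node [simp]: "ladder (Node M) \<longleftrightarrow> size M \<le> 1 \<and> (\<forall>t\<in>#M. ladder t)"
  by simp

declare ladder.simps [simp del]

lemma ex_ladder: "n > 0 \<Longrightarrow> \<exists>t. ladder t \<and> tree_verts t = n"
proof (induction n rule: nat_induct_non_zero)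
  case 1
  show ?case by (intro exI[of _ "Node {#}"]) simp
next
  case (Suc n)
  then obtain t where "ladder t" "tree_verts t = n" by blast
  then show ?case by (intro exI[of _ "Node {#t#}"]) simp
qed

text \<open>Only grafting a ladder onto the end of a ladder avoids a branching, and a ladder has one
  end.\<close>

lemma size_ladders_grafts: "size (filter_mset ladder (grafts s t)) =
  (if ladder s \<and> ladder t then 1 else 0)"
proof (induction t)
  case (Node M)
  consider "M = {#}" | c where "M = {#c#}" | "size M \<ge> 2"
    by (metis One_nat_def Suc_1 le_less_linear less_2_cases size_1_singleton_mset
      size_eq_0_iff_empty)
  then show ?case
  proof cases
    case 1
    then show ?thesis by simp
  next
    case 2
    have "filter_mset ladder (image_mset (\<lambda>r. Node {#r#}) A) =
      image_mset (\<lambda>r. Node {#r#}) (filter_mset ladder A)" for A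
      by (simp add: filter_mset_image_mset)
    then show ?thesis using 2 Node[of c] by simp
  next
    case 3
    \<comment> \<open>Grafting never lowers the number of children of the root, which is already at
      least two.\<close>
    have "\<not> ladder r" if "r \<in># grafts s (Node M)" for r
    proof -
      from that consider "r = Node (add_mset s M)" |
        c r' where "c \<in># M" "r = Node (add_mset r' (M - {#c#}))" by auto
      then show ?thesis
      proof cases
        case 2
        then have "size (add_mset r' (M - {#c#})) = size M" by (simp add: size_Suc_Diff1)
        then show ?thesis using 2 3 by simp
      qed (use 3 in auto)
    qed
    then have "filter_mset ladder (grafts s (Node M)) = {#}"
      by (intro multiset_eqI) (auto simp: count_eq_zero_iff simp del: grafts_Node)
    then show ?thesis using 3 by (simp del: grafts_Node)
  qed
qed

text \<open>Inserting a ladder into a product of \<open>m\<close> ladders gives \<open>m\<close> products of \<open>m\<close> ladders, up to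
  terms outside the support of \<open>ladder_form\<close>, besides \<open>l\<close> times a product of \<open>m + 1\<close> ladders. The
  recursion makes these contributions cancel.\<close>

primrec ladder_coeff :: "complex \<Rightarrow> nat \<Rightarrow> complex" where
  "ladder_coeff l 0 = 0"
| "ladder_coeff l (Suc m) = (if m = 0 then - 1 / l else - of_nat m / l * ladder_coeff l m)"

text \<open>For m > 0 the coefficient of a product of m ladders is (-1)^m (m-1)! / l^m. Fixing the
  total size \<open>n\<close> makes this a weight vector of the dual module.\<close>

definition ladder_form :: "complex \<Rightarrow> nat \<Rightarrow> tree spoly \<Rightarrow> complex" where
  "ladder_form l n = lin_ext (\<lambda>M. if (\<forall>t\<in>#M. ladder t) \<and> (\<Sum>t\<in>#M. tree_verts t) = n
     then ladder_coeff l (size M) else 0)"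

lemma clinear_ladder_form: "clinear (ladder_form l n)"
  unfolding ladder_form_def by (rule clinear_lin_ext)

lemma ladder_form_mon: "ladder_form l n (mon M) =
  (if (\<forall>t\<in>#M. ladder t) \<and> (\<Sum>t\<in>#M. tree_verts t) = n then ladder_coeff l (size M) else 0)"
  by (simp add: ladder_form_def scaleC_one)

text \<open>Let c_m be the coefficients. If \<open>s\<close> and the m factors are ladders of total
  size \<open>n\<close>, the value is l c_(m+1) + m c_m, since each factor admits one insertion that
  stays a ladder. This vanishes for m > 0 and equals -1 for m = 0; in all other cases every term is
  0.\<close>

lemma ladder_form_hatP:
  assumes "l \<noteq> 0"
  shows "ladder_form l n (hatP l s p) = (if ladder s \<and> tree_verts s = n then - 1 else 0) *
    const_coeff p"
    (is "_ = ?c * _")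
proof (rule clinear_eqI[of "\<lambda>p. ladder_form l n (hatP l s p)" "\<lambda>p. ?c * const_coeff p"])
  show "clinear (\<lambda>p. ladder_form l n (hatP l s p))" "clinear (\<lambda>p :: tree spoly. ?c * const_coeff p)"
    by (rule clinear_compose[OF clinear_ladder_form clinear_hat(1)]
        clinear_compose_scale[OF clinear_const_coeff, unfolded scaleC_complex_def])+
  fix M :: "tree multiset"
  define P where "P \<longleftrightarrow> ladder s \<and> (\<forall>t\<in>#M. ladder t) \<and> tree_verts s + (\<Sum>t\<in>#M. tree_verts t) = n"
  have inner: "(\<Sum>r\<in>#grafts s c. ladder_form l n (mon (add_mset r (M - {#c#})))) =
      (if P then ladder_coeff l (size M) else 0)" if c: "c \<in># M" for c
  proof -
    \<comment> \<open>\<open>Q\<close> omits the condition that \<open>c\<close> is a ladder;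
      \<open>size_ladders_grafts\<close> contributes it together with that on
      \<open>s\<close>.\<close>
    define Q where "Q \<longleftrightarrow> (\<forall>t\<in>#M - {#c#}. ladder t) \<and> tree_verts s + (\<Sum>t\<in>#M. tree_verts t) = n"
    have "ladder_form l n (mon (add_mset r (M - {#c#}))) =
      (if ladder r \<and> Q then ladder_coeff l (size M) else 0)"
      if "r \<in># grafts s c" for r
      using tree_verts_grafts[OF that] sum_tree_verts_remove[OF c] size_Suc_Diff1[OF c]
      unfolding ladder_form_mon Q_def by auto
    then have "(\<Sum>r\<in>#grafts s c. ladder_form l n (mon (add_mset r (M - {#c#})))) =
        (\<Sum>r\<in>#grafts s c. if ladder r \<and> Q then ladder_coeff l (size M) else 0)"
      by (intro arg_cong[of _ _ sum_mset] image_mset_cong) simp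
    also have "\<dots> = of_nat (size (filter_mset ladder (grafts s c))) * (if Q then ladder_coeff l
      (size M) else 0)"
    proof -
      have "(\<Sum>r\<in>#A. if ladder r \<and> Q then x else 0) = of_nat (size (filter_mset ladder A)) *
        (if Q then x else 0)"
        for A and x :: complex
        by (induction A) (auto simp: algebra_simps)
      then show ?thesis .
    qed
    also have "\<dots> = (if P then ladder_coeff l (size M) else 0)"
    proof -
      have "(\<forall>t\<in>#M. ladder t) \<longleftrightarrow> ladder c \<and> (\<forall>t\<in>#M - {#c#}. ladder t)"
        using c by (metis insert_DiffM insert_noteq_member in_diffD)
      then show ?thesis unfolding size_ladders_grafts P_def Q_def by auto
    qed
    finally show ?thesis .
  qed
  have "ladder_form l n (hatP l s (mon M)) = l * (if P then ladder_coeff l (Suc (size M)) else 0) +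
      (\<Sum>c\<in>#M. \<Sum>r\<in>#grafts s c. ladder_form l n (mon (add_mset r (M - {#c#}))))"
    by (simp add: hatP_mon clinear_add[OF clinear_ladder_form] clinear_scale[OF clinear_ladder_form]
        clinear_sum_mset[OF clinear_ladder_form] scaleC_complex_def ladder_form_mon P_def)
  also have "(\<Sum>c\<in>#M. \<Sum>r\<in>#grafts s c. ladder_form l n (mon (add_mset r (M - {#c#})))) =
      (\<Sum>c\<in>#M. if P then ladder_coeff l (size M) else 0)"
    by (intro arg_cong[of _ _ sum_mset] image_mset_cong inner)
  also have "\<dots> = of_nat (size M) * (if P then ladder_coeff l (size M) else 0)"
    by (rule sum_mset_constant)
  finally show "ladder_form l n (hatP l s (mon M)) = ?c * const_coeff (mon M)"
    using assms by (cases "M = {#}") (auto simp: const_coeff_mon const_coeff_1 P_def)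
qed

lemma ladder_form_hatD: "ladder_form l n (hatD l p) = (l + of_nat n) * ladder_form l n p"
proof (rule clinear_eqI[of "\<lambda>p. ladder_form l n (hatD l p)"
  "\<lambda>p. (l + of_nat n) * ladder_form l n p"])
  show "clinear (\<lambda>p. ladder_form l n (hatD l p))" "clinear (\<lambda>p. (l + of_nat n) * ladder_form l n p)"
    by (rule clinear_compose[OF clinear_ladder_form clinear_hat(3)]
        clinear_compose_scale[OF clinear_ladder_form, unfolded scaleC_complex_def])+
  fix M :: "tree multiset"
  show "ladder_form l n (hatD l (mon M)) = (l + of_nat n) * ladder_form l n (mon M)"
    by (simp add: hatD_mon clinear_scale[OF clinear_ladder_form] ladder_form_mon scaleC_complex_def
        flip: of_nat_sum_mset)
qed

section \<open>Enveloping algebras\<close>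

definition free_ext :: "('a \<Rightarrow> 'b::complex_algebra_1) \<Rightarrow> 'a free_algebra \<Rightarrow> 'b" where
  "free_ext f = lin_ext (\<lambda>w. prod_list (map f (letters w)))"

lemma clinear_free_ext: "clinear (free_ext f)"
  unfolding free_ext_def by (rule clinear_lin_ext)

lemma scalar_mult_eq: "scalar a * p = a *\<^sub>C p"
proof (induction p rule: poly_mapping_single_induct)
  case (single k b)
  show ?case by (simp add: scalar_def mult_single scaleC_single scaleC_complex_def)
qed (simp_all add: distrib_left scaleC_add_right)

lemma free_ext_mult: "free_ext f (p * q) = free_ext f p * free_ext f q"
proof -
  note intros = clinear_compose[OF clinear_free_ext clinear_mult_left]
    clinear_compose[OF clinear_free_ext clinear_mult_right]
    clinear_compose[OF clinear_mult_left clinear_free_ext]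
      clinear_compose[OF clinear_mult_right clinear_free_ext]
  have "free_ext f (Poly_Mapping.single k 1 * q) = free_ext f (Poly_Mapping.single k 1) * free_ext
    f q" for k q
    by (rule clinear_eqI[of "\<lambda>q. free_ext f (Poly_Mapping.single k 1 * q)"
          "\<lambda>q. free_ext f (Poly_Mapping.single k 1) * free_ext f q"])
      (rule intros | simp add: mult_single free_ext_def scaleC_one plus_free_monoid_def)+
  then show ?thesis
    by (rule clinear_eqI[of "\<lambda>p. free_ext f (p * q)"
      "\<lambda>p. free_ext f p * free_ext f q", OF intros(2,4)])
qed

lemma free_ext_letter: "free_ext f (letter x) = f x"
  by (simp add: free_ext_def letter_def scaleC_one)

lemma free_algebra_one: "(1 :: 'a free_algebra) = Poly_Mapping.single (Word []) 1"
  by (simp flip: zero_free_monoid_def)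

lemma free_ext_one: "free_ext f 1 = 1"
  unfolding free_ext_def free_algebra_one lin_ext_single by (simp add: scaleC_one)

lemma uea_cases: obtains p where "u = abs_uea p"
  by (metis Quotient3_abs_rep[OF Quotient3_uea])

lemma rep_abs_uea: "rep_uea (abs_uea p) - p \<in> uea_ideal"
  using Quotient3_rep_abs[OF Quotient3_uea, of p] by (simp add: uea_ideal.zero)

lemma uea_of_add: "uea_of (x + y) = uea_of x + uea_of y"
  unfolding uea_of_def plus_uea.abs_eq uea.abs_eq_iff by (rule uea_ideal.add_rel)

lemma uea_of_scale: "uea_of (a *\<^sub>C x) = a *\<^sub>C uea_of x"
  unfolding uea_of_def scaleC_uea.abs_eq uea.abs_eq_iff by (rule uea_ideal.scale_rel)

lemma clinear_uea_of: "clinear uea_of"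
  by (rule clinearI) (rule uea_of_add uea_of_scale)+

lemma uea_of_bracket: "uea_of [x, y]\<^sub>L = uea_of x * uea_of y - uea_of y * uea_of x"
  unfolding uea_of_def times_uea.abs_eq minus_uea.abs_eq uea.abs_eq_iff
    by (rule uea_ideal.bracket_rel)

lemma clinear_abs_uea: "clinear abs_uea"
  by (rule clinearI) (simp_all add: plus_uea.abs_eq scaleC_uea.abs_eq scalar_mult_eq)

lemma abs_uea_word: "abs_uea (Poly_Mapping.single (Word xs) c) = c *\<^sub>C prod_list (map uea_of xs)"
proof -
  have "abs_uea (Poly_Mapping.single (Word xs) 1) = prod_list (map uea_of xs)"
  proof (induction xs)
    case Nil
    show ?case by (simp add: one_uea_def free_algebra_one)
  next
    case (Cons x xs)
    have "Poly_Mapping.single (Word (x # xs)) 1 =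
      letter x * (Poly_Mapping.single (Word xs) 1 :: 'a free_algebra)"
      by (simp add: letter_def mult_single plus_free_monoid_def)
    then show ?case using Cons by (simp add: times_uea.abs_eq[symmetric] uea_of_def)
  qed
  moreover have "Poly_Mapping.single (Word xs) c = c *\<^sub>C Poly_Mapping.single (Word xs)
    (1 :: complex)"
    by (simp add: scaleC_single scaleC_complex_def)
  ultimately show ?thesis using clinear_scale[OF clinear_abs_uea] by metis
qed

lemma uea_induct [case_names zero word add]:
  assumes "P 0" "\<And>c xs. P (c *\<^sub>C prod_list (map uea_of xs))" "\<And>u v. P u \<Longrightarrow> P v \<Longrightarrow> P (u + v)"
  shows "P u"
proof -
  obtain p where p: "u = abs_uea p" using uea_cases by blast
  have "P (abs_uea p)"
  proof (induction p rule: poly_mapping_single_induct)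
    case zero
    then show ?case using assms(1) by (simp add: zero_uea_def)
  next
    case (single k b)
    show ?case using assms(2) by (cases k) (simp add: abs_uea_word)
  next
    case (add p q)
    then show ?case using assms(3) by (simp flip: plus_uea.abs_eq)
  qed
  then show ?thesis using p by simp
qed

definition lie_hom :: "('a::lie_bracket \<Rightarrow> 'b::complex_algebra_1) \<Rightarrow> bool" where
  "lie_hom f \<longleftrightarrow> clinear f \<and> (\<forall>x y. f [x, y]\<^sub>L = f x * f y - f y * f x)"

text \<open>\<open>uea_extend\<close> is computed on an arbitrary representative; a Lie homomorphism
  kills the generators of the ideal, so the choice does not matter.\<close>

lemma uea_extend_abs:
  assumes "lie_hom f"
  shows "uea_extend f (abs_uea p) = free_ext f p"
proof -
  note lin = clinear_free_ext[of f]
  have f: "clinear f" "f [x, y]\<^sub>L = f x * f y - f y * f x" for x y using assms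
    by (auto simp: lie_hom_def)
  have "free_ext f r = 0" if "r \<in> uea_ideal" for r
    using that
  proof induction
    case (add_rel x y)
    then show ?case by (simp add: clinear_diff[OF lin] clinear_add[OF lin] free_ext_letter
      clinear_add[OF f(1)])
  next
    case (scale_rel a x)
    then show ?case
      by (simp add: clinear_diff[OF lin] clinear_scale[OF lin] scalar_mult_eq free_ext_letter
        clinear_scale[OF f(1)])
  next
    case (bracket_rel x y)
    then show ?case by (simp add: clinear_diff[OF lin] free_ext_letter free_ext_mult f(2))
  qed (simp_all add: clinear_0[OF lin] clinear_add[OF lin] free_ext_mult)
  from this[OF rep_abs_uea[of p]] have "free_ext f (rep_uea (abs_uea p)) = free_ext f p"
    by (simp add: clinear_diff[OF lin])
  then show ?thesis by (simp add: uea_extend_def free_ext_def lin_ext_def)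
qed

lemma uea_extend_hom:
  assumes "lie_hom f"
  shows "clinear (uea_extend f)" "uea_extend f (u * v) = uea_extend f u * uea_extend f v"
    "uea_extend f 1 = 1" "uea_extend f (uea_of x) = f x"
proof -
  note ext = uea_extend_abs[OF assms] and lin = clinear_free_ext[of f]
  show "clinear (uea_extend f)"
  proof (rule clinearI)
    fix u v :: "'a uea"
    obtain p q where "u = abs_uea p" "v = abs_uea q" using uea_cases by metis
    then show "uea_extend f (u + v) = uea_extend f u + uea_extend f v"
      by (simp add: plus_uea.abs_eq ext clinear_add[OF lin])
  next
    fix a and u :: "'a uea"
    obtain p where "u = abs_uea p" using uea_cases by metis
    then show "uea_extend f (a *\<^sub>C u) = a *\<^sub>C uea_extend f u"
      by (simp add: scaleC_uea.abs_eq ext scalar_mult_eq clinear_scale[OF lin])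
  qed
  obtain p q where "u = abs_uea p" "v = abs_uea q" using uea_cases by metis
  then show "uea_extend f (u * v) = uea_extend f u * uea_extend f v"
    by (simp add: times_uea.abs_eq ext free_ext_mult)
  show "uea_extend f 1 = 1" "uea_extend f (uea_of x) = f x"
    unfolding one_uea_def uea_of_def ext by (rule free_ext_one free_ext_letter)+
qed

text \<open>A left \<open>\<gg>\<close>-module becomes a right one through \<open>m x = - x m\<close>; it is then a right
  \<open>U(\<gg>)\<close>-module.\<close>

locale lie_module =
  fixes op :: "'a::lie_bracket \<Rightarrow> 'm::complex_vector_space \<Rightarrow> 'm"
  assumes clinear_op1: "clinear (\<lambda>x. op x m)"
    and clinear_op2: "clinear (op x)"
    and op_bracket: "op [x, y]\<^sub>L m = op x (op y m) - op y (op x m)"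
begin

text \<open>\<open>fold\<close> applies the first letter of a word first, as a right action has to
  do.\<close>

definition free_act :: "'a free_algebra \<Rightarrow> 'm \<Rightarrow> 'm" where
  "free_act p m = lin_ext (\<lambda>w. fold (\<lambda>x m. - op x m) (letters w) m) p"

lemma clinear_free_act1: "clinear (\<lambda>p. free_act p m)"
  unfolding free_act_def by (rule clinear_lin_ext)

lemma clinear_fold: "clinear (fold (\<lambda>x m. - op x m) xs)"
proof (induction xs)
  case Nil
  then show ?case by (simp add: clinear_id id_def)
next
  case (Cons x xs)
  then show ?case
    using clinear_compose[OF Cons clinear_compose_neg[OF clinear_op2[of x]]] by (simp add: comp_def)
qed

lemma clinear_free_act2: "clinear (free_act p)"
  unfolding free_act_def[abs_def] lin_ext_def
  by (intro clinear_compose_sum clinear_compose_scale clinear_fold)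

lemma free_act_mult: "free_act (p * q) m = free_act q (free_act p m)"
proof -
  have 1: "free_act (Poly_Mapping.single k 1 * q) m =
    free_act q (free_act (Poly_Mapping.single k 1) m)" for k q
    by (rule clinear_eqI[of "\<lambda>q. free_act (Poly_Mapping.single k 1 * q) m"
          "\<lambda>q. free_act q (free_act (Poly_Mapping.single k 1) m)"])
      (rule clinear_compose[OF clinear_free_act1 clinear_mult_left] clinear_free_act1
       | simp add: mult_single free_act_def scaleC_one plus_free_monoid_def)+
  show ?thesis
    by (rule clinear_eqI[of "\<lambda>p. free_act (p * q) m" "\<lambda>p. free_act q (free_act p m)"])
      (rule clinear_compose[OF clinear_free_act1 clinear_mult_right]
        clinear_compose[OF clinear_free_act2 clinear_free_act1] 1)+
qed

lemma free_act_letter: "free_act (letter x) m = - op x m"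
  by (simp add: free_act_def letter_def scaleC_one)

lemma free_act_ideal: "p \<in> uea_ideal \<Longrightarrow> free_act p m = 0"
proof (induction arbitrary: m rule: uea_ideal.induct)
  case (add_rel x y)
  then show ?case
    by (simp add: clinear_diff[OF clinear_free_act1] clinear_add[OF clinear_free_act1]
      free_act_letter
        clinear_add[OF clinear_op1])
next
  case (scale_rel a x)
  then show ?case
    by (simp add: clinear_diff[OF clinear_free_act1] clinear_scale[OF clinear_free_act1]
      scalar_mult_eq
        free_act_letter clinear_scale[OF clinear_op1])
next
  \<comment> \<open>On the right, x y acts by first x, then y. The signs cancel in products of two
    letters but not in the single letter of the bracket, which compensates for the reversed
    order.\<close>
  case (bracket_rel x y)
  then show ?case
    by (simp add: clinear_diff[OF clinear_free_act1] free_act_letter free_act_mult op_bracket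
        clinear_neg[OF clinear_op2])
qed (simp_all add: clinear_0[OF clinear_free_act1] clinear_add[OF clinear_free_act1] free_act_mult
    clinear_0[OF clinear_free_act2])

definition act :: "'m \<Rightarrow> 'a uea \<Rightarrow> 'm" where
  "act m u = free_act (rep_uea u) m"

lemma act_abs: "act m (abs_uea p) = free_act p m"
  using free_act_ideal[OF rep_abs_uea[of p], of m]
  by (simp add: act_def clinear_diff[OF clinear_free_act1])

lemma clinear_act: "clinear (act m)"
proof (rule clinearI)
  fix u v :: "'a uea"
  obtain p q where "u = abs_uea p" "v = abs_uea q" using uea_cases by metis
  then show "act m (u + v) = act m u + act m v"
    by (simp add: plus_uea.abs_eq act_abs clinear_add[OF clinear_free_act1])
next
  fix a and u :: "'a uea"
  obtain p where "u = abs_uea p" using uea_cases by metis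
  then show "act m (a *\<^sub>C u) = a *\<^sub>C act m u"
    by (simp add: scaleC_uea.abs_eq act_abs scalar_mult_eq clinear_scale[OF clinear_free_act1])
qed

lemma act_mult: "act m (u * v) = act (act m u) v"
proof -
  obtain p q where "u = abs_uea p" "v = abs_uea q" using uea_cases by metis
  then show ?thesis by (simp add: times_uea.abs_eq act_abs free_act_mult)
qed

lemma act_uea_of: "act m (uea_of x) = - op x m"
  by (simp add: uea_of_def act_abs free_act_letter)

lemma act_one: "act m 1 = m"
  unfolding one_uea_def act_abs free_act_def free_algebra_one lin_ext_single
    by (simp add: scaleC_one)

end

section \<open>The insertion-elimination algebra acts on polynomials\<close>

definition basis_op :: "complex \<Rightarrow> ie_basis \<Rightarrow> tree spoly \<Rightarrow> tree spoly" where
  "basis_op l b = (case b of D \<Rightarrow> hatD l | Dplus s \<Rightarrow> hatP l (tree_of s) | Dminus s \<Rightarrow> hatM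
    (tree_of s))"

lemma basis_op_simps [simp]:
  "basis_op l D = hatD l" "basis_op l (Dplus s) = hatP l (tree_of s)"
  "basis_op l (Dminus s) = hatM (tree_of s)"
  by (simp_all add: basis_op_def)

lemma clinear_basis_op: "clinear (basis_op l b)"
  by (cases b) (simp_all add: clinear_hat)

lemma clinear_coords: "clinear coords"
  by (rule clinearI; rule poly_mapping_eqI)
    (simp_all add: plus_ie_alg.rep_eq scaleC_ie_alg.rep_eq lookup_map_times
      scaleC_poly_mapping.rep_eq
      scaleC_complex_def)

lemma clinear_of_coords: "clinear of_coords"
proof (rule clinearI)
  fix x y
  show "of_coords (x + y) = of_coords x + of_coords y"
    by (simp add: coords_inject[symmetric] plus_ie_alg.rep_eq of_coords_inverse)
next
  fix a x
  show "of_coords (a *\<^sub>C x) = a *\<^sub>C of_coords x"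
    using clinear_scale[OF clinear_coords, of a "of_coords x"]
    by (simp add: coords_inject[symmetric] of_coords_inverse)
qed

lemma coords_ie_gen: "coords (ie_gen b) = Poly_Mapping.single b 1"
  by (simp add: ie_gen_def of_coords_inverse)

lemma ie_alg_eqI:
  assumes "clinear f" "clinear g" "\<And>b. f (ie_gen b) = g (ie_gen b)"
  shows "f x = (g x :: 'b::complex_vector_space)"
proof -
  have "f (of_coords p) = g (of_coords p)" for p
    by (rule clinear_eqI[of "\<lambda>p. f (of_coords p)" "\<lambda>p. g (of_coords p)"])
      (rule clinear_compose[OF assms(1) clinear_of_coords]
        clinear_compose[OF assms(2) clinear_of_coords]
        assms(3)[unfolded ie_gen_def])+
  from this[of "coords x"] show ?thesis by (simp add: coords_inverse)
qed

lemma lie_bracket_eq: "[x, y]\<^sub>L = lin_ext (\<lambda>a. lin_ext (ie_basis_bracket a) (coords y)) (coords x)"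
  by (simp add: lie_bracket_ie_alg_def lin_ext_def complex_vector.scale_sum_right scaleC_scaleC)

lemma clinear_bracket: "clinear (\<lambda>x. [x, y :: ie_alg]\<^sub>L)" "clinear (\<lambda>y. [x :: ie_alg, y]\<^sub>L)"
  unfolding lie_bracket_eq
proof -
  show "clinear (\<lambda>x. lin_ext (\<lambda>a. lin_ext (ie_basis_bracket a) (coords y)) (coords x))"
    by (rule clinear_compose[OF clinear_lin_ext clinear_coords])
  show "clinear (\<lambda>y. lin_ext (\<lambda>a. lin_ext (ie_basis_bracket a) (coords y)) (coords x))"
    unfolding lin_ext_def[of "\<lambda>a. lin_ext (ie_basis_bracket a) (coords _)"]
    by (intro clinear_compose_sum clinear_compose_scale
      clinear_compose[OF clinear_lin_ext clinear_coords])
qed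

lemma bracket_ie_gen: "[ie_gen a, ie_gen b]\<^sub>L = ie_basis_bracket a b"
  by (simp add: lie_bracket_eq coords_ie_gen scaleC_one)

definition ie_op :: "complex \<Rightarrow> ie_alg \<Rightarrow> tree spoly \<Rightarrow> tree spoly" where
  "ie_op l x p = lin_ext (\<lambda>b. basis_op l b p) (coords x)"

lemma ie_op_gen [simp]: "ie_op l (ie_gen b) p = basis_op l b p"
  by (simp add: ie_op_def coords_ie_gen scaleC_one)

lemma clinear_ie_op1: "clinear (\<lambda>x. ie_op l x p)"
  unfolding ie_op_def by (rule clinear_compose[OF clinear_lin_ext clinear_coords])

lemma clinear_ie_op2: "clinear (ie_op l x)"
  unfolding ie_op_def[abs_def] lin_ext_def
  by (intro clinear_compose_sum clinear_compose_scale clinear_basis_op)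

lemma Sum_any_rtree:
  fixes c :: "tree \<Rightarrow> complex" and f :: "rtree \<Rightarrow> 'b::complex_vector_space"
  assumes "finite S" "\<And>t. t \<notin> S \<Longrightarrow> c t = 0"
  shows "Sum_any (\<lambda>r. c (tree_of r) *\<^sub>C f r) = (\<Sum>t\<in>S. c t *\<^sub>C f (inv tree_of t))"
proof -
  have inv: "tree_of (inv tree_of t) = t" "inv tree_of (tree_of r) = r" for t r
    using bij_tree_of by (simp_all add: bij_is_surj surj_f_inv_f bij_is_inj)
  have "Sum_any (\<lambda>r. c (tree_of r) *\<^sub>C f r) = (\<Sum>r\<in>inv tree_of ` S. c (tree_of r) *\<^sub>C f r)"
  proof (rule Sum_any.expand_superset)
    show "{r. c (tree_of r) *\<^sub>C f r \<noteq> 0} \<subseteq> inv tree_of ` S"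
    proof
      fix r assume "r \<in> {r. c (tree_of r) *\<^sub>C f r \<noteq> 0}"
      then have "tree_of r \<in> S" using assms(2)[of "tree_of r"] by auto
      then show "r \<in> inv tree_of ` S" using inv(2)[of r] by force
    qed
  qed (use assms(1) in simp)
  also have "\<dots> = (\<Sum>t\<in>S. c t *\<^sub>C f (inv tree_of t))"
    by (subst sum.reindex) (auto simp: inv intro: inj_on_inverseI[of _ tree_of])
  finally show ?thesis .
qed

lemma tree_of_inv [simp]: "tree_of (inv tree_of t) = t"
  using bij_tree_of by (simp add: bij_is_surj surj_f_inv_f)

lemma ie_op_Sum_any:
  assumes "finite S" "\<And>t. t \<notin> S \<Longrightarrow> c t = 0"
  shows "ie_op l (Sum_any (\<lambda>r. c (tree_of r) *\<^sub>C ie_gen (Dplus r))) p = (\<Sum>t\<in>S. c t *\<^sub>C hatP l t p)"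
    and "ie_op l (Sum_any (\<lambda>r. c (tree_of r) *\<^sub>C ie_gen (Dminus r))) p = (\<Sum>t\<in>S. c t *\<^sub>C hatM t p)"
proof -
  have "Sum_any (\<lambda>r. c (tree_of r) *\<^sub>C f r) = (\<Sum>t\<in>S. c t *\<^sub>C f (inv tree_of t))"
    for f :: "rtree \<Rightarrow> ie_alg"
    by (rule Sum_any_rtree) (use assms in auto)
  then show "ie_op l (Sum_any (\<lambda>r. c (tree_of r) *\<^sub>C ie_gen (Dplus r))) p =
    (\<Sum>t\<in>S. c t *\<^sub>C hatP l t p)"
    "ie_op l (Sum_any (\<lambda>r. c (tree_of r) *\<^sub>C ie_gen (Dminus r))) p = (\<Sum>t\<in>S. c t *\<^sub>C hatM t p)"
    by (simp_all add: clinear_sum[OF clinear_ie_op1] clinear_scale[OF clinear_ie_op1])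
qed

lemma tree_of_eq_iff [simp]: "tree_of s = tree_of t \<longleftrightarrow> s = t"
  using bij_tree_of by (simp add: bij_is_inj inj_eq)

lemma ie_op_basis_bracket_Dminus_Dplus:
  "ie_op l (ie_basis_bracket (Dminus s) (Dplus t)) p =
    hatM (tree_of s) (hatP l (tree_of t) p) - hatP l (tree_of t) (hatM (tree_of s) p)"
proof (cases "s = t")
  case True
  \<comment> \<open>No tree has size 0, so for \<open>s = t\<close> both sums in
    \<open>hatM_hatP\<close> are empty and only \<open>hatD l\<close> is left, in accordance with
    the separate bracket for equal trees.\<close>
  have E: "{r. tree_verts (tree_of t) + tree_verts r = tree_verts (tree_of t)} = {}"
    "{r. tree_verts r + tree_verts (tree_of t) = tree_verts (tree_of t)} = {}"
    using tree_verts_pos by (auto dest: less_imp_neq)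
  show ?thesis unfolding True hatM_hatP E by (simp add: scaleC_one)
next
  case False
  have 1: "ie_op l (Sum_any (\<lambda>r. of_nat (alpha s t r) *\<^sub>C ie_gen (Dplus r))) p =
    (\<Sum>r\<in>{r. tree_verts (tree_of s) + tree_verts r = tree_verts (tree_of t)}.
      of_nat (count (cuts (tree_of t)) (tree_of s, r)) *\<^sub>C hatP l r p)"
    unfolding alpha_eq by (rule ie_op_Sum_any) (auto intro: count_cuts_eq_0)
  have 2: "ie_op l (Sum_any (\<lambda>r. of_nat (beta s t r) *\<^sub>C ie_gen (Dminus r))) p =
    (\<Sum>r\<in>{r. tree_verts r + tree_verts (tree_of t) = tree_verts (tree_of s)}.
      of_nat (count (grafts (tree_of t) r) (tree_of s)) *\<^sub>C hatM r p)"
    unfolding beta_eq by (rule ie_op_Sum_any(2)) (auto intro: count_grafts_eq_0)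
  show ?thesis
    unfolding hatM_hatP using False by (simp add: clinear_add[OF clinear_ie_op1] 1 2)
qed

lemma ie_op_basis_bracket:
  "ie_op l (ie_basis_bracket a b) p = basis_op l a (basis_op l b p) - basis_op l b (basis_op l a p)"
proof -
  note [simp] = clinear_scale[OF clinear_ie_op1] clinear_neg[OF clinear_ie_op1]
    clinear_0[OF clinear_ie_op1]
    tree_size_eq
  show ?thesis
  proof (cases a)
    case a: D
    show ?thesis
      by (cases b) (simp_all add: a hatD_hatP hatD_hatM)
  next
    case a: (Dplus s)
    show ?thesis
    proof (cases b)
      case D
      then show ?thesis using hatD_hatP[of l "tree_of s" p] by (simp add: a algebra_simps)
    next
      case (Dplus t)
      show ?thesis
        unfolding a Dplus ie_basis_bracket.simps beta_eq basis_op_simps hatP_hatP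
        by (rule ie_op_Sum_any(1)[OF finite_trees_of_size])
          (auto simp: trees_of_size_def count_grafts_eq_0 add.commute)
    next
      case (Dminus t)
      then show ?thesis
        using ie_op_basis_bracket_Dminus_Dplus[of l t s p] by (simp add: a eq_commute[of s t])
    qed
  next
    case a: (Dminus s)
    show ?thesis
    proof (cases b)
      case D
      then show ?thesis using hatD_hatM[of l "tree_of s" p] by (simp add: a algebra_simps)
    next
      case (Dplus t)
      show ?thesis
        unfolding a Dplus basis_op_simps by (rule ie_op_basis_bracket_Dminus_Dplus)
    next
      case (Dminus t)
      show ?thesis
        unfolding a Dminus ie_basis_bracket.simps alpha_eq basis_op_simps hatM_hatM
        by (rule ie_op_Sum_any(2)[OF finite_trees_of_size])
          (auto simp: trees_of_size_def count_cuts_eq_0 add.commute)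
    qed
  qed
qed

lemma lie_module_ie_op: "lie_module (ie_op l)"
proof
  show "clinear (\<lambda>x. ie_op l x m)" "clinear (ie_op l x)" for x m
    by (rule clinear_ie_op1 clinear_ie_op2)+
  fix x y m
  have "ie_op l [ie_gen a, y]\<^sub>L m = ie_op l (ie_gen a) (ie_op l y m) - ie_op l y
    (ie_op l (ie_gen a) m)" for a
    by (rule ie_alg_eqI[of "\<lambda>y. ie_op l [ie_gen a, y]\<^sub>L m"
          "\<lambda>y. ie_op l (ie_gen a) (ie_op l y m) - ie_op l y (ie_op l (ie_gen a) m)"])
      (rule clinear_compose[OF clinear_ie_op1 clinear_bracket(2)]
        clinear_compose_diff[OF clinear_compose[OF clinear_ie_op2 clinear_ie_op1] clinear_ie_op1]
       | simp add: bracket_ie_gen ie_op_basis_bracket)+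
  then show "ie_op l [x, y]\<^sub>L m = ie_op l x (ie_op l y m) - ie_op l y (ie_op l x m)"
    by (rule ie_alg_eqI[of "\<lambda>x. ie_op l [x, y]\<^sub>L m"
          "\<lambda>x. ie_op l x (ie_op l y m) - ie_op l y (ie_op l x m)",
          OF clinear_compose[OF clinear_ie_op1 clinear_bracket(1)]
        clinear_compose_diff[OF clinear_ie_op1 clinear_compose[OF clinear_ie_op2 clinear_ie_op1]]])
qed

section \<open>The center\<close>

abbreviation ugen :: "ie_basis \<Rightarrow> ie_alg uea" where
  "ugen b \<equiv> uea_of (ie_gen b)"

abbreviation "cspan \<equiv> complex_vector.span"

lemma cspan_induct_linear:
  assumes "u \<in> cspan A" "clinear f" "\<And>a. a \<in> A \<Longrightarrow> f a \<in> cspan B"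
  shows "f u \<in> cspan B"
  using assms(1)
proof (induction rule: complex_vector.span_induct_alt)
  case base
  show ?case by (simp add: clinear_0[OF assms(2)] complex_vector.span_zero)
next
  case (step c a u)
  then show ?case
    using assms(3) by (simp add: clinear_add[OF assms(2)] clinear_scale[OF assms(2)]
        complex_vector.span_add complex_vector.span_scale)
qed

lemma uea_of_span: "uea_of x \<in> cspan (range ugen)"
proof -
  have "x = lin_ext ie_gen (coords x)"
    by (rule ie_alg_eqI[of "\<lambda>x. x" "\<lambda>x. lin_ext ie_gen (coords x)"])
      (simp_all add: clinear_id clinear_compose[OF clinear_lin_ext clinear_coords] coords_ie_gen
        scaleC_one)
  then have "uea_of x = (\<Sum>b\<in>Poly_Mapping.keys (coords x). Poly_Mapping.lookup (coords x) b *\<^sub>C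
    ugen b)"
    by (metis (no_types, lifting) lin_ext_def clinear_sum[OF clinear_uea_of]
      clinear_scale[OF clinear_uea_of] sum.cong)
  moreover have "\<dots> \<in> cspan (range ugen)"
    by (intro complex_vector.span_sum complex_vector.span_scale complex_vector.span_base) simp
  ultimately show ?thesis by simp
qed

section \<open>A spanning set of the enveloping algebra\<close>

definition neg_word :: "rtree list \<Rightarrow> ie_alg uea" where
  "neg_word ts = prod_list (map (\<lambda>t. ugen (Dminus t)) ts)"

text \<open>The span of these products is the left ideal generated by n+.\<close>

definition left_null :: "ie_alg uea set" where
  "left_null = {u * ugen (Dplus s) | u s. True}"

text \<open>A filtration by how far the weights of the words may lie below 0, with the left ideal in
  every level. The D- occur in arbitrary order: only the weight of a word is read off.\<close>

definition pbw_upto :: "nat \<Rightarrow> ie_alg uea set" where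
  "pbw_upto K = cspan ({neg_word ts * ugen D ^ k | ts k. sum_list (map tree_size ts) \<le> K} \<union>
    left_null)"

definition pbw_span :: "ie_alg uea set" where
  "pbw_span = cspan ({neg_word ts * ugen D ^ k | ts k. True} \<union> left_null)"

lemma commute_ugen: "ugen a * ugen b = ugen b * ugen a + uea_of (ie_basis_bracket a b)"
  by (simp add: uea_of_bracket flip: bracket_ie_gen)

lemma Dplus_D: "ugen (Dplus s) * ugen D = (ugen D - of_nat (tree_size s) *\<^sub>C 1) * ugen (Dplus s)"
  using commute_ugen[of "Dplus s" D]
  by (simp add: clinear_scale[OF clinear_uea_of] clinear_neg[OF clinear_uea_of] scaleC_mult_left
    algebra_simps)

lemma D_Dminus: "ugen D * ugen (Dminus t) = ugen (Dminus t) * ugen D - of_nat (tree_size t) *\<^sub>C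
  ugen (Dminus t)"
  using commute_ugen[of D "Dminus t"]
  by (simp add: clinear_scale[OF clinear_uea_of] clinear_neg[OF clinear_uea_of])

lemma Dplus_D_power:
  "ugen (Dplus s) * ugen D ^ k = (ugen D - of_nat (tree_size s) *\<^sub>C 1) ^ k * ugen (Dplus s)"
proof (induction k)
  case (Suc k)
  have "ugen (Dplus s) * ugen D ^ Suc k = (ugen D - of_nat (tree_size s) *\<^sub>C 1) *
    (ugen (Dplus s) * ugen D ^ k)"
    by (simp add: Dplus_D flip: mult.assoc)
  then show ?case using Suc by (simp add: mult.assoc)
qed simp

lemma left_null_mult: "u \<in> left_null \<Longrightarrow> v * u \<in> left_null"
  unfolding left_null_def by (smt (verit) mem_Collect_eq mult.assoc)

lemma neg_word_Cons: "ugen (Dminus t) * (neg_word ts * p) = neg_word (t # ts) * p"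
  by (simp add: neg_word_def mult.assoc)

lemma Dminus_pbw_span: "u \<in> pbw_span \<Longrightarrow> ugen (Dminus t) * u \<in> pbw_span"
  unfolding pbw_span_def
proof (erule cspan_induct_linear[OF _ clinear_mult_left])
  fix a assume "a \<in> {neg_word ts * ugen D ^ k |ts k. True} \<union> left_null"
  then show "ugen (Dminus t) * a \<in> cspan ({neg_word ts * ugen D ^ k |ts k. True} \<union> left_null)"
    using left_null_mult neg_word_Cons by (intro complex_vector.span_base) blast
qed

text \<open>Moving \<open>b\<close> past the first letter leaves a bracket, which is a combination
  of generators acting on a shorter word. The induction hypothesis must hence cover all generators
  at once.\<close>

lemma ugen_neg_word_pbw_span: "ugen b * (neg_word ts * ugen D ^ k) \<in> pbw_span"
proof (induction ts arbitrary: b)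
  case Nil
  show ?case
  proof (cases b)
    case D
    have "ugen b * (neg_word [] * ugen D ^ k) = neg_word [] * ugen D ^ Suc k"
      by (simp add: D neg_word_def)
    then show ?thesis unfolding pbw_span_def by (intro complex_vector.span_base) blast
  next
    case (Dplus s)
    \<comment> \<open>Passing D+ to the right of a power of d only shifts d by a scalar, so the
      product stays in the left ideal.\<close>
    have "ugen b * (neg_word [] * ugen D ^ k) \<in> left_null"
      unfolding Dplus left_null_def by (auto simp: neg_word_def Dplus_D_power)
    then show ?thesis unfolding pbw_span_def by (intro complex_vector.span_base) blast
  next
    case (Dminus s)
    have "neg_word (s # []) * ugen D ^ k \<in> pbw_span"
      unfolding pbw_span_def by (intro complex_vector.span_base) blast
    then show ?thesis unfolding Dminus by (simp add: neg_word_Cons)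
  qed
next
  case (Cons t ts)
  let ?w = "neg_word ts * ugen D ^ k"
  have "x * ?w \<in> pbw_span" if "x \<in> cspan (range ugen)" for x
    using cspan_induct_linear[OF that clinear_mult_right] Cons.IH unfolding pbw_span_def by blast
  then have "uea_of (ie_basis_bracket b (Dminus t)) * ?w \<in> pbw_span" using uea_of_span by blast
  moreover have "ugen (Dminus t) * (ugen b * ?w) \<in> pbw_span"
    using Cons.IH Dminus_pbw_span by blast
  moreover have "ugen b * (neg_word (t # ts) * ugen D ^ k) =
    ugen (Dminus t) * (ugen b * ?w) + uea_of (ie_basis_bracket b (Dminus t)) * ?w"
    using commute_ugen[of b "Dminus t"] by (simp add: distrib_right flip: neg_word_Cons mult.assoc)
  ultimately show ?case unfolding pbw_span_def by (simp add: complex_vector.span_add)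
qed

lemma pbw_span_UNIV: "u \<in> pbw_span"
proof -
  have gen: "ugen b * u \<in> pbw_span" if "u \<in> pbw_span" for b u
    using that unfolding pbw_span_def
  proof (rule cspan_induct_linear[OF _ clinear_mult_left])
    fix a assume "a \<in> {neg_word ts * ugen D ^ k |ts k. True} \<union> left_null"
    then show "ugen b * a \<in> cspan ({neg_word ts * ugen D ^ k |ts k. True} \<union> left_null)"
      using ugen_neg_word_pbw_span[of b, unfolded pbw_span_def] left_null_mult[of a "ugen b"]
        complex_vector.span_base[of "ugen b * a"] by blast
  qed
  have "x * u \<in> pbw_span" if "x \<in> cspan (range ugen)" "u \<in> pbw_span" for x u
    using cspan_induct_linear[OF that(1) clinear_mult_right] gen[OF that(2)]
      unfolding pbw_span_def by blast
  then have mult: "uea_of x * u \<in> pbw_span" if "u \<in> pbw_span" for x u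
    using that uea_of_span by blast
  have one: "1 \<in> pbw_span"
    unfolding pbw_span_def
    by (intro complex_vector.span_base UnI1 CollectI exI[of _ "[]"] exI[of _ 0])
      (simp add: neg_word_def)
  show ?thesis
  proof (induction u rule: uea_induct)
    case zero
    show ?case unfolding pbw_span_def by (rule complex_vector.span_zero)
  next
    case (word c xs)
    have "prod_list (map uea_of xs) \<in> pbw_span" by (induction xs) (simp_all add: one mult)
    then show ?case unfolding pbw_span_def by (rule complex_vector.span_scale)
  next
    case (add u v)
    then show ?case unfolding pbw_span_def by (rule complex_vector.span_add)
  qed
qed

lemma pbw_upto_mono: "K \<le> L \<Longrightarrow> pbw_upto K \<subseteq> pbw_upto L"
  unfolding pbw_upto_def by (intro complex_vector.span_mono) force

lemma ex_pbw_upto: "\<exists>K. u \<in> pbw_upto K"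
  using pbw_span_UNIV[of u] unfolding pbw_span_def
proof (induction rule: complex_vector.span_induct_alt)
  case base
  show ?case unfolding pbw_upto_def using complex_vector.span_zero by blast
next
  case (step c a u)
  then obtain K where K: "u \<in> pbw_upto K" by blast
  obtain L where L: "a \<in> pbw_upto L"
    using step(1) unfolding pbw_upto_def by (blast intro: complex_vector.span_base)
  have "u \<in> pbw_upto (K + L)" "a \<in> pbw_upto (K + L)"
    using K L pbw_upto_mono[of K "K + L"] pbw_upto_mono[of L "K + L"] by auto
  then have "c *\<^sub>C a + u \<in> pbw_upto (K + L)"
    unfolding pbw_upto_def by (intro complex_vector.span_add complex_vector.span_scale)
  then show ?case by blast
qed

section \<open>Weights under the adjoint action of d\<close>

abbreviation ad_D :: "ie_alg uea \<Rightarrow> ie_alg uea" where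
  "ad_D u \<equiv> ugen D * u - u * ugen D"

lemma ad_D_neg_word:
  "ad_D (neg_word ts * ugen D ^ k) = - of_nat (sum_list (map tree_size ts)) *\<^sub>C
    (neg_word ts * ugen D ^ k)"
proof (induction ts)
  case Nil
  show ?case by (simp add: neg_word_def power_commutes)
next
  case (Cons t ts)
  let ?w = "neg_word ts * ugen D ^ k"
  have "ad_D (ugen (Dminus t) * ?w) = ugen (Dminus t) * ad_D ?w - of_nat (tree_size t) *\<^sub>C
    (ugen (Dminus t) * ?w)"
    using arg_cong[OF D_Dminus[of t], of "\<lambda>u. u * ?w"]
    by (simp add: scaleC_mult_left algebra_simps)
  also have "\<dots> = - of_nat (sum_list (map tree_size (t # ts))) *\<^sub>C (ugen (Dminus t) * ?w)"
    unfolding Cons by (simp add: scaleC_mult_right complex_vector.scale_left_diff_distrib)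
  finally show ?case by (simp add: neg_word_Cons)
qed

text \<open>This stability is why the left ideal may belong to every level of the filtration,
  whatever weights occur in it.\<close>

lemma ad_D_left_null: "u \<in> left_null \<Longrightarrow> ad_D u \<in> left_null"
proof -
  assume "u \<in> left_null"
  then obtain v s where "u = v * ugen (Dplus s)" unfolding left_null_def by blast
  then have "ad_D u = (ugen D * v - v * (ugen D - of_nat (tree_size s) *\<^sub>C 1)) * ugen (Dplus s)"
    using Dplus_D[of s] by (simp add: left_diff_distrib mult.assoc)
  then show ?thesis unfolding left_null_def by blast
qed

lemma clinear_ad_D: "clinear ad_D"
  by (intro clinear_compose_diff clinear_mult_left clinear_mult_right)

text \<open>This removes the part of lowest weight, so an element commuting with \<open>d\<close> can be pushed
  down to \<open>pbw_upto 0\<close>.\<close>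

lemma ad_D_pbw_upto:
  assumes "u \<in> pbw_upto (Suc K)"
  shows "ad_D u + of_nat (Suc K) *\<^sub>C u \<in> pbw_upto K"
  using assms unfolding pbw_upto_def
proof (rule cspan_induct_linear[OF _ clinear_compose_add[OF clinear_ad_D clinear_compose_scale[OF
  clinear_id]]])
  let ?B = "{neg_word ts * ugen D ^ k |ts k. sum_list (map tree_size ts) \<le> K} \<union> left_null"
  fix a
  assume "a \<in> {neg_word ts * ugen D ^ k |ts k. sum_list (map tree_size ts) \<le> Suc K} \<union> left_null"
  then consider ts k where "a = neg_word ts * ugen D ^ k"
    "sum_list (map tree_size ts) \<le> Suc K" | "a \<in> left_null"
    by blast
  then show "ad_D a + of_nat (Suc K) *\<^sub>C a \<in> cspan ?B"
  proof cases
    case 1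
    have eq: "ad_D a + of_nat (Suc K) *\<^sub>C a =
      (of_nat (Suc K) - of_nat (sum_list (map tree_size ts))) *\<^sub>C a"
      unfolding 1(1) ad_D_neg_word by (simp add: complex_vector.scale_left_diff_distrib)
    show ?thesis
    proof (cases "sum_list (map tree_size ts) = Suc K")
      case True
      then show ?thesis unfolding eq by (simp add: complex_vector.span_zero)
    next
      case False
      then have "a \<in> ?B" using 1 by auto
      then show ?thesis unfolding eq by (intro complex_vector.span_scale complex_vector.span_base)
    qed
  next
    case 2
    then show ?thesis
      using ad_D_left_null by (intro complex_vector.span_add complex_vector.span_scale
        complex_vector.span_base) auto
  qed
qed

lemma pbw_upto_0_if_ad_D:
  assumes "ad_D u = 0"
  shows "u \<in> pbw_upto 0"
proof -
  have "u \<in> pbw_upto K \<Longrightarrow> u \<in> pbw_upto 0" for K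
  proof (induction K)
    case (Suc K)
    have "of_nat (Suc K) *\<^sub>C u \<in> pbw_upto K" using ad_D_pbw_upto[OF Suc.prems] assms by simp
    then have "inverse (of_nat (Suc K)) *\<^sub>C of_nat (Suc K) *\<^sub>C u \<in> pbw_upto K"
      unfolding pbw_upto_def by (rule complex_vector.span_scale)
    then have "u \<in> pbw_upto K" by (simp add: scaleC_scaleC scaleC_one del: of_nat_Suc)
    then show ?case by (rule Suc.IH)
  qed
  then show ?thesis using ex_pbw_upto by blast
qed

text \<open>A complex polynomial evaluated in any complex algebra: below, at d in the enveloping
  algebras of both Lie algebras, and at numbers.\<close>

definition polyU :: "complex poly \<Rightarrow> 'a::complex_algebra_1 \<Rightarrow> 'a" where
  "polyU q x = (\<Sum>i\<le>degree q. coeff q i *\<^sub>C x ^ i)"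

lemma polyU_upto: "degree q \<le> n \<Longrightarrow> polyU q x = (\<Sum>i\<le>n. coeff q i *\<^sub>C x ^ i)"
  unfolding polyU_def by (rule sum.mono_neutral_left) (auto simp: coeff_eq_0)

lemma polyU_add: "polyU (p + q) x = polyU p x + polyU q x"
  using degree_add_le_max[of p q]
  by (simp add: polyU_upto[of _ "max (degree p) (degree q)"] scaleC_add_left sum.distrib)

lemma polyU_monom: "polyU (Polynomial.monom c k) x = c *\<^sub>C x ^ k"
proof -
  have "polyU (Polynomial.monom c k) x = (\<Sum>i\<le>k. if k = i then c *\<^sub>C x ^ i else 0)"
    unfolding polyU_upto[OF degree_monom_le] by (intro sum.cong) auto
  then show ?thesis by simp
qed

lemma pbw_upto_0_decomp:
  assumes "u \<in> pbw_upto 0"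
  shows "\<exists>q v. v \<in> cspan left_null \<and> u = polyU q (ugen D) + v"
  using assms unfolding pbw_upto_def
proof (induction rule: complex_vector.span_induct_alt)
  case base
  show ?case
    by (intro exI[of _ 0]) (simp add: polyU_def complex_vector.span_zero)
next
  case (step c a u)
  then obtain q v where qv: "v \<in> cspan left_null" "u = polyU q (ugen D) + v" by blast
  from step(1) consider ts k where "a = neg_word ts * ugen D ^ k"
    "sum_list (map tree_size ts) \<le> 0" | "a \<in> left_null"
    by blast
  then show ?case
  proof cases
    case 1
    \<comment> \<open>Trees have positive size, so a word of total size 0 is empty.\<close>
    have "tree_size (hd ts) > 0" using tree_verts_pos by (simp add: tree_size_eq)
    then have "ts = []" using 1(2) by (cases ts) auto
    then have "c *\<^sub>C a + u = polyU (Polynomial.monom c k + q) (ugen D) + v"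
      by (simp add: 1 neg_word_def polyU_add polyU_monom qv(2))
    then show ?thesis using qv(1) by blast
  next
    case 2
    then have "c *\<^sub>C a + v \<in> cspan left_null"
      by (intro complex_vector.span_add complex_vector.span_scale qv(1) complex_vector.span_base)
    moreover have "c *\<^sub>C a + u = polyU q (ugen D) + (c *\<^sub>C a + v)" using qv(2) by simp
    ultimately show ?thesis by blast
  qed
qed

lemma center_decomp:
  assumes "z \<in> uea_center"
  obtains q v where "v \<in> cspan left_null" "z = polyU q (ugen D) + v"
proof -
  have "z * u = u * z" for u using assms by (simp add: uea_center_def)
  then have "ad_D z = 0" by simp
  from pbw_upto_0_decomp[OF pbw_upto_0_if_ad_D[OF this]] show ?thesis using that by blast
qed

lemma poly_conv_polyU: "poly q x = polyU q (x :: complex)"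
  by (simp add: poly_altdef polyU_def scaleC_complex_def)

text \<open>Starting at -n and moving away from 0, the excluded point is never met; infinitely many
  points share one value of \<open>q\<close>.\<close>

lemma poly_shift_invariant_const:
  fixes q :: "complex poly"
  assumes "n > 0" "\<And>x. x \<noteq> 0 \<Longrightarrow> poly q x = poly q (x - of_nat n)"
  shows "poly q x = poly q y"
proof -
  let ?c = "poly q (- of_nat n)"
  have "poly q (- of_nat (Suc k * n)) = ?c" for k
  proof (induction k)
    case (Suc k)
    have "- of_nat (Suc k * n) \<noteq> (0 :: complex)" using assms(1)
      by (simp del: of_nat_mult of_nat_add)
    from assms(2)[OF this] have "poly q (- of_nat (Suc (Suc k) * n)) =
      poly q (- of_nat (Suc k * n))"
      by (simp add: algebra_simps)
    then show ?case using Suc by simp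
  qed simp
  then have "range (\<lambda>k. - of_nat (Suc k * n)) \<subseteq> {x. poly (q - [:?c:]) x = 0}" by auto
  moreover have "infinite (range (\<lambda>k. - of_nat (Suc k * n) :: complex))"
  proof (rule range_inj_infinite, rule injI)
    fix j k assume "- of_nat (Suc j * n) = (- of_nat (Suc k * n) :: complex)"
    then have "Suc j * n = Suc k * n" by (simp only: neg_equal_iff_equal of_nat_eq_iff)
    then show "j = k" using assms(1) by simp
  qed
  ultimately have "infinite {x. poly (q - [:?c:]) x = 0}" using finite_subset by blast
  then have "q - [:?c:] = 0" using poly_roots_finite by blast
  then have "q = [:?c:]" by simp
  then obtain c where "q = [:c:]" by blast
  then show ?thesis by simp
qed

section \<open>The polynomial of a central element is constant\<close>

interpretation R: lie_module "ie_op l" for l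
  by (rule lie_module_ie_op)

lemma functional_polyU:
  assumes "clinear F" "\<And>m. F (R.act l m (ugen D)) = c * F m"
  shows "F (R.act l m (polyU q (ugen D))) = poly q c * F m"
proof -
  have "F (R.act l m (ugen D ^ k)) = c ^ k * F m" for k
  proof (induction k arbitrary: m)
    case 0
    show ?case by (simp add: R.act_one)
  next
    case (Suc k)
    show ?case by (simp add: R.act_mult Suc assms(2))
  qed
  then show ?thesis
    by (simp add: polyU_def clinear_sum[OF R.clinear_act] clinear_scale[OF R.clinear_act]
        clinear_sum[OF assms(1)] clinear_scale[OF assms(1)] scaleC_complex_def poly_altdef
          sum_distrib_right
        mult.assoc)
qed

lemma const_coeff_act_D: "const_coeff (R.act l m (ugen D)) = - l * const_coeff m"
  by (simp add: R.act_uea_of clinear_neg[OF clinear_const_coeff] const_coeff_hatD)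

lemma const_coeff_act_left_null:
  assumes "v \<in> cspan left_null"
  shows "const_coeff (R.act l m v) = 0"
  using assms
proof (induction rule: complex_vector.span_induct_alt)
  case base
  show ?case by (simp add: clinear_0[OF R.clinear_act] clinear_0[OF clinear_const_coeff])
next
  case (step c a u)
  then obtain w s where a: "a = w * ugen (Dplus s)" by (auto simp: left_null_def)
  have "const_coeff (R.act l m a) = 0"
    by (simp add: a R.act_mult R.act_uea_of clinear_neg[OF clinear_const_coeff] const_coeff_hatP)
  then show ?case using step
    by (simp add: clinear_add[OF R.clinear_act] clinear_scale[OF R.clinear_act]
        clinear_add[OF clinear_const_coeff] clinear_scale[OF clinear_const_coeff])
qed

text \<open>Only finitely many D+ occur in \<open>v\<close>, and the functional notices a tree only
  if it has exactly \<open>n\<close> vertices. The bound is uniform in \<open>l\<close>, so that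
  \<open>n\<close> can be fixed before \<open>l\<close> varies.\<close>

lemma ladder_form_act_left_null:
  assumes "v \<in> cspan left_null"
  shows "\<exists>N. \<forall>n\<ge>N. \<forall>l m. l \<noteq> 0 \<longrightarrow> ladder_form l n (R.act l m v) = 0"
  using assms
proof (induction rule: complex_vector.span_induct_alt)
  case base
  show ?case by (simp add: clinear_0[OF R.clinear_act] clinear_0[OF clinear_ladder_form])
next
  case (step c a u)
  then obtain w s where a: "a = w * ugen (Dplus s)" by (auto simp: left_null_def)
  obtain N where N: "\<And>n l m. n \<ge> N \<Longrightarrow> l \<noteq> 0 \<Longrightarrow> ladder_form l n (R.act l m u) = 0"
    using step by blast
  have "ladder_form l n (R.act l m a) = 0" if "n \<ge> Suc (tree_size s)" "l \<noteq> 0" for n l m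
    using that by (simp add: a R.act_mult R.act_uea_of clinear_neg[OF clinear_ladder_form]
      ladder_form_hatP
        tree_size_eq)
  then have "\<forall>n\<ge>max N (Suc (tree_size s)). \<forall>l m. l \<noteq> 0 \<longrightarrow> ladder_form l n (R.act l m (c *\<^sub>C a + u))
    = 0"
    using N by (simp add: clinear_add[OF R.clinear_act] clinear_scale[OF R.clinear_act]
        clinear_add[OF clinear_ladder_form] clinear_scale[OF clinear_ladder_form])
  then show ?case by blast
qed

lemma center_poly_const:
  assumes "polyU q (ugen D) + v \<in> uea_center" "v \<in> cspan left_null"
  shows "poly q x = poly q y"
proof -
  let ?z = "polyU q (ugen D) + v"
  obtain N where N: "\<And>n l m. n \<ge> N \<Longrightarrow> l \<noteq> 0 \<Longrightarrow> ladder_form l n (R.act l m v) = 0"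
    using ladder_form_act_left_null[OF assms(2)] by blast
  define n where "n = Suc N"
  obtain t where "ladder t" "tree_verts t = n" using ex_ladder[of n] by (auto simp: n_def)
  define s where "s = inv tree_of t"
  have s: "ladder (tree_of s)" "tree_verts (tree_of s) = n"
    using \<open>ladder t\<close> \<open>tree_verts t = n\<close> by (simp_all add: s_def)
  have "poly q (- l) = poly q (- l - of_nat n)" if l: "l \<noteq> 0" for l
  proof -
    \<comment> \<open>The sign of the right action cancels the -1 of
      \<open>ladder_form_hatP\<close>.\<close>
    have T: "ladder_form l n (R.act l m (ugen (Dplus s))) = const_coeff m" for m
      using l s by (simp add: R.act_uea_of clinear_neg[OF clinear_ladder_form] ladder_form_hatP)
    have "ladder_form l n (R.act l m (ugen D)) = (- l - of_nat n) * ladder_form l n m" for m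
      by (simp add: R.act_uea_of clinear_neg[OF clinear_ladder_form] ladder_form_hatD algebra_simps)
    from functional_polyU[OF clinear_ladder_form this]
    have z: "ladder_form l n (R.act l m ?z) = poly q (- l - of_nat n) * ladder_form l n m" for m
      using N[of n l m] l
      by (simp add: clinear_add[OF R.clinear_act] clinear_add[OF clinear_ladder_form] n_def)
    have "const_coeff (R.act l 1 ?z) = poly q (- l)"
      using functional_polyU[OF clinear_const_coeff const_coeff_act_D, of l 1 q]
      by (simp add: clinear_add[OF R.clinear_act] clinear_add[OF clinear_const_coeff]
          const_coeff_act_left_null[OF assms(2)] const_coeff_1)
    \<comment> \<open>In the right action, \<open>?z * ugen (Dplus s)\<close> applies
      \<open>?z\<close> first, so by \<open>T\<close> the constant coefficient sees it; in the
      opposite order \<open>ladder_form\<close> sees it.\<close>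
    then have "poly q (- l) = ladder_form l n (R.act l 1 (?z * ugen (Dplus s)))"
      by (simp add: R.act_mult T)
    also have "?z * ugen (Dplus s) = ugen (Dplus s) * ?z"
      using assms(1) unfolding uea_center_def by blast
    also have "ladder_form l n (R.act l 1 \<dots>) = poly q (- l - of_nat n)"
      by (simp add: R.act_mult z T const_coeff_1)
    finally show ?thesis .
  qed
  from this[of "- x" for x] have "poly q x = poly q (x - of_nat n)" if "x \<noteq> 0" for x
    using that by (metis minus_minus neg_equal_0_iff_equal)
  then show ?thesis using poly_shift_invariant_const[of n q] by (simp add: n_def)
qed

section \<open>Verma modules\<close>

lemma tensor_null_add:
  assumes "p \<in> tensor_null r l" "q \<in> tensor_null r l"
  shows "p + q \<in> tensor_null r l"
proof -
  have "0 - q \<in> tensor_null r l" using assms by (intro tensor_null.diff tensor_null.zero)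
  from tensor_null.diff[OF assms(1) this] show ?thesis by simp
qed

lemma tensor_null_neg: "p \<in> tensor_null r l \<Longrightarrow> - p \<in> tensor_null r l"
  using tensor_null.diff[OF tensor_null.zero] by fastforce

lemma equiv_tensor_rel: "equiv UNIV (tensor_rel r l)"
proof (rule equivI)
  show "refl (tensor_rel r l)" by (auto simp: refl_on_def tensor_rel_def tensor_null.zero)
  show "sym (tensor_rel r l)"
    using tensor_null_neg[of _ r l] by (fastforce simp: sym_def tensor_rel_def)
  show "trans (tensor_rel r l)"
  proof (rule transI)
    fix x y z assume "(x, y) \<in> tensor_rel r l" "(y, z) \<in> tensor_rel r l"
    then have "(x - y) + (y - z) \<in> tensor_null r l"
      unfolding tensor_rel_def by (intro tensor_null_add) auto
    then show "(x, z) \<in> tensor_rel r l" by (simp add: tensor_rel_def)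
  qed
qed auto

abbreviation tensor_mult :: "'a::ring_1 \<Rightarrow> ('a \<times> 'b \<Rightarrow>\<^sub>0 int) \<Rightarrow> ('a \<times> 'b \<Rightarrow>\<^sub>0 int)" where
  "tensor_mult u \<equiv> frag_extend (\<lambda>(a, b). frag_of (u * a, b))"

lemma tensor_mult_null:
  assumes "\<And>a s. r (u * a) s = u * r a s" "p \<in> tensor_null r l"
  shows "tensor_mult u p \<in> tensor_null r l"
  using assms(2)
proof induction
  case (add_left a a' b)
  show ?case
    using tensor_null.add_left[of "u * a" "u * a'" b r l]
    by (simp add: frag_extend_diff frag_extend_add distrib_left)
next
  case (add_right a b b')
  show ?case
    using tensor_null.add_right[of "u * a" b b' r l]
    by (simp add: frag_extend_diff frag_extend_add)
next
  case (balanced a s b)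
  show ?case
    using tensor_null.balanced[of r "u * a" s b l] by (simp add: frag_extend_diff assms(1))
next
  case zero
  show ?case by (simp add: tensor_null.zero)
next
  case (diff p q)
  then show ?case by (simp add: frag_extend_diff tensor_null.diff)
qed

text \<open>\<open>tensor_act\<close> multiplies all representatives and saturates. Left
  multiplication respects the right module structure, so the result is the class of one multiplied
  representative.\<close>

lemma tensor_act_class:
  assumes "\<And>a s. r (u * a) s = u * r a s"
  shows "tensor_act r l u (tensor_rel r l `` {p}) = tensor_rel r l `` {tensor_mult u p}"
proof (intro equalityI subsetI)
  fix y assume "y \<in> tensor_act r l u (tensor_rel r l `` {p})"
  then obtain x where x: "(p, x) \<in> tensor_rel r l" "(tensor_mult u x, y) \<in> tensor_rel r l"
    unfolding tensor_act_def by auto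
  have "(tensor_mult u p, tensor_mult u x) \<in> tensor_rel r l"
    using tensor_mult_null[where r = r and u = u and l = l and p = "p - x"] assms x(1)
      by (simp add: tensor_rel_def frag_extend_diff)
  then show "y \<in> tensor_rel r l `` {tensor_mult u p}"
    using x(2) equivE[OF equiv_tensor_rel, of r l] by (blast dest: transD)
next
  fix y assume y: "y \<in> tensor_rel r l `` {tensor_mult u p}"
  have "(p, p) \<in> tensor_rel r l" by (simp add: tensor_rel_def tensor_null.zero)
  then show "y \<in> tensor_act r l u (tensor_rel r l `` {p})"
    using y unfolding tensor_act_def by auto
qed

section \<open>The one-dimensional module over the subalgebra\<close>

lemma clinear_of_borel: "clinear of_borel"
  by (rule clinearI) (simp_all add: plus_borel_alg.rep_eq scaleC_borel_alg.rep_eq)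

lemma lie_hom_of_borel: "lie_hom (\<lambda>x. uea_of (of_borel x))"
  unfolding lie_hom_def
  by (auto simp: clinear_compose[OF clinear_uea_of clinear_of_borel] lie_bracket_borel_alg.rep_eq
    uea_of_bracket)

definition coeff_D :: "ie_alg \<Rightarrow> complex" where
  "coeff_D x = Poly_Mapping.lookup (coords x) D"

lemma clinear_coeff_D: "clinear coeff_D"
  by (rule clinearI) (simp_all add: coeff_D_def clinear_add[OF clinear_coords]
      clinear_scale[OF clinear_coords] lookup_add scaleC_poly_mapping.rep_eq)

text \<open>The coefficient of d vanishes on n+ and determines an element of the Cartan part, so the
  decomposition behind \<open>THE\<close> is unique.\<close>

lemma borel_char_eq:
  assumes "\<mu> \<in> cartan_dual"
  shows "borel_char \<mu> x = coeff_D (of_borel x) * \<mu> (ie_gen D)"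
proof -
  have cartan: "h = coeff_D h *\<^sub>C ie_gen D" if h: "h \<in> cartan" for h
  proof -
    obtain c where "h = c *\<^sub>C ie_gen D"
      using h unfolding cartan_def complex_vector.span_singleton by blast
    then show ?thesis
      by (simp add: clinear_scale[OF clinear_coeff_D]) (simp add: coeff_D_def coords_ie_gen
        scaleC_complex_def)
  qed
  have nplus: "coeff_D n = 0" if "n \<in> nplus" for n
    using that unfolding nplus_def
  proof (induction rule: complex_vector.span_induct_alt)
    case base
    show ?case by (rule clinear_0[OF clinear_coeff_D])
  next
    case (step c a u)
    then show ?case
      by (auto simp: clinear_add[OF clinear_coeff_D] clinear_scale[OF clinear_coeff_D])
        (simp add: coeff_D_def coords_ie_gen lookup_single)
  qed
  obtain h n where hn: "of_borel x = h + n" "h \<in> cartan" "n \<in> nplus"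
    using of_borel[of x] unfolding borel_def by blast
  have "(THE h. h \<in> cartan \<and> (\<exists>n\<in>nplus. of_borel x = h + n)) = h"
  proof (rule the_equality)
    show "h \<in> cartan \<and> (\<exists>n\<in>nplus. of_borel x = h + n)" using hn by blast
    fix h' assume "h' \<in> cartan \<and> (\<exists>n\<in>nplus. of_borel x = h' + n)"
    then obtain n' where h': "h' \<in> cartan" "n' \<in> nplus" "h + n = h' + n'" using hn(1) by auto
    have "coeff_D h = coeff_D h'"
      using arg_cong[OF h'(3), of coeff_D] nplus[OF hn(3)] nplus[OF h'(2)]
      by (simp add: clinear_add[OF clinear_coeff_D])
    then show "h' = h" using cartan[OF hn(2)] cartan[OF h'(1)] by metis
  qed
  moreover have "\<mu> h = coeff_D h * \<mu> (ie_gen D)"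
  proof -
    have "ie_gen D \<in> cartan" unfolding cartan_def by (simp add: complex_vector.span_base)
    then have "\<mu> (coeff_D h *\<^sub>C ie_gen D) = coeff_D h * \<mu> (ie_gen D)"
      using assms unfolding cartan_dual_def by blast
    then show ?thesis using cartan[OF hn(2)] by simp
  qed
  moreover have "coeff_D (of_borel x) = coeff_D h"
    using hn(1) nplus[OF hn(3)] by (simp add: clinear_add[OF clinear_coeff_D])
  ultimately show ?thesis unfolding borel_char_def by simp
qed

text \<open>No bracket of d and the D+ contains d. This makes \<open>borel_char\<close> a Lie
  homomorphism, as its values commute.\<close>

lemma coeff_D_bracket_borel: "coeff_D [of_borel x, of_borel y]\<^sub>L = 0"
proof -
  have keys: "b = D \<or> (\<exists>t. b = Dplus t)" if "b \<in> Poly_Mapping.keys (coords (of_borel z))" for b z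
    using borel_no_Dminus[OF of_borel[of z]] that by (cases b) (auto simp: in_keys_iff)
  have Dplus: "coeff_D (c *\<^sub>C ie_gen (Dplus t)) = 0" for c t
    unfolding clinear_scale[OF clinear_coeff_D]
      by (simp add: coeff_D_def coords_ie_gen lookup_single)
  have sum: "coeff_D (Sum_any (\<lambda>r. c r *\<^sub>C ie_gen (Dplus r))) = 0" for c
    unfolding Sum_any.expand_set clinear_sum[OF clinear_coeff_D] Dplus by simp
  have "coeff_D (ie_basis_bracket a b) = 0"
    if "a = D \<or> (\<exists>t. a = Dplus t)" "b = D \<or> (\<exists>t. b = Dplus t)" for a b
    using that by (elim disjE exE) (simp_all only: ie_basis_bracket.simps sum Dplus
      clinear_0[OF clinear_coeff_D])
  then show ?thesis
    using keys[of _ x] keys[of _ y]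
    by (simp add: lie_bracket_ie_alg_def clinear_sum[OF clinear_coeff_D]
      clinear_scale[OF clinear_coeff_D])
qed

lemma lie_hom_borel_char:
  assumes "\<mu> \<in> cartan_dual"
  shows "lie_hom (borel_char \<mu>)"
proof -
  have "clinear (borel_char \<mu>)"
    unfolding borel_char_eq[OF assms, abs_def]
    by (rule clinearI) (simp_all add: clinear_add[OF clinear_coeff_D]
      clinear_add[OF clinear_of_borel]
        clinear_scale[OF clinear_coeff_D] clinear_scale[OF clinear_of_borel] distrib_right
          scaleC_complex_def)
  moreover have "borel_char \<mu> [x, y]\<^sub>L = 0" for x y
    unfolding borel_char_eq[OF assms] lie_bracket_borel_alg.rep_eq coeff_D_bracket_borel by simp
  ultimately show ?thesis by (simp add: lie_hom_def mult.commute)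
qed

section \<open>A nonzero functional on each Verma module\<close>

lemmas borel_ract_hom = uea_extend_hom[OF lie_hom_of_borel]

lemma const_coeff_ie_op_borel:
  "const_coeff (ie_op l (of_borel x) m) = coeff_D (of_borel x) * l * const_coeff m"
proof -
  let ?p = "coords (of_borel x)"
  have "const_coeff (basis_op l b m) = (if b = D then l * const_coeff m else 0)"
    if "b \<in> Poly_Mapping.keys ?p" for b
    using borel_no_Dminus[OF of_borel[of x]] that
    by (cases b) (auto simp: in_keys_iff const_coeff_hatD const_coeff_hatP)
  then have "const_coeff (ie_op l (of_borel x) m) =
      (\<Sum>b\<in>Poly_Mapping.keys ?p. Poly_Mapping.lookup ?p b * (if b =
        D then l * const_coeff m else 0))"
    unfolding ie_op_def lin_ext_def clinear_sum[OF clinear_const_coeff]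
      clinear_scale[OF clinear_const_coeff]
    by (intro sum.cong) (simp_all add: scaleC_complex_def)
  also have "\<dots> = (\<Sum>b\<in>Poly_Mapping.keys ?p. if b = D then Poly_Mapping.lookup ?p D * l *
    const_coeff m else 0)"
    by (intro sum.cong) auto
  also have "\<dots> = coeff_D (of_borel x) * l * const_coeff m"
    by (auto simp: coeff_D_def in_keys_iff)
  finally show ?thesis .
qed

text \<open>Under the right action d multiplies the constant coefficient by -l, whence the sign in
  the choice of \<open>l\<close>.\<close>

lemma const_coeff_act_borel:
  assumes "\<mu> \<in> cartan_dual"
  defines "l \<equiv> - \<mu> (ie_gen D)"
  shows "const_coeff (R.act l m (uea_extend (\<lambda>x. uea_of (of_borel x)) w)) =
    uea_extend (borel_char \<mu>) w * const_coeff m"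
proof -
  note char = uea_extend_hom[OF lie_hom_borel_char[OF assms(1)]] and ract = borel_ract_hom
  show ?thesis
  proof (induction w rule: uea_induct)
    case zero
    show ?case
      by (simp add: clinear_0[OF ract(1)] clinear_0[OF char(1)] clinear_0[OF R.clinear_act]
          clinear_0[OF clinear_const_coeff])
  next
    case (word c xs)
    have "const_coeff (R.act l m (uea_extend (\<lambda>x. uea_of (of_borel x))
      (prod_list (map uea_of xs)))) =
      uea_extend (borel_char \<mu>) (prod_list (map uea_of xs)) * const_coeff m" for m
    proof (induction xs arbitrary: m)
      case Nil
      show ?case by (simp add: ract(3) char(3) R.act_one)
    next
      case (Cons x xs)
      have "const_coeff (R.act l m (uea_of (of_borel x))) = borel_char \<mu> x * const_coeff m"
        by (simp add: R.act_uea_of clinear_neg[OF clinear_const_coeff] const_coeff_ie_op_borel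
            borel_char_eq[OF assms(1)] l_def)
      then show ?case by (simp add: ract(2,4) char(2,4) R.act_mult Cons)
    qed
    then show ?case
      by (simp add: clinear_scale[OF ract(1)] clinear_scale[OF char(1)]
        clinear_scale[OF R.clinear_act]
          clinear_scale[OF clinear_const_coeff] scaleC_complex_def)
  next
    case (add u v)
    then show ?case
      by (simp add: clinear_add[OF ract(1)] clinear_add[OF char(1)] clinear_add[OF R.clinear_act]
          clinear_add[OF clinear_const_coeff] distrib_right)
  qed
qed

text \<open>The map u \<otimes> c to e(1 u) c, where e is the constant coefficient. By
  \<open>const_coeff_act_borel\<close> it respects the balancing relation, and it sends 1 \<otimes>
  1 to 1.\<close>

definition verma_form :: "complex \<Rightarrow> (ie_alg uea \<times> complex \<Rightarrow>\<^sub>0 int) \<Rightarrow> complex" where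
  "verma_form l p = (\<Sum>k\<in>Poly_Mapping.keys p.
     of_int (Poly_Mapping.lookup p k) * (const_coeff (R.act l 1 (fst k)) * snd k))"

lemma verma_form_diff: "verma_form l (p - q) = verma_form l p - verma_form l q"
proof -
  let ?K = "Poly_Mapping.keys p \<union> Poly_Mapping.keys q"
  have "verma_form l r = (\<Sum>k\<in>?K. of_int (Poly_Mapping.lookup r k) *
    (const_coeff (R.act l 1 (fst k)) * snd k))"
    if "Poly_Mapping.keys r \<subseteq> ?K" for r
    unfolding verma_form_def by (rule sum.mono_neutral_left) (use that in \<open>auto simp: in_keys_iff\<close>)
  then show ?thesis
    using keys_diff[of p q] by (simp add: lookup_minus left_diff_distrib sum_subtractf)
qed

lemma verma_form_zero: "verma_form l 0 = 0"
  by (simp add: verma_form_def)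

lemma verma_form_add: "verma_form l (p + q) = verma_form l p + verma_form l q"
  using verma_form_diff[of l "p + q" q] by simp

lemma verma_form_of: "verma_form l (frag_of (u, c)) = const_coeff (R.act l 1 u) * c"
  by (simp add: verma_form_def)

lemma verma_form_null:
  assumes "\<mu> \<in> cartan_dual" "p \<in> tensor_null borel_ract (borel_lact \<mu>)"
  shows "verma_form (- \<mu> (ie_gen D)) p = 0"
  using assms(2)
proof induction
  case (balanced a s b)
  show ?case
    by (simp add: verma_form_diff verma_form_of borel_ract_def borel_lact_def R.act_mult
        const_coeff_act_borel[OF assms(1)])
qed (simp_all add: verma_form_diff verma_form_add verma_form_of verma_form_zero
  clinear_add[OF R.clinear_act]
    clinear_add[OF clinear_const_coeff] algebra_simps)

lemma borel_ract_mult: "borel_ract (u * a) s = u * borel_ract a s"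
  by (simp add: borel_ract_def mult.assoc)

lemma verma_act_class:
  "verma_act \<mu> u (tensor_rel borel_ract (borel_lact \<mu>) `` {p}) =
    tensor_rel borel_ract (borel_lact \<mu>) `` {tensor_mult u p}"
  unfolding verma_act_def by (rule tensor_act_class) (rule borel_ract_mult)

lemma verma_class_eq_iff:
  "tensor_rel borel_ract (borel_lact \<mu>) `` {p} = tensor_rel borel_ract (borel_lact \<mu>) `` {q} \<longleftrightarrow>
    p - q \<in> tensor_null borel_ract (borel_lact \<mu>)"
  using eq_equiv_class_iff[OF equiv_tensor_rel UNIV_I UNIV_I, of borel_ract "borel_lact \<mu>" p q]
  by (simp add: tensor_rel_def)

lemma verma_central_value:
  assumes "\<mu> \<in> cartan_dual" "verma_act \<mu> (a *\<^sub>C 1) v = verma_act \<mu> (b *\<^sub>C 1) v"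
    "v = tensor_rel borel_ract (borel_lact \<mu>) `` {frag_of (1, 1)}"
  shows "a = b"
proof -
  have "frag_of (a *\<^sub>C 1, 1) - frag_of (b *\<^sub>C 1, 1) \<in> tensor_null borel_ract (borel_lact \<mu>)"
    using assms(2) unfolding assms(3) verma_act_class verma_class_eq_iff by simp
  from verma_form_null[OF assms(1) this] show ?thesis
    by (simp add: verma_form_diff verma_form_of clinear_scale[OF R.clinear_act] R.act_one
        clinear_scale[OF clinear_const_coeff] const_coeff_1 scaleC_complex_def)
qed

section \<open>Calculating with pure tensors\<close>

definition verma_eq :: "(ie_alg \<Rightarrow> complex) \<Rightarrow> ie_alg uea \<times> complex \<Rightarrow> ie_alg uea \<times> complex \<Rightarrow> bool"
  where
  "verma_eq \<mu> x y \<longleftrightarrow> frag_of x - frag_of y \<in> tensor_null borel_ract (borel_lact \<mu>)"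

lemma verma_eq_sym: "verma_eq \<mu> x y \<Longrightarrow> verma_eq \<mu> y x"
  unfolding verma_eq_def using tensor_null_neg by fastforce

lemma verma_eq_trans: "verma_eq \<mu> x y \<Longrightarrow> verma_eq \<mu> y z \<Longrightarrow> verma_eq \<mu> x z"
  unfolding verma_eq_def using tensor_null_add by fastforce

lemma verma_eq_borel: "verma_eq \<mu> (u * uea_extend (\<lambda>x. uea_of (of_borel x)) w, c)
    (u, uea_extend (borel_char \<mu>) w * c)"
  using tensor_null.balanced[of borel_ract u w c "borel_lact \<mu>"]
  by (simp add: verma_eq_def borel_ract_def borel_lact_def)

text \<open>The left sides share the scalar and the right sides share the first factor, so
  additivity on each side of the tensor applies once.\<close>

lemma verma_eq_add:
  assumes "verma_eq \<mu> (u, c) (u', c')" "verma_eq \<mu> (v, c) (u', b)"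
  shows "verma_eq \<mu> (u + v, c) (u', c' + b)"
proof -
  let ?N = "tensor_null borel_ract (borel_lact \<mu>)"
  have "(frag_of (u, c) - frag_of (u', c')) + (frag_of (v, c) - frag_of (u', b)) \<in> ?N"
    using assms unfolding verma_eq_def by (rule tensor_null_add)
  from tensor_null.diff[OF tensor_null_add[OF tensor_null.add_left this] tensor_null.add_right]
  have "frag_of (u + v, c) - (frag_of (u, c) + frag_of (v, c)) +
      ((frag_of (u, c) - frag_of (u', c')) + (frag_of (v, c) - frag_of (u', b))) -
      (frag_of (u', c' + b) - (frag_of (u', c') + frag_of (u', b))) \<in> ?N" .
  then show ?thesis by (simp add: verma_eq_def)
qed

text \<open>The tensor product comes from a free abelian group, so a complex scalar crosses it as
  the element \<open>a *\<^sub>C 1\<close> of the enveloping algebra of the subalgebra.\<close>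

lemma verma_eq_scale:
  assumes "\<mu> \<in> cartan_dual"
  shows "verma_eq \<mu> (a *\<^sub>C u, c) (u, a * c)"
  using verma_eq_borel[of \<mu> u "a *\<^sub>C 1" c] uea_extend_hom[OF lie_hom_borel_char[OF assms]]
    borel_ract_hom
  by (simp add: clinear_scale[OF uea_extend_hom(1)[OF lie_hom_borel_char[OF assms]]]
      clinear_scale[OF borel_ract_hom(1)] scaleC_mult_right scaleC_complex_def)

lemma of_borel_gen:
  "of_borel (to_borel (ie_gen D)) = ie_gen D" "of_borel (to_borel (ie_gen (Dplus s))) =
    ie_gen (Dplus s)"
  by (simp_all add: to_borel_inverse ie_gen_in_borel)

lemma borel_char_gen:
  assumes "\<mu> \<in> cartan_dual"
  shows "borel_char \<mu> (to_borel (ie_gen D)) = \<mu> (ie_gen D)"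
    "borel_char \<mu> (to_borel (ie_gen (Dplus s))) = 0"
  by (simp_all add: borel_char_eq[OF assms] of_borel_gen coeff_D_def coords_ie_gen lookup_single)

lemma verma_eq_left_null:
  assumes "\<mu> \<in> cartan_dual" "v \<in> cspan left_null"
  shows "verma_eq \<mu> (w * v, c) (w, 0)"
  using assms(2)
proof (induction rule: complex_vector.span_induct_alt)
  case base
  show ?case using verma_eq_scale[OF assms(1), of 0 w c] by simp
next
  case (step a x u)
  then obtain y s where x: "x = y * ugen (Dplus s)" by (auto simp: left_null_def)
  let ?b = "uea_of (to_borel (ie_gen (Dplus s)))"
  have "verma_eq \<mu> (w * y * ugen (Dplus s), d) (w * y, 0)" for d
    using verma_eq_borel[of \<mu> "w * y" ?b d]
    by (simp add: borel_ract_hom(4) of_borel_gen borel_char_gen[OF assms(1)]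
        uea_extend_hom(4)[OF lie_hom_borel_char[OF assms(1)]])
  moreover have "verma_eq \<mu> (z, 0) (w, 0)" for z
  proof -
    \<comment> \<open>All tensors with second entry 0 are zero, so the first factor may be exchanged
      freely; \<open>w\<close> is restored to fit \<open>verma_eq_add\<close>.\<close>
    have "verma_eq \<mu> (0, 0) (z, 0)" for z using verma_eq_scale[OF assms(1), of 0 z 0] by simp
    then show ?thesis using verma_eq_sym verma_eq_trans by blast
  qed
  ultimately have "verma_eq \<mu> (w * x, d) (w, 0)" for d
    unfolding x mult.assoc[symmetric] using verma_eq_trans by blast
  then have "verma_eq \<mu> (a *\<^sub>C (w * x), c) (w, 0)"
    using verma_eq_trans[OF verma_eq_scale[OF assms(1)]] by blast
  from verma_eq_add[OF this step(2)] show ?case by (simp add: distrib_left scaleC_mult_right)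
qed

lemma clinear_hom_polyU:
  assumes "clinear f" "\<And>u v. f (u * v) = f u * f v" "f 1 = 1"
  shows "f (polyU q x) = polyU q (f x)"
proof -
  have "f (x ^ i) = f x ^ i" for i by (induction i) (simp_all add: assms(2,3))
  then show ?thesis
    by (simp add: polyU_def clinear_sum[OF assms(1)] clinear_scale[OF assms(1)])
qed

lemma verma_central_action:
  assumes \<mu>: "\<mu> \<in> cartan_dual" and z: "z \<in> uea_center"
    and dec: "v \<in> cspan left_null" "z = polyU q (ugen D) + v"
  shows "verma_eq \<mu> (z * w, c) (poly q (\<mu> (ie_gen D)) *\<^sub>C w, c)"
proof -
  let ?b = "polyU q (uea_of (to_borel (ie_gen D)))"
  note char = uea_extend_hom[OF lie_hom_borel_char[OF \<mu>]]
  have "uea_extend (\<lambda>x. uea_of (of_borel x)) ?b = polyU q (ugen D)"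
    by (simp add: clinear_hom_polyU borel_ract_hom of_borel_gen)
  moreover have "uea_extend (borel_char \<mu>) ?b = poly q (\<mu> (ie_gen D))"
    by (simp add: clinear_hom_polyU char borel_char_gen[OF \<mu>] poly_conv_polyU)
  ultimately have "verma_eq \<mu> (w * polyU q (ugen D), c) (w, poly q (\<mu> (ie_gen D)) * c)"
    using verma_eq_borel[of \<mu> w ?b c] by simp
  from verma_eq_add[OF this verma_eq_left_null[OF \<mu> dec(1)]]
  have "verma_eq \<mu> (w * z, c) (w, poly q (\<mu> (ie_gen D)) * c)"
    by (simp add: dec(2) distrib_left)
  \<comment> \<open>The tensor relation only moves factors that stand on the right of
    \<open>w\<close>; centrality brings \<open>z\<close> there.\<close>
  moreover have "w * z = z * w" using z by (simp add: uea_center_def)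
  ultimately show ?thesis
    using verma_eq_trans verma_eq_sym verma_eq_scale[OF \<mu>] by metis
qed

text \<open>Every element is the class of an integral combination of pure tensors, and both actions
  are additive on representatives.\<close>

lemma verma_act_eqI:
  assumes "\<And>w c. verma_eq \<mu> (u * w, c) (u' * w, c)" "x \<in> verma \<mu>"
  shows "verma_act \<mu> u x = verma_act \<mu> u' x"
proof -
  obtain p where x: "x = tensor_rel borel_ract (borel_lact \<mu>) `` {p}"
    using assms(2) unfolding verma_def tensor_carrier_def by (blast elim: quotientE)
  have "tensor_mult u p - tensor_mult u' p \<in> tensor_null borel_ract (borel_lact \<mu>)"
  proof (rule frag_induction[of p UNIV])
    show "tensor_mult u (frag_of k) - tensor_mult u' (frag_of k) \<in> tensor_null borel_ract
      (borel_lact \<mu>)" for k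
      using assms(1)[of "fst k" "snd k"] by (cases k) (simp add: verma_eq_def)
    fix a b
    assume ab: "tensor_mult u a - tensor_mult u' a \<in> tensor_null borel_ract (borel_lact \<mu>)"
      "tensor_mult u b - tensor_mult u' b \<in> tensor_null borel_ract (borel_lact \<mu>)"
    have "tensor_mult u (a - b) - tensor_mult u' (a - b) =
      (tensor_mult u a - tensor_mult u' a) - (tensor_mult u b - tensor_mult u' b)"
      by (simp add: frag_extend_diff)
    then show "tensor_mult u (a - b) - tensor_mult u' (a - b) \<in> tensor_null borel_ract
      (borel_lact \<mu>)"
      using tensor_null.diff[OF ab] by simp
  qed (simp_all add: tensor_null.zero)
  then show ?thesis unfolding x verma_act_class verma_class_eq_iff .
qed

section \<open>The common central character\<close>

lemma ex_common_verma_character: "\<exists>\<chi>. \<forall>\<mu>\<in>cartan_dual. is_verma_character \<mu> \<chi>"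
proof -
  \<comment> \<open>The scalar is quantified before \<mu>; this order makes the character common to
    all Verma modules.\<close>
  have "\<forall>z\<in>uea_center. \<exists>a. \<forall>\<mu>\<in>cartan_dual. \<forall>w c. verma_eq \<mu> (z * w, c) (a *\<^sub>C w, c)"
  proof
    fix z :: "ie_alg uea" assume z: "z \<in> uea_center"
    obtain q v where dec: "v \<in> cspan left_null" "z = polyU q (ugen D) + v"
      using center_decomp[OF z] by blast
    have "poly q x = poly q 0" for x
      using center_poly_const[of q v x 0] z dec by simp
    then show "\<exists>a. \<forall>\<mu>\<in>cartan_dual. \<forall>w c. verma_eq \<mu> (z * w, c) (a *\<^sub>C w, c)"
      using verma_central_action[OF _ z dec] by metis
  qed
  then obtain a where a: "\<And>z \<mu> w c. z \<in> uea_center \<Longrightarrow> \<mu> \<in> cartan_dual \<Longrightarrow>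
      verma_eq \<mu> (z * w, c) (a z *\<^sub>C w, c)"
    by metis
  have "is_verma_character \<mu> (restrict a uea_center)" if "\<mu> \<in> cartan_dual" for \<mu>
    unfolding is_verma_character_def admits_central_character_def
    using a[OF _ that] by (auto intro!: verma_act_eqI simp: scaleC_mult_left)
  then show ?thesis by blast
qed

lemma is_verma_character_unique:
  assumes \<mu>: "\<mu> \<in> cartan_dual" and \<chi>: "is_verma_character \<mu> \<chi>" "is_verma_character \<mu> \<chi>'"
  shows "\<chi> = \<chi>'"
proof
  fix z
  show "\<chi> z = \<chi>' z"
  proof (cases "z \<in> uea_center")
    case True
    let ?v = "tensor_rel borel_ract (borel_lact \<mu>) `` {frag_of (1, 1)}"
    have "?v \<in> verma \<mu>" unfolding verma_def tensor_carrier_def by (simp add: quotientI)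
    then have "verma_act \<mu> (\<chi> z *\<^sub>C 1) ?v = verma_act \<mu> (\<chi>' z *\<^sub>C 1) ?v"
      using \<chi> True unfolding is_verma_character_def admits_central_character_def by metis
    then show ?thesis using verma_central_value[OF \<mu>] by blast
  next
    \<comment> \<open>Outside the center both functions are \<open>undefined\<close>.\<close>
    case False
    then show ?thesis using \<chi> unfolding is_verma_character_def by (metis PiE_E)
  qed
qed

theorem corollary4p5:
  shows "(\<forall>\<mu>\<in>cartan_dual. \<exists>!\<chi>. is_verma_character \<mu> \<chi>) \<and>
    (\<forall>\<mu>1\<in>cartan_dual. \<forall>\<mu>2\<in>cartan_dual. verma_character \<mu>1 = verma_character \<mu>2)"
proof -
  obtain \<chi> where \<chi>: "\<And>\<mu>. \<mu> \<in> cartan_dual \<Longrightarrow> is_verma_character \<mu> \<chi>"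
    using ex_common_verma_character by blast
  have "verma_character \<mu> = \<chi>" if "\<mu> \<in> cartan_dual" for \<mu>
    unfolding verma_character_def using \<chi>[OF that] is_verma_character_unique[OF that]
    by (intro the_equality) auto
  moreover have "\<exists>!\<chi>. is_verma_character \<mu> \<chi>" if "\<mu> \<in> cartan_dual" for \<mu>
    using \<chi>[OF that] is_verma_character_unique[OF that] by blast
  ultimately show ?thesis by simp
qed

end
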